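(* Let $n \ge 8$ be an even integer and let $s$ be an integer with $s^2 \equiv 1 \pmod n$ and $s \not\equiv \pm 1 \pmod n$. Let $G = \langle x,y \mid x^2 = y^{n/2},\ y^n = 1,\ yx = xy^s\rangle$. Then $${\sf d}(G) = n,\qquad \eta(G) = n+1,\qquad {\sf s}(G) = \begin{cases} 2n & \text{if } n \equiv 0 \pmod 4,\\ 3n & \text{if } n\equiv 2 \pmod 4,\end{cases}\qquad {\sf E}(G) = 3n.$$
   Context: $G$ is a group of order $2n$, with $\exp(G)=n$ if $n\equiv 0 \pmod 4$ and $\exp(G)=2n$ if $n \equiv 2\pmod 4$. A sequence over a finite group $G$ is a finite unordered list of elements of $G$ with repetition allowed (an element of the free abelian monoid on $G$); its length $|S|$ is the number of terms; a subsequence is a sub-multiset. For a sequence $S=g_1\cdots g_k$, $\pi(S)$ is the set of all products $g_{\tau(1)}\cdots g_{\tau(k)}$ over all permutations $\tau$ of $[1,k]$. $S$ is product-one if $1\in\pi(S)$; an $m$-product-one sequence is a product-one sequence of length $m$; a short product-one sequence is a product-one sequence of length between $1$ and $\exp(G)$; $S$ is product-one free if it has no nonempty product-one subsequence. Invariants: ${\sf d}(G)$ is the maximal length of a product-one free sequence over $G$; ${\sf E}(G)$ is the least $\ell$ such that every sequence of length $\ge \ell$ has a $|G|$-product-one subsequence; $\eta(G)$ is the least $\ell$ such that every sequence of length $\ge\ell$ has a short product-one subsequence; ${\sf s}(G)$ is the least $\ell$ such that every sequence of length $\ge \ell$ has an $\exp(G)$-product-one subsequence. *)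

theory Defs
  imports "HOL-Algebra.Algebra" "HOL-Library.Multiset"
begin

definition list_prod :: "('a, 'b) monoid_scheme \<Rightarrow> 'a list \<Rightarrow> 'a" where
  "list_prod G xs = foldr (\<lambda>a b. a \<otimes>\<^bsub>G\<^esub> b) xs \<one>\<^bsub>G\<^esub>"

definition prods :: "('a, 'b) monoid_scheme \<Rightarrow> 'a multiset \<Rightarrow> 'a set" where
  "prods G S = {list_prod G xs | xs. mset xs = S}"

definition seq_over :: "('a, 'b) monoid_scheme \<Rightarrow> 'a multiset \<Rightarrow> bool" where
  "seq_over G S \<longleftrightarrow> set_mset S \<subseteq> carrier G"

definition product_one :: "('a, 'b) monoid_scheme \<Rightarrow> 'a multiset \<Rightarrow> bool" where
  "product_one G S \<longleftrightarrow> \<one>\<^bsub>G\<^esub> \<in> prods G S"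

definition product_one_free :: "('a, 'b) monoid_scheme \<Rightarrow> 'a multiset \<Rightarrow> bool" where
  "product_one_free G S \<longleftrightarrow> (\<forall>T. T \<subseteq># S \<and> T \<noteq> {#} \<longrightarrow> \<not> product_one G T)"

definition group_exp :: "('a, 'b) monoid_scheme \<Rightarrow> nat" where
  "group_exp G = (LEAST k. 0 < k \<and> (\<forall>g\<in>carrier G. g [^]\<^bsub>G\<^esub> k = \<one>\<^bsub>G\<^esub>))"

definition davenport :: "('a, 'b) monoid_scheme \<Rightarrow> nat" where
  "davenport G = (GREATEST l. \<exists>S. seq_over G S \<and> product_one_free G S \<and> size S = l)"

definition E_inv :: "('a, 'b) monoid_scheme \<Rightarrow> nat" where
  "E_inv G = (LEAST l. \<forall>S. seq_over G S \<and> size S \<ge> l \<longrightarrow>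
      (\<exists>T. T \<subseteq># S \<and> size T = order G \<and> product_one G T))"

definition eta_inv :: "('a, 'b) monoid_scheme \<Rightarrow> nat" where
  "eta_inv G = (LEAST l. \<forall>S. seq_over G S \<and> size S \<ge> l \<longrightarrow>
      (\<exists>T. T \<subseteq># S \<and> 1 \<le> size T \<and> size T \<le> group_exp G \<and> product_one G T))"

definition s_inv :: "('a, 'b) monoid_scheme \<Rightarrow> nat" where
  "s_inv G = (LEAST l. \<forall>S. seq_over G S \<and> size S \<ge> l \<longrightarrow>
      (\<exists>T. T \<subseteq># S \<and> size T = group_exp G \<and> product_one G T))"

end

theory Submission
  imports Defs "HOL-Number_Theory.Cong"
begin

text \<open>
  In the exponents of \<open>y\<close>, product-one sequences become zero-sum sequences modulo \<open>n\<close> in which,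
  as soon as terms outside \<open>\<langle>y\<rangle>\<close> occur, every exponent may be multiplied by \<open>s\<close>.
  The sequences \<open>1\<close>, \<open>y\<close>, \<open>x\<close> with \<open>n - 1\<close> terms \<open>y\<close> and one term \<open>x\<close> give the lower bounds.

  For the upper bounds on the invariants d, \<open>\<eta>\<close> and, if 4 divides \<open>n\<close>, s and E, one passes to a quotient
  by a subgroup of \<open>\<langle>y\<rangle>\<close> that is still non-abelian: as \<open>s\<close> is not 1 modulo \<open>n\<close>, either \<open>s = -1\<close>
  modulo an odd prime divisor of \<open>n\<close>, or \<open>s = 1 + m / 2\<close> modulo a power \<open>m\<close> of 2 dividing \<open>n\<close>. In such
  a quotient the freedom to change signs suffices, and the Erdos-Ginzburg-Ziv theorem combines
  the blocks found there.

  If \<open>n\<close> is 2 modulo 4, put \<open>d = gcd (s - 1) n\<close> and \<open>f = n / d\<close>; as \<open>s\<close> is not -1, \<open>d \<ge> 6\<close>. Many terms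
  outside \<open>\<langle>y\<rangle>\<close>: pairs of terms of the same type that agree modulo \<open>f\<close> can be placed so that their
  contribution vanishes modulo \<open>f\<close>, and the Erdos-Ginzburg-Ziv theorem modulo \<open>d\<close> selects
  \<open>n\<close> pairs. Few terms outside \<open>\<langle>y\<rangle>\<close>: almost all of them are used, and either the exponents inside \<open>\<langle>y\<rangle>\<close> are spread enough to reach every sum, or
  almost all of them coincide modulo \<open>n / 2\<close>, and Gao's argument (central case) or a change
  of signs (non-central case) applies.
\<close>

subsection \<open>Subset sums of residues\<close>

text \<open>A recurring obstacle is that lengths are prescribed. Pairs of terms answer it:
  exchanging the two terms of a pair alters a sum but not the number of terms, so a problem of fixed
  length becomes one about subset sums of differences. Erdos-Ginzburg-Ziv itself is obtained in this
  way.

  \<open>reach\<close> lives over the integers, not over residues: the value of a block that is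
  trivial modulo \<open>m\<close> can be divided by \<open>m\<close>, and the quotients are combined
  modulo \<open>q\<close>. The bounds \<open>2 * m\<close> and \<open>m + 1\<close> of the small
  quotients keep their shape under this step and give \<open>2 * n\<close> and \<open>n + 1\<close>
  without loss.

  If \<open>n\<close> is 2 modulo 4, the exponent \<open>n div 2\<close> of \<open>x ^ 2\<close> is
  odd, so odd pairs of equal parity no longer have even value, and length \<open>2 * n\<close> is
  treated modulo \<open>n\<close> directly. The split is at \<open>n\<close> odd terms: more than
  that leaves fewer than \<open>2 * n\<close> even ones, so \<open>n\<close> pairs cannot all be
  even; at most \<open>n\<close> leaves at least \<open>2 * n\<close> even ones, enough for
  \<open>flexible_class\<close>, which asks for \<open>2 * n - 1\<close>.\<close>

definition ssums :: "int multiset \<Rightarrow> int set" where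
  "ssums D = sum_mset ` {E. E \<subseteq># D}"

definition ressums :: "nat \<Rightarrow> int multiset \<Rightarrow> int set" where
  "ressums n D = (\<lambda>z. z mod int n) ` ssums D"

definition stab :: "nat \<Rightarrow> int set \<Rightarrow> int set" where
  "stab n Rs = {t. \<forall>z\<in>Rs. (z + t) mod int n \<in> Rs}"

lemma subset_add_msetI: "T \<subseteq># M \<Longrightarrow> T \<subseteq># add_mset d M"
  by (simp add: subseteq_mset_def le_SucI)

lemma ssums_empty [simp]: "ssums {#} = {0}"
  by (auto simp: ssums_def)

lemma ssumsI: "E \<subseteq># D \<Longrightarrow> sum_mset E \<in> ssums D"
  by (auto simp: ssums_def)

lemma ssums_add_mset: "ssums (add_mset d D) = ssums D \<union> (\<lambda>z. z + d) ` ssums D"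
proof
  show "ssums (add_mset d D) \<subseteq> ssums D \<union> (\<lambda>z. z + d) ` ssums D"
  proof
    fix z assume "z \<in> ssums (add_mset d D)"
    then obtain E where E: "E \<subseteq># add_mset d D" "z = sum_mset E" by (auto simp: ssums_def)
    show "z \<in> ssums D \<union> (\<lambda>z. z + d) ` ssums D"
    proof (cases "d \<in># E")
      case True
      then obtain F where F: "E = add_mset d F" by (meson multi_member_split)
      then have "F \<subseteq># D" using E by simp
      then show ?thesis using E F by (auto simp: ssums_def algebra_simps)
    next
      case False
      then have "E \<subseteq># D"
        using E by (metis add_mset_remove_trivial diff_single_trivial subset_eq_diff_conv add_mset_add_single)
      then show ?thesis using E ssumsI by blast
    qed
  qed
  show "ssums D \<union> (\<lambda>z. z + d) ` ssums D \<subseteq> ssums (add_mset d D)"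
  proof
    fix z assume "z \<in> ssums D \<union> (\<lambda>z. z + d) ` ssums D"
    then obtain E where E: "E \<subseteq># D" "z = sum_mset E \<or> z = sum_mset E + d"
      by (auto simp: ssums_def)
    then have "E \<subseteq># add_mset d D" "add_mset d E \<subseteq># add_mset d D"
      by (simp_all add: subset_add_msetI)
    then have "sum_mset E \<in> ssums (add_mset d D)" "sum_mset (add_mset d E) \<in> ssums (add_mset d D)"
      by (auto simp only: ssumsI)
    then show "z \<in> ssums (add_mset d D)" using E by (auto simp: algebra_simps)
  qed
qed

lemma ssums_mono: "D \<subseteq># D' \<Longrightarrow> ssums D \<subseteq> ssums D'"
  by (auto simp: ssums_def intro: subset_mset.order_trans)

lemma zero_in_ssums [simp]: "0 \<in> ssums D"
  using ssumsI[of "{#}" D] by simp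

lemma finite_ssums [simp]: "finite (ssums D)"
  by (induction D) (auto simp: ssums_add_mset)

lemma finite_ressums [simp]: "finite (ressums n D)"
  by (simp add: ressums_def)

lemma ressums_mono: "D \<subseteq># D' \<Longrightarrow> ressums n D \<subseteq> ressums n D'"
  unfolding ressums_def by (intro image_mono ssums_mono)

lemma ressums_add_mset:
  "ressums n (add_mset d D) = ressums n D \<union> (\<lambda>z. (z + d) mod int n) ` ressums n D"
  unfolding ressums_def ssums_add_mset image_Un image_image by (simp add: mod_simps)

lemma zero_in_ressums [simp]: "0 \<in> ressums n D"
  unfolding ressums_def by (rule image_eqI[of _ _ 0]) auto

lemma ressums_bounds: "n > 0 \<Longrightarrow> ressums n D \<subseteq> {0..<int n}"
  by (auto simp: ressums_def)

lemma ressums_card_le: "n > 0 \<Longrightarrow> card (ressums n D) \<le> n"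
  using card_mono[OF _ ressums_bounds, of n D] by simp

lemma ressums_full:
  assumes "n > 0" "card (ressums n D) \<ge> n"
  shows "ressums n D = {0..<int n}"
  using assms ressums_card_le[of n D] ressums_bounds[of n D]
  by (intro card_subset_eq) auto

lemma ressumsE:
  assumes "z mod int n \<in> ressums n D"
  obtains E where "E \<subseteq># D" "[sum_mset E = z] (mod int n)"
  using assms by (auto simp: ressums_def ssums_def cong_def)

lemma stab_add:
  assumes "t \<in> stab n Rs" "u \<in> stab n Rs" shows "t + u \<in> stab n Rs"
proof -
  have "(z + (t + u)) mod int n \<in> Rs" if "z \<in> Rs" for z
  proof -
    have "((z + t) mod int n + u) mod int n \<in> Rs" using assms that by (auto simp: stab_def)
    then show ?thesis by (simp add: mod_simps add.assoc)
  qed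
  then show ?thesis by (simp add: stab_def)
qed

lemma stab_cong:
  assumes "t \<in> stab n Rs" "[t = u] (mod int n)" shows "u \<in> stab n Rs"
proof -
  have "(z + u) mod int n = (z + t) mod int n" for z
    using cong_add[OF cong_refl[of z] cong_sym[OF assms(2)]] by (simp add: cong_def)
  then show ?thesis using assms(1) by (simp add: stab_def)
qed

lemma stab_zero:
  assumes "Rs \<subseteq> {0..<int n}" shows "0 \<in> stab n Rs"
  using assms by (auto simp: stab_def)

lemma stab_mult:
  assumes "Rs \<subseteq> {0..<int n}" "t \<in> stab n Rs" "n > 0" shows "t * q \<in> stab n Rs"
proof -
  have nat: "t * int i \<in> stab n Rs" for i
    by (induction i) (use assms stab_zero in \<open>auto simp: algebra_simps intro: stab_add\<close>)
  have "q mod int n = int (nat (q mod int n))" using assms by simp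
  then have "t * (q mod int n) \<in> stab n Rs" using nat by metis
  moreover have "[t * (q mod int n) = t * q] (mod int n)"
    by (simp add: cong_def mod_simps)
  ultimately show ?thesis by (rule stab_cong)
qed

text \<open>The stabilizer is a subgroup of the integers that contains \<open>n\<close>, so its
  least positive member generates it and divides \<open>n\<close>.\<close>

lemma stab_generator:
  assumes Rs: "Rs \<subseteq> {0..<int n}" and n: "n > 0"
  obtains k where "k > 0" "k dvd n" "\<And>t. t \<in> stab n Rs \<longleftrightarrow> int k dvd t"
proof -
  define k where "k = (LEAST k. k > 0 \<and> int k \<in> stab n Rs)"
  have n': "int n \<in> stab n Rs"
    using stab_cong[OF stab_zero[OF Rs]] by (simp add: cong_def)
  then have k: "k > 0" "int k \<in> stab n Rs"
    using LeastI[of "\<lambda>k. k > 0 \<and> int k \<in> stab n Rs" n] n by (auto simp: k_def)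
  have "int k dvd t" if t: "t \<in> stab n Rs" for t
  proof (rule ccontr)
    assume "\<not> int k dvd t"
    then have pos: "t mod int k > 0" using k by (simp add: dvd_eq_mod_eq_0 order_le_neq_trans)
    have "t + int k * (- (t div int k)) \<in> stab n Rs"
      by (intro stab_add t stab_mult Rs k n)
    then have "t mod int k \<in> stab n Rs" by (simp add: minus_mult_div_eq_mod)
    then have "nat (t mod int k) > 0 \<and> int (nat (t mod int k)) \<in> stab n Rs" using pos by auto
    then have "k \<le> nat (t mod int k)" unfolding k_def by (rule Least_le)
    moreover have "t mod int k < int k" using k by simp
    ultimately show False using pos by (simp add: le_nat_iff)
  qed
  moreover have "t \<in> stab n Rs" if "int k dvd t" for t
    using that stab_mult[OF Rs k(2) n] by (auto elim: dvdE)
  ultimately have iff: "t \<in> stab n Rs \<longleftrightarrow> int k dvd t" for t by blast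
  then have "k dvd n" using n' by simp
  then show ?thesis using that k(1) iff by blast
qed

lemma ressums_grow:
  assumes n: "n > 0" and "d \<notin> stab n (ressums n D)"
  shows "card (ressums n (add_mset d D)) > card (ressums n D)"
proof -
  obtain z where z: "z \<in> ressums n D" "(z + d) mod int n \<notin> ressums n D"
    using assms by (auto simp: stab_def)
  then have "ressums n D \<subset> ressums n (add_mset d D)" by (auto simp: ressums_add_mset)
  then show ?thesis by (rule psubset_card_mono[rotated]) simp
qed

lemma ressums_stable:
  assumes n: "n > 0" and "d \<in> stab n (ressums n D)"
  shows "ressums n (add_mset d D) = ressums n D"
  using assms by (auto simp: ressums_add_mset stab_def)

text \<open>With congruences between actual subset sums, later arguments avoid canonical
  residues.\<close>

lemma stab_ressums_iff:
  "t \<in> stab n (ressums n D) \<longleftrightarrow> (\<forall>z\<in>ssums D. \<exists>w\<in>ssums D. [z + t = w] (mod int n))"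
  unfolding stab_def ressums_def mem_Collect_eq ball_simps image_iff cong_def by (simp add: mod_add_left_eq)

lemma stab_ressums_add:
  assumes "t \<in> stab n (ressums n D)"
  shows "t \<in> stab n (ressums n (add_mset d D))"
  unfolding stab_ressums_iff
proof
  fix z assume "z \<in> ssums (add_mset d D)"
  then consider "z \<in> ssums D" | y where "y \<in> ssums D" "z = y + d"
    by (auto simp: ssums_add_mset)
  then show "\<exists>w\<in>ssums (add_mset d D). [z + t = w] (mod int n)"
  proof cases
    case 1
    then show ?thesis using assms by (auto simp: stab_ressums_iff ssums_add_mset)
  next
    case 2
    then obtain w where "w \<in> ssums D" "[y + t = w] (mod int n)"
      using assms by (auto simp: stab_ressums_iff)
    then have "w + d \<in> ssums (add_mset d D)" "[z + t = w + d] (mod int n)"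
      using 2 cong_add[of "y + t" w "int n" d d] by (auto simp: ssums_add_mset algebra_simps)
    then show ?thesis by blast
  qed
qed

lemma stab_ressums_mono:
  assumes "D \<subseteq># D'" "t \<in> stab n (ressums n D)"
  shows "t \<in> stab n (ressums n D')"
proof -
  have "t \<in> stab n (ressums n (D + F))" for F
    by (induction F) (use assms stab_ressums_add in auto)
  then show ?thesis using assms(1) by (metis subset_mset.add_diff_inverse)
qed

text \<open>Stabilizers only grow when terms are added, so one that is trivial at the end was
  trivial throughout. Hence every term not divisible by \<open>n\<close> strictly enlarged the set
  of sums when it was added.\<close>

lemma card_ressums_trivial_stab:
  assumes "n > 0" "\<And>t. t \<in> stab n (ressums n D) \<Longrightarrow> int n dvd t"
  shows "card (ressums n D) \<ge> 1 + size (filter_mset (\<lambda>d. \<not> int n dvd d) D)"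
  using assms(2)
proof (induction D)
  case empty
  then show ?case by (simp add: ressums_def)
next
  case (add d D)
  have IH: "card (ressums n D) \<ge> 1 + size (filter_mset (\<lambda>d. \<not> int n dvd d) D)"
    using add stab_ressums_add by blast
  show ?case
  proof (cases "int n dvd d")
    case True
    then show ?thesis using IH card_mono[OF _ ressums_mono[of D "add_mset d D" n]]
      by (simp add: subset_mset.le_add_same_cancel1)
  next
    case False
    then have "d \<notin> stab n (ressums n D)" using add.prems stab_ressums_add by blast
    from ressums_grow[OF assms(1) this] show ?thesis using IH False by simp
  qed
qed

text \<open>Kneser's theorem for sums of two-element sets.\<close>

lemma kneser_ressums:
  assumes n: "n > 0" and k: "k > 0" "k dvd n" "\<And>t. t \<in> stab n (ressums n D) \<longleftrightarrow> int k dvd t"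
  shows "card (ressums k D) \<ge> 1 + size (filter_mset (\<lambda>d. \<not> int k dvd d) D)"
proof (rule card_ressums_trivial_stab[OF k(1)])
  fix t assume t: "t \<in> stab k (ressums k D)"
  \<comment> \<open>The sums modulo \<open>n\<close> are a union of classes modulo \<open>k\<close>,
    so a shift that respects the sums modulo \<open>k\<close> respects those modulo
    \<open>n\<close>. Thus the image modulo \<open>k\<close> has trivial stabilizer.\<close>
  have "t \<in> stab n (ressums n D)"
    unfolding stab_ressums_iff
  proof
    fix z assume "z \<in> ssums D"
    then obtain w where w: "w \<in> ssums D" "[z + t = w] (mod int k)"
      using t by (auto simp: stab_ressums_iff)
    then have "int k dvd z + t - w" by (simp add: cong_iff_dvd_diff)
    then have "z + t - w \<in> stab n (ressums n D)" using k by simp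
    then obtain w' where "w' \<in> ssums D" "[w + (z + t - w) = w'] (mod int n)"
      using w unfolding stab_ressums_iff by blast
    then show "\<exists>w\<in>ssums D. [z + t = w] (mod int n)" by auto
  qed
  then show "int k dvd t" using k by simp
qed

lemma ressums_full_if_stab_one:
  assumes "n > 0" "1 \<in> stab n (ressums n D)"
  shows "z mod int n \<in> ressums n D"
proof -
  have "1 * z \<in> stab n (ressums n D)"
    using assms ressums_bounds by (intro stab_mult) auto
  then have "\<forall>w\<in>ressums n D. (w + z) mod int n \<in> ressums n D" by (simp add: stab_def)
  from bspec[OF this zero_in_ressums] show ?thesis by simp
qed

text \<open>A prime allows two stabilizers only: everything, or the trivial one, and then Kneser's
  bound already yields \<open>p\<close> residues.\<close>

lemma ressums_full_prime:
  assumes p: "Factorial_Ring.prime p" and "size (filter_mset (\<lambda>d. \<not> int p dvd d) D) \<ge> p - 1"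
  shows "z mod int p \<in> ressums p D"
proof -
  have p0: "p > 0" using p prime_gt_0_nat by auto
  obtain k where k: "k > 0" "k dvd p" "\<And>t. t \<in> stab p (ressums p D) \<longleftrightarrow> int k dvd t"
    using stab_generator[OF ressums_bounds[OF p0] p0] by metis
  then consider "k = 1" | "k = p" using p by (metis One_nat_def prime_nat_iff)
  then show ?thesis
  proof cases
    case 1
    then show ?thesis using ressums_full_if_stab_one p0 k(3)[of 1] by auto
  next
    case 2
    then have "card (ressums p D) \<ge> p" using kneser_ressums[OF p0 k] assms p0 by simp
    from ressums_full[OF p0 this] show ?thesis using p0 by simp
  qed
qed

text \<open>Cauchy-Davenport for a sum of sets \<open>{0, d}\<close>, from the same
  dichotomy.\<close>

lemma card_ressums_prime:
  assumes p: "Factorial_Ring.prime p" and "\<And>d. d \<in># D \<Longrightarrow> \<not> int p dvd d"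
  shows "card (ressums p D) \<ge> min p (1 + size D)"
proof -
  have p0: "p > 0" using p prime_gt_0_nat by auto
  obtain k where k: "k > 0" "k dvd p" "\<And>t. t \<in> stab p (ressums p D) \<longleftrightarrow> int k dvd t"
    using stab_generator[OF ressums_bounds[OF p0] p0] by metis
  then consider "k = 1" | "k = p" using p by (metis One_nat_def prime_nat_iff)
  then show ?thesis
  proof cases
    case 1
    have "ressums p D = {0..<int p}"
    proof
      show "{0..<int p} \<subseteq> ressums p D"
      proof
        fix z assume "z \<in> {0..<int p}"
        then show "z \<in> ressums p D"
          using ressums_full_if_stab_one[OF p0, of D z] k(3)[of 1] 1 by auto
      qed
    qed (use ressums_bounds p0 in blast)
    then show ?thesis by simp
  next
    case 2
    have "filter_mset (\<lambda>d. \<not> int p dvd d) D = D" using assms(2) by (auto simp: filter_mset_eq_conv)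
    then show ?thesis using kneser_ressums[OF p0 k] 2 by simp
  qed
qed

section \<open>Zero-sum free sequences and the Davenport constant of a cyclic group\<close>

definition zero_sum_free :: "nat \<Rightarrow> int multiset \<Rightarrow> bool" where
  "zero_sum_free n M \<longleftrightarrow> (\<forall>T. T \<subseteq># M \<and> T \<noteq> {#} \<longrightarrow> \<not> int n dvd sum_mset T)"

lemma zero_sum_freeD: "zero_sum_free n M \<Longrightarrow> T \<subseteq># M \<Longrightarrow> T \<noteq> {#} \<Longrightarrow> \<not> int n dvd sum_mset T"
  by (simp add: zero_sum_free_def)

lemma stab_contains_neg:
  assumes Rs: "Rs \<subseteq> {0..<int n}" and n: "n > 0" and "t \<in> stab n Rs" "0 \<in> Rs"
  shows "(- t) mod int n \<in> Rs"
  using stab_mult[OF Rs assms(3) n, of "-1"] assms(4) by (auto simp: stab_def)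

text \<open>Each new term \<open>d\<close> enlarges the set of sums. If it stabilized them,
  \<open>- d\<close> would be a subset sum too, because 0 is one, and adding \<open>d\<close> to
  that subset would give a nonempty zero sum.\<close>

lemma zero_sum_free_card:
  assumes n: "n > 0" and "zero_sum_free n M"
  shows "card (ressums n M) \<ge> 1 + size M"
  using assms(2)
proof (induction M)
  case empty
  then show ?case by (simp add: ressums_def)
next
  case (add d M)
  have "zero_sum_free n M"
    unfolding zero_sum_free_def
    using zero_sum_freeD[OF add.prems] subset_add_msetI by metis
  moreover have "d \<notin> stab n (ressums n M)"
  proof
    assume "d \<in> stab n (ressums n M)"
    then have "(- d) mod int n \<in> ressums n M"
      using stab_contains_neg[OF ressums_bounds[OF n] n] zero_in_ressums by blast
    then obtain E where E: "E \<subseteq># M" "[sum_mset E = - d] (mod int n)" by (rule ressumsE)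
    have "int n dvd sum_mset E - - d" using E(2) by (simp only: cong_iff_dvd_diff)
    then have dvd: "int n dvd sum_mset (add_mset d E)" by (simp add: add.commute)
    have "add_mset d E \<subseteq># add_mset d M" using E(1) by simp
    from zero_sum_freeD[OF add.prems this] dvd show False by simp
  qed
  ultimately have "card (ressums n M) \<ge> 1 + size M"
    "card (ressums n (add_mset d M)) > card (ressums n M)"
    using add.IH ressums_grow[OF n, of d M] by blast+
  then show ?case by simp
qed

lemma davenport_cyclic:
  assumes n: "n > 0" and "size M \<ge> n"
  obtains T where "T \<subseteq># M" "T \<noteq> {#}" "int n dvd sum_mset T"
proof -
  have "\<not> zero_sum_free n M"
    using zero_sum_free_card[OF n, of M] ressums_card_le[OF n, of M] assms by linarith
  then obtain T where "T \<subseteq># M" "T \<noteq> {#}" "int n dvd sum_mset T"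
    unfolding zero_sum_free_def by blast
  then show ?thesis by (rule that)
qed

lemma large_zero_sum:
  assumes n: "n > 0"
  obtains T where "T \<subseteq># M" "int n dvd sum_mset T" "size T + n \<ge> size M + 1"
proof -
  have "\<exists>T. T \<subseteq># M \<and> int n dvd sum_mset T \<and> size T + n \<ge> size M + 1"
  proof (induction "size M" arbitrary: M rule: less_induct)
    case less
    show ?case
    proof (cases "size M < n")
      case True
      then show ?thesis by (intro exI[of _ "{#}"]) auto
    next
      case False
      then obtain T where T: "T \<subseteq># M" "T \<noteq> {#}" "int n dvd sum_mset T"
        using davenport_cyclic[OF n, of M] by auto
      then have sz: "size (M - T) + size T = size M" 
        by (simp add: size_Diff_submset size_mset_mono)
      then have "size (M - T) < size M" using T by (simp add: nonempty_has_size)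
      then obtain U where U: "U \<subseteq># M - T" "int n dvd sum_mset U" "size U + n \<ge> size (M - T) + 1"
        using less by metis
      have "T + U \<subseteq># T + (M - T)" using U(1) by simp
      then have "T + U \<subseteq># M" using T(1) by simp
      then show ?thesis using T U sz by (intro exI[of _ "T + U"]) auto
    qed
  qed
  then show ?thesis using that by blast
qed

subsection \<open>Flexible families of pairs\<close>

lemma pigeonhole_mset:
  assumes "size M > card (f ` set_mset M)"
  obtains a b where "{#a, b#} \<subseteq># M" "f a = f b"
proof -
  have "\<exists>a b. {#a, b#} \<subseteq># M \<and> f a = f b"
  proof (rule ccontr)
    assume no: "\<not> ?thesis"
    have cnt: "count M a \<le> 1" for a
    proof (rule ccontr)
      assume "\<not> count M a \<le> 1"
      then have "{#a, a#} \<subseteq># M" by (auto simp: subseteq_mset_def)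
      then show False using no by blast
    qed
    have "inj_on f (set_mset M)"
    proof (rule inj_onI, rule ccontr)
      fix a b assume ab: "a \<in># M" "b \<in># M" "f a = f b" "a \<noteq> b"
      then have "{#a, b#} \<subseteq># M" by (simp add: insert_subset_eq_iff in_diff_count)
      then show False using no ab by blast
    qed
    then have "card (f ` set_mset M) = card (set_mset M)" by (rule card_image)
    moreover have "size M = card (set_mset M)"
    proof -
      have "size M = (\<Sum>a\<in>set_mset M. count M a)" by (simp add: size_multiset_overloaded_eq)
      also have "\<dots> = (\<Sum>a\<in>set_mset M. 1)"
        using cnt by (intro sum.cong) (auto simp: le_Suc_eq count_eq_zero_iff)
      finally show ?thesis by simp
    qed
    ultimately show False using assms by simp
  qed
  then show ?thesis using that by blast
qed

lemma subset_mset_sizeE: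
  assumes "n \<le> size M"
  obtains T where "T \<subseteq># M" "size T = n"
proof -
  have "\<exists>T. T \<subseteq># M \<and> size T = n" using assms
  proof (induction M arbitrary: n)
    case empty
    then show ?case by auto
  next
    case (add x M)
    show ?case
    proof (cases "n \<le> size M")
      case True
      then show ?thesis using add.IH subset_add_msetI by metis
    next
      case False
      then have "n = size (add_mset x M)" using add.prems by simp
      then show ?thesis by blast
    qed
  qed
  then show ?thesis using that by blast
qed

lemma subset_image_msetE:
  assumes "E \<subseteq># image_mset f M"
  obtains T where "T \<subseteq># M" "E = image_mset f T"
proof -
  have "image_mset f M = E + (image_mset f M - E)" using assms by simp
  then obtain B C where "M = B + C" "E = image_mset f B" by (metis image_mset_eq_plusD)
  then show ?thesis using that[of B] by simp
qed

definition pair_mset :: "('a \<times> 'a) multiset \<Rightarrow> 'a multiset" where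
  "pair_mset P = image_mset fst P + image_mset snd P"

text \<open>Taking the second instead of the first term of a pair changes a sum by this difference
  and keeps the number of terms.\<close>

definition pair_diffs :: "(int \<times> int) multiset \<Rightarrow> int multiset" where
  "pair_diffs P = image_mset (\<lambda>(a, b). b - a) P"

lemma pair_mset_simps [simp]:
  "pair_mset {#} = {#}"
  "pair_mset (add_mset p P) = add_mset (fst p) (add_mset (snd p) (pair_mset P))"
  "pair_mset (P + Q) = pair_mset P + pair_mset Q"
  "size (pair_mset P) = 2 * size P"
  by (simp_all add: pair_mset_def)

lemma pair_mset_mono: "P \<subseteq># Q \<Longrightarrow> pair_mset P \<subseteq># pair_mset Q"
  by (simp add: pair_mset_def image_mset_subseteq_mono subset_mset.add_mono)

lemma pair_mset_le: "P \<subseteq># Q \<Longrightarrow> pair_mset P \<subseteq># pair_mset Q + L"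
  using pair_mset_mono by (meson mset_subset_eq_add_left subset_mset.order_trans)

lemma pair_diffs_simps [simp]:
  "pair_diffs {#} = {#}"
  "pair_diffs (add_mset p P) = add_mset (snd p - fst p) (pair_diffs P)"
  "size (pair_diffs P) = size P"
  by (simp_all add: pair_diffs_def case_prod_unfold)

text \<open>Pairs with equal value under \<open>f\<close> are removed until none is left; the
  remainder has at most one term for each value.\<close>

lemma pairing:
  fixes M :: "'a multiset"
  obtains P L where "M = pair_mset P + L" "\<And>p. p \<in># P \<Longrightarrow> f (fst p) = f (snd p)"
    "\<And>a b. {#a, b#} \<subseteq># L \<Longrightarrow> f a \<noteq> f b" "size L \<le> card (f ` set_mset L)"
proof -
  have "\<exists>P L. M = pair_mset P + L \<and> (\<forall>p\<in>#P. f (fst p) = f (snd p)) \<and>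
    (\<forall>a b. {#a, b#} \<subseteq># L \<longrightarrow> f a \<noteq> f b)"
  proof (induction "size M" arbitrary: M rule: less_induct)
    case less
    show ?case
    proof (cases "\<exists>a b. {#a, b#} \<subseteq># M \<and> f a = f b")
      case True
      then obtain a b where ab: "{#a, b#} \<subseteq># M" "f a = f b" by blast
      then have M: "M = (M - {#a, b#}) + {#a, b#}" by (metis subset_mset.diff_add)
      then have "size M = size (M - {#a, b#}) + 2"
        by (metis size_union size_add_mset size_empty add_2_eq_Suc' numeral_2_eq_2)
      then obtain P L where PL: "M - {#a, b#} = pair_mset P + L" "\<forall>p\<in>#P. f (fst p) = f (snd p)"
        "\<forall>a b. {#a, b#} \<subseteq># L \<longrightarrow> f a \<noteq> f b"
        using less[of "M - {#a, b#}"] by auto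
      have "M = pair_mset (add_mset (a, b) P) + L" using M PL(1) by simp
      moreover have "\<forall>p\<in>#add_mset (a, b) P. f (fst p) = f (snd p)" using PL(2) ab(2) by simp
      ultimately show ?thesis using PL(3) by blast
    next
      case False
      then show ?thesis by (intro exI[of _ "{#}"] exI[of _ M]) auto
    qed
  qed
  then obtain P L where *: "M = pair_mset P + L" "\<forall>p\<in>#P. f (fst p) = f (snd p)"
    "\<forall>a b. {#a, b#} \<subseteq># L \<longrightarrow> f a \<noteq> f b" by blast
  have "size L \<le> card (f ` set_mset L)"
  proof (rule ccontr)
    assume "\<not> ?thesis"
    then have "size L > card (f ` set_mset L)" by simp
    then obtain a b where "{#a, b#} \<subseteq># L" "f a = f b" by (rule pigeonhole_mset)
    then show False using *(3) by blast
  qed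
  then show ?thesis using * that by blast
qed

text \<open>Each pair holds at most one \<open>Q\<close> term, and a pair that holds one is counted
  on the right. In its use, \<open>Q\<close> means outside a coset, and the right side counts pairs
  split by the stabilizer.\<close>

lemma size_filter_pair_mset_le:
  assumes "\<And>p. p \<in># P \<Longrightarrow> \<not> (Q (fst p) \<and> Q (snd p))"
    and "\<And>p. p \<in># P \<Longrightarrow> Q (fst p) \<noteq> Q (snd p) \<Longrightarrow> S (snd p - fst p)"
  shows "size (filter_mset Q (pair_mset P)) \<le> size (filter_mset S (pair_diffs P))"
  using assms
proof (induction P)
  case (add p P)
  have IH: "size (filter_mset Q (pair_mset P)) \<le> size (filter_mset S (pair_diffs P))"
    by (rule add.IH) (use add.prems in auto)
  have "\<not> (Q (fst p) \<and> Q (snd p))" "Q (fst p) \<noteq> Q (snd p) \<Longrightarrow> S (snd p - fst p)"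
    using add.prems by auto
  then show ?case using IH by auto
qed simp

abbreviation residue_class :: "nat \<Rightarrow> int \<Rightarrow> int multiset \<Rightarrow> int multiset" where
  "residue_class k c M \<equiv> filter_mset (\<lambda>r. [r = c] (mod int k)) M"

abbreviation off_class :: "nat \<Rightarrow> int \<Rightarrow> int multiset \<Rightarrow> int multiset" where
  "off_class k c M \<equiv> filter_mset (\<lambda>r. \<not> [r = c] (mod int k)) M"

lemma card_multiples_le:
  assumes "k > 0" "k dvd n" "n > 0" "finite A" "\<And>r. r \<in> A \<Longrightarrow> [r = r0] (mod int k)"
  shows "card ((\<lambda>r. r mod int n) ` A) \<le> n div k"
proof -
  let ?f = "\<lambda>i. (r0 + int k * int i) mod int n"
  obtain j where j: "n = k * j" using assms by auto
  have "(\<lambda>r. r mod int n) ` A \<subseteq> ?f ` {..<n div k}"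
  proof
    fix z assume "z \<in> (\<lambda>r. r mod int n) ` A"
    then obtain r where r: "[r = r0] (mod int k)" "z = r mod int n" using assms by blast
    then have "int k dvd r - r0" by (simp add: cong_iff_dvd_diff)
    then obtain q where "r - r0 = int k * q" by (rule dvdE)
    then have q: "r = r0 + int k * q" by simp
    have j0: "j > 0" using j assms(3) by (cases j) auto
    define i where "i = nat (q mod int j)"
    have i: "i < j" "int i = q mod int j" using j0 by (auto simp: i_def nat_less_iff)
    have "int k * (q mod int j) = (int k * q) mod (int k * int j)"
      by (simp only: mult_mod_right)
    then have e: "int k * int i = (int k * q) mod int n" by (simp only: i(2) j of_nat_mult)
    have "?f i = (r0 + int k * q) mod int n" unfolding e by (rule mod_add_right_eq)
    then have "?f i = z" by (simp only: r(2) q)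
    then show "z \<in> ?f ` {..<n div k}" using i(1) j assms(1) by auto
  qed
  from card_mono[OF _ this] card_image_le[of "{..<n div k}" ?f] show ?thesis by simp
qed

text \<open>Among the families of disjoint pairs take one whose sums \<open>Rs\<close> are as many as possible, then one
  with as many pairs as possible that are split by the stabilizer of \<open>Rs\<close>, then a smallest one.
  If \<open>Rs\<close> is not everything, the terms outside the family lie in a single coset of the stabilizer,
  and some pair \<open>(a, b)\<close> avoids this coset. Exchanging it for \<open>(a, m1)\<close> and \<open>(m2, b)\<close>, where
  \<open>m1\<close> and \<open>m2\<close> are congruent unused terms, contradicts the choice.\<close>

lemma full_pairs:
  assumes n: "n > 0" and sz: "size R + 2 \<ge> 2 * n"
    and out: "\<And>k c. k dvd n \<Longrightarrow> k > 1 \<Longrightarrow> size (off_class k c R) + 1 \<ge> k"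
  obtains P where "pair_mset P \<subseteq># R" "size P < n" "\<And>z. z mod int n \<in> ressums n (pair_diffs P)"
proof -
  let ?Rs = "\<lambda>P. ressums n (pair_diffs P)"
  define spl where "spl = (\<lambda>P. size (filter_mset (\<lambda>d. d \<notin> stab n (?Rs P)) (pair_diffs P)))"
  have bnd: "spl P \<le> size R" if "pair_mset P \<subseteq># R" for P
  proof -
    have "spl P \<le> size (pair_diffs P)" unfolding spl_def by (rule size_filter_mset_lesseq)
    also have "\<dots> \<le> size R" using size_mset_mono[OF that] by simp
    finally show ?thesis .
  qed
  have "\<exists>P. pair_mset P \<subseteq># R \<and> (\<forall>Q. pair_mset Q \<subseteq># R \<longrightarrow> card (?Rs Q) \<le> card (?Rs P))"
    by (rule ex_has_greatest_nat[of _ "{#}" _ "Suc n"]) (auto simp: less_Suc_eq_le ressums_card_le n)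
  then obtain P1 where P1: "pair_mset P1 \<subseteq># R" "\<And>Q. pair_mset Q \<subseteq># R \<Longrightarrow> card (?Rs Q) \<le> card (?Rs P1)"
    by blast
  let ?B = "\<lambda>P. pair_mset P \<subseteq># R \<and> card (?Rs P) = card (?Rs P1)"
  have "\<exists>P. ?B P \<and> (\<forall>Q. ?B Q \<longrightarrow> spl Q \<le> spl P)"
    by (rule ex_has_greatest_nat[of _ P1 _ "Suc (size R)"]) (use P1 bnd in \<open>auto simp: less_Suc_eq_le\<close>)
  then obtain P2 where P2: "?B P2" "\<And>Q. ?B Q \<Longrightarrow> spl Q \<le> spl P2" by blast
  let ?C = "\<lambda>P. ?B P \<and> spl P = spl P2"
  have "\<exists>P. ?C P \<and> (\<forall>Q. ?C Q \<longrightarrow> size P \<le> size Q)"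
    by (rule ex_has_least_nat) (use P2 in blast)
  then obtain P where P: "?C P" "\<And>Q. ?C Q \<Longrightarrow> size P \<le> size Q" by blast
  define D where "D = pair_diffs P"
  define Rs where "Rs = ressums n D"
  have maxX: "card (ressums n (pair_diffs Q)) \<le> card Rs" if "pair_mset Q \<subseteq># R" for Q
    using P1(2)[OF that] P(1) by (simp add: Rs_def D_def)
  obtain k where k: "k > 0" "k dvd n" "\<And>t. t \<in> stab n Rs \<longleftrightarrow> int k dvd t"
    using stab_generator[OF ressums_bounds[OF n] n] unfolding Rs_def by metis
  have kn: "card (ressums k D) \<ge> 1 + size (filter_mset (\<lambda>d. \<not> int k dvd d) D)"
    by (rule kneser_ressums[OF n k(1,2)]) (use k(3) in \<open>simp add: Rs_def\<close>)
  define Dns where "Dns = filter_mset (\<lambda>d. int k dvd d) D"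
  \<comment> \<open>Dropping a pair that changes neither the sums nor \<open>spl\<close> would
    contradict the minimal size of \<open>P\<close>. So every difference divisible by
    \<open>k\<close> still enlarges the sums of the others; these sums are multiples of
    \<open>k\<close>, which bounds their number by \<open>n div k\<close>.\<close>
  have grow: "card (ressums n E) \<ge> 1 + size E" if "E \<subseteq># Dns" for E
    using that
  proof (induction E)
    case empty
    then show ?case by (simp add: ressums_def)
  next
    case (add d E)
    have EDns: "E \<subseteq># Dns" using add.prems by (rule subset_mset.order_trans[OF _ , rotated]) simp
    have ED: "add_mset d E \<subseteq># D"
      using add.prems unfolding Dns_def by (meson multiset_filter_subset subset_mset.order_trans)
    have kd: "int k dvd d"
      using add.prems unfolding Dns_def by (auto dest!: mset_subset_eq_insertD)
    have "d \<notin> stab n (ressums n E)"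
    proof
      assume d: "d \<in> stab n (ressums n E)"
      have "d \<in># D" using ED by (simp add: insert_subset_eq_iff)
      then obtain p where p: "p \<in># P" "d = snd p - fst p"
        by (auto simp: D_def pair_diffs_def case_prod_unfold)
      then obtain P' where P': "P = add_mset p P'" by (meson multi_member_split)
      have D: "D = add_mset d (pair_diffs P')" using p P' by (simp add: D_def)
      then have "E \<subseteq># pair_diffs P'" using ED by simp
      then have "d \<in> stab n (?Rs P')" using d by (rule stab_ressums_mono)
      then have Rs': "Rs = ?Rs P'" using ressums_stable[OF n] D by (simp add: Rs_def)
      have "pair_mset P' \<subseteq># pair_mset P" using P' by (intro pair_mset_mono) simp
      then have "?B P'" using P(1) Rs' by (auto simp: Rs_def D_def)
      moreover have "spl P' = spl P"
        using Rs' D k(3)[of d] kd unfolding spl_def Rs_def by (simp add: D_def)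
      ultimately have "?C P'" using P(1) by simp
      from P(2)[OF this] show False using P' by simp
    qed
    from ressums_grow[OF n this] add.IH[OF EDns] show ?case by simp
  qed
  have Dns: "size Dns + 1 \<le> n div k"
  proof -
    let ?A = "ssums Dns"
    have "[r = 0] (mod int k)" if "r \<in> ?A" for r
    proof -
      obtain E where "E \<subseteq># Dns" "r = sum_mset E" using \<open>r \<in> ?A\<close> by (auto simp: ssums_def)
      then have "\<forall>d\<in>#E. int k dvd d" by (auto simp: Dns_def dest!: mset_subset_eqD)
      then have "int k dvd sum_mset E" by (induction E) auto
      then show ?thesis using \<open>r = sum_mset E\<close> by (simp add: cong_0_iff)
    qed
    then have "card ((\<lambda>r. r mod int n) ` ?A) \<le> n div k"
      by (intro card_multiples_le[OF k(1,2) n]) auto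
    then show ?thesis using grow[of Dns] by (simp add: ressums_def)
  qed
  have szP: "size P = size Dns + size (filter_mset (\<lambda>d. \<not> int k dvd d) D)"
  proof -
    have "size P = size D" by (simp add: D_def)
    also have "D = Dns + filter_mset (\<lambda>d. \<not> int k dvd d) D"
      unfolding Dns_def by (rule multiset_partition)
    finally show ?thesis by (metis size_union)
  qed
  show ?thesis
  proof (cases "k = 1")
    case True
    then have "size P < n" using szP Dns by simp
    moreover have "z mod int n \<in> ressums n (pair_diffs P)" for z
      using ressums_full_if_stab_one[OF n] k(3)[of 1] True unfolding Rs_def D_def by simp
    ultimately show ?thesis using that[of P] P(1) by blast
  next
    case False
    then have k1: "k > 1" using k(1) by simp
    \<comment> \<open>The sums modulo \<open>n\<close> are a union of classes modulo
      \<open>k\<close>. If all classes occurred, 1 would be in the stabilizer, against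
      \<open>k > 1\<close>.\<close>
    have ck: "card (ressums k D) < k"
    proof (rule ccontr)
      assume "\<not> ?thesis"
      then have full: "ressums k D = {0..<int k}" using ressums_full[OF k(1)] by simp
      have "1 \<in> stab n (ressums n D)"
        unfolding stab_ressums_iff
      proof
        fix z assume "z \<in> ssums D"
        have "(z + 1) mod int k \<in> ressums k D" unfolding full using k(1) by simp
        then obtain E where E: "E \<subseteq># D" "[sum_mset E = z + 1] (mod int k)" by (rule ressumsE)
        define w where "w = sum_mset E"
        have w: "w \<in> ssums D" using E(1) by (simp add: w_def ssumsI)
        have "int k dvd z + 1 - w" using E(2) unfolding w_def[symmetric] by (simp add: cong_iff_dvd_diff dvd_diff_commute)
        then have "z + 1 - w \<in> stab n (ressums n D)" using k(3) by (simp add: Rs_def)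
        then obtain w' where "w' \<in> ssums D" "[w + (z + 1 - w) = w'] (mod int n)"
          using w unfolding stab_ressums_iff by blast
        then show "\<exists>w\<in>ssums D. [z + 1 = w] (mod int n)" by auto
      qed
      then have "int k dvd 1" using k(3)[of 1] by (simp add: Rs_def)
      then show False using k1 by simp
    qed
    have nspl: "size (filter_mset (\<lambda>d. \<not> int k dvd d) D) + 2 \<le> k" using kn ck by linarith
    define R2 where "R2 = R - pair_mset P"
    have R: "R = pair_mset P + R2" using P(1) by (simp add: R2_def)
    have same: "int k dvd r' - r" if "{#r, r'#} \<subseteq># R2" for r r'
    proof (rule ccontr)
      assume "\<not> int k dvd r' - r"
      then have "r' - r \<notin> stab n (ressums n D)" using k(3) by (simp add: Rs_def)
      from ressums_grow[OF n this]
      have "card Rs < card (ressums n (pair_diffs (add_mset (r, r') P)))" by (simp add: Rs_def D_def)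
      moreover have "pair_mset (add_mset (r, r') P) \<subseteq># R"
      proof -
        have "pair_mset (add_mset (r, r') P) = pair_mset P + {#r, r'#}" by simp
        then show ?thesis using that by (simp only: R mset_subset_eq_mono_add_left_cancel)
      qed
      ultimately show False using maxX by fastforce
    qed
    obtain j where j: "n = k * j" using k(2) by auto
    have j0: "j > 0" using j n by (cases j) auto
    have "size R2 > j"
    proof -
      have "size R = 2 * size P + size R2" by (subst R) simp
      moreover have "n div k = j" using j k(1) by simp
      moreover have "size P \<le> k - 2 + (j - 1)" if "n div k = j"
        using szP nspl Dns that by linarith
      ultimately have a: "2 * (k * j) \<le> 2 * (k - 2 + (j - 1)) + size R2 + 2"
        using sz j by simp
      have "2 * (k - 2 + (j - 1)) + 2 + j < 2 * (k * j)"
      proof -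
        obtain k' where k': "k = k' + 2" using k1 by (metis add.commute le_Suc_ex Suc_leI numeral_2_eq_2 One_nat_def)
        obtain j' where j': "j = j' + 1" using j0 by (metis Suc_eq_plus1 gr0_implies_Suc)
        show ?thesis unfolding k' j' by (simp add: algebra_simps)
      qed
      then show ?thesis using a by linarith
    qed
    then obtain r0 where r0: "r0 \<in># R2" by (metis multiset_nonemptyE not_less_zero size_empty)
    have cong0: "[r = r0] (mod int k)" if "r \<in># R2" for r
    proof (cases "r = r0")
      case False
      then have "{#r0, r#} \<subseteq># R2" using that r0 by (simp add: insert_subset_eq_iff in_diff_count)
      from same[OF this] show ?thesis by (simp add: cong_iff_dvd_diff)
    qed simp
    have "card ((\<lambda>r. r mod int n) ` set_mset R2) \<le> n div k"
      by (rule card_multiples_le[OF k(1,2) n]) (use cong0 in auto)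
    then have "size R2 > card ((\<lambda>r. r mod int n) ` set_mset R2)"
      using \<open>size R2 > j\<close> j k(1) by simp
    then obtain m1 m2 where m: "{#m1, m2#} \<subseteq># R2" "m1 mod int n = m2 mod int n"
      by (rule pigeonhole_mset)
    then have mR2: "m1 \<in># R2" "m2 \<in># R2" by (auto dest: mset_subset_eqD)
    define out where "out = (\<lambda>r. \<not> [r = m1] (mod int k))"
    have noR2: "filter_mset out R2 = {#}"
    proof -
      have "\<not> out r" if "r \<in># R2" for r
        using cong0[OF that] cong0[OF mR2(1)] unfolding out_def by (metis cong_trans cong_sym)
      then have "filter_mset out R2 = filter_mset (\<lambda>_. False) R2" by (intro filter_mset_cong) auto
      then show ?thesis by simp
    qed
    have "k \<le> size (filter_mset out R) + 1" using assms(3)[OF k(2) k1] by (simp add: out_def)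
    then have outP: "k \<le> size (filter_mset out (pair_mset P)) + 1" using noR2 by (simp add: R)
    \<comment> \<open>Otherwise every term outside the class would lie in a pair of its own that
      \<open>k\<close> splits; there are at most \<open>k - 2\<close> such pairs, but at least
      \<open>k - 1\<close> terms outside.\<close>
    have "\<exists>p\<in>#P. out (fst p) \<and> out (snd p)"
    proof (rule ccontr)
      assume no: "\<not> ?thesis"
      have "size (filter_mset out (pair_mset P)) \<le> size (filter_mset (\<lambda>d. \<not> int k dvd d) (pair_diffs P))"
      proof (rule size_filter_pair_mset_le)
        show "\<not> (out (fst p) \<and> out (snd p))" if "p \<in># P" for p using no that by blast
        show "\<not> int k dvd snd p - fst p" if "p \<in># P" "out (fst p) \<noteq> out (snd p)" for p
        proof
          assume "int k dvd snd p - fst p"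
          then have "[snd p = fst p] (mod int k)" by (simp add: cong_iff_dvd_diff)
          then have "out (fst p) = out (snd p)" unfolding out_def by (metis cong_trans cong_sym)
          then show False using that by simp
        qed
      qed
      then show False using outP nspl by (simp add: D_def)
    qed
    then obtain a b where p: "(a, b) \<in># P" "out a" "out b" by auto
    then obtain P0 where P0: "P = add_mset (a, b) P0" by (meson multi_member_split)
    define D0 where "D0 = pair_diffs P0"
    define P' where "P' = add_mset (a, m1) (add_mset (m2, b) P0)"
    have D: "D = add_mset (b - a) D0" by (simp add: D_def D0_def P0)
    have D': "pair_diffs P' = add_mset (m1 - a) (add_mset (b - m2) D0)" by (simp add: P'_def D0_def)
    have P'R: "pair_mset P' \<subseteq># R"
    proof -
      have "pair_mset P' = pair_mset P + {#m1, m2#}" by (simp add: P'_def P0)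
      then show ?thesis using m(1) by (simp only: R mset_subset_eq_mono_add_left_cancel)
    qed
    \<comment> \<open>Modulo \<open>n\<close> the old difference \<open>b - a\<close> is the sum of
      the new ones \<open>m1 - a\<close> and \<open>b - m2\<close>, so no sum is lost. Both new
      differences are outside the stabilizer, so \<open>spl\<close> increases.\<close>
    have sub: "Rs \<subseteq> ressums n (pair_diffs P')"
    proof
      fix z assume "z \<in> Rs"
      then obtain w where w: "w \<in> ssums D" "z = w mod int n" by (auto simp: Rs_def ressums_def)
      then consider "w \<in> ssums D0" | v where "v \<in> ssums D0" "w = v + (b - a)"
        by (auto simp: D ssums_add_mset)
      then show "z \<in> ressums n (pair_diffs P')"
      proof cases
        case 1
        then have "w \<in> ssums (pair_diffs P')" by (simp add: D' ssums_add_mset)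
        then show ?thesis using w by (auto simp: ressums_def)
      next
        case 2
        then have "v + (b - m2) + (m1 - a) \<in> ssums (pair_diffs P')" by (auto simp: D' ssums_add_mset)
        moreover have "z = (v + (b - m2) + (m1 - a)) mod int n"
        proof -
          have "[v + (b - a) + m1 = v + (b - a) + m2] (mod int n)"
            using m(2) by (intro cong_add cong_refl) (simp add: cong_def)
          then have "[v + (b - a) + m1 - m2 = v + (b - a) + m2 - m2] (mod int n)"
            by (rule cong_diff) simp
          then have "[v + (b - m2) + (m1 - a) = v + (b - a)] (mod int n)"
            by (simp add: algebra_simps)
          then show ?thesis using w 2 by (simp add: cong_def)
        qed
        ultimately show ?thesis by (auto simp: ressums_def)
      qed
    qed
    have Rs': "ressums n (pair_diffs P') = Rs"
      using card_seteq[OF _ sub] maxX[OF P'R] by simp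
    have "?B P'" using P'R Rs' P(1) by (simp add: Rs_def D_def)
    then have "spl P' \<le> spl P" using P2(2) P(1) by simp
    moreover have "spl P < spl P'"
    proof -
      have o1: "\<not> int k dvd m1 - a" using p(2) by (simp add: out_def cong_iff_dvd_diff dvd_diff_commute)
      have "\<not> int k dvd b - m2"
      proof
        assume "int k dvd b - m2"
        then have "[b = m2] (mod int k)" by (simp add: cong_iff_dvd_diff)
        moreover have "[m2 = m1] (mod int k)" using cong0 mR2 by (metis cong_trans cong_sym)
        ultimately show False using p(3) by (auto simp: out_def intro: cong_trans)
      qed
      moreover have "spl P' = size (filter_mset (\<lambda>d. d \<notin> stab n Rs) (pair_diffs P'))"
        by (simp only: spl_def Rs')
      ultimately have "spl P' = size (filter_mset (\<lambda>d. d \<notin> stab n Rs) D0) + 2"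
        using o1 k(3) by (simp add: D')
      moreover have "spl P \<le> size (filter_mset (\<lambda>d. d \<notin> stab n Rs) D0) + 1"
      proof -
        have "spl P = size (filter_mset (\<lambda>d. d \<notin> stab n Rs) D)" by (simp only: spl_def Rs_def D_def)
        then show ?thesis unfolding D by simp
      qed
      ultimately show ?thesis by simp
    qed
    ultimately show ?thesis by simp
  qed
qed

text \<open>A largest \<open>k\<close> such that all but at most \<open>k - 2\<close> terms lie in one class modulo \<open>k\<close>; within this
  class the previous lemma applies. This replaces the theorem of DeVos, Goddyn and Mohar.\<close>

lemma flexible_class:
  assumes n: "n > 0" and sz: "size R + 1 \<ge> 2 * n"
  obtains k c P where "k > 0" "k dvd n"
    "k = 1 \<or> size (off_class k c R) + 2 \<le> k"
    "pair_mset P \<subseteq># residue_class k c R" "size P < n div k"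
    "\<And>t. int k dvd t \<Longrightarrow> \<exists>E. E \<subseteq># pair_diffs P \<and> [sum_mset E = t] (mod int n)"
proof -
  let ?out = "\<lambda>k c. size (off_class k c R)"
  let ?good = "\<lambda>k. k > 0 \<and> k dvd n \<and> (k = 1 \<or> (\<exists>c. ?out k c + 2 \<le> k))"
  have "\<exists>k. ?good k \<and> (\<forall>k'. ?good k' \<longrightarrow> k' \<le> k)"
    by (rule ex_has_greatest_nat[of _ 1 _ "Suc n"]) (use n in \<open>auto simp: less_Suc_eq_le dvd_imp_le\<close>)
  then obtain k where k: "?good k" and kmax: "\<And>k'. ?good k' \<Longrightarrow> k' \<le> k" by blast
  then obtain c where kc: "k = 1 \<or> ?out k c + 2 \<le> k" by blast
  have k0: "k > 0" and kn: "k dvd n" using k by auto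
  define R1 where "R1 = residue_class k c R"
  have split: "size R = size R1 + ?out k c"
    unfolding R1_def by (metis multiset_partition size_union)
  have out1: "?out 1 c = 0" by simp
  obtain N where N: "n = k * N" using kn by auto
  have N0: "N > 0" using N n by (cases N) auto
  have Nd: "n div k = N" using N k0 by simp
  define g where "g = (\<lambda>r. (r - c) div int k)"
  define R' where "R' = image_mset g R1"
  have inR1: "r = c + int k * g r" if "r \<in># R1" for r
  proof -
    have "int k dvd r - c" using that by (simp add: R1_def cong_iff_dvd_diff)
    then show ?thesis by (simp add: g_def)
  qed
  have szR': "size R' + 2 \<ge> 2 * N"
  proof (cases "k = 1")
    case True
    then show ?thesis using split sz out1 N by (simp add: R'_def)
  next
    case False
    then have "?out k c + 2 \<le> k" using kc by blast
    then have a: "2 * (k * N) + 1 \<le> size R1 + k" using split sz N by linarith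
    have "2 * N + k \<le> 2 * (k * N) + 3"
    proof -
      obtain k' where k': "k = k' + 1" using k0 by (metis Suc_eq_plus1 gr0_implies_Suc)
      obtain N' where N': "N = N' + 1" using N0 by (metis Suc_eq_plus1 gr0_implies_Suc)
      show ?thesis unfolding k' N' by (simp add: algebra_simps)
    qed
    then show ?thesis using a by (simp add: R'_def)
  qed
  \<comment> \<open>The class of \<open>c'\<close> modulo \<open>k'\<close> among the rescaled terms
    is the class of \<open>c + k * c'\<close> modulo \<open>k * k'\<close> in \<open>R\<close>. By
    maximality of \<open>k\<close> the latter misses at least \<open>k * k' - 1\<close> terms, and
    at most \<open>k - 2\<close> of them (none if \<open>k = 1\<close>) lie outside the class of
    \<open>c\<close>.\<close>
  have out': "size (filter_mset (\<lambda>r. \<not> [r = c'] (mod int k')) R') + 1 \<ge> k'"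
    if k': "k' dvd N" "k' > 1" for k' c'
  proof -
    let ?K = "k * k'" let ?C = "c + int k * c'"
    have "?K > k" using k0 k'(2) by simp
    then have "\<not> ?good ?K" using kmax[of ?K] by (meson leD)
    moreover have "?K dvd n" "?K > 0" using N k' k0 by auto
    ultimately have bad: "\<not> ?out ?K ?C + 2 \<le> ?K" by blast
    have iff: "[r = ?C] (mod int ?K) \<longleftrightarrow> [g r = c'] (mod int k')" if "r \<in># R1" for r
    proof -
      have "r - ?C = int k * (g r - c')" using inR1[OF that] by (simp add: algebra_simps)
      then show ?thesis using k0 unfolding cong_iff_dvd_diff by simp
    qed
    have "filter_mset (\<lambda>r. \<not> [r = ?C] (mod int ?K)) R1 = filter_mset (\<lambda>r. \<not> [g r = c'] (mod int k')) R1"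
      using iff by (intro filter_mset_cong) auto
    then have eq: "size (filter_mset (\<lambda>r. \<not> [r = ?C] (mod int ?K)) R1) =
        size (filter_mset (\<lambda>r. \<not> [r = c'] (mod int k')) R')"
      by (simp add: R'_def filter_mset_image_mset)
    let ?O = "off_class k c R"
    have "R = R1 + ?O" unfolding R1_def by (rule multiset_partition)
    then have "?out ?K ?C = size (filter_mset (\<lambda>r. \<not> [r = ?C] (mod int ?K)) R1) +
        size (filter_mset (\<lambda>r. \<not> [r = ?C] (mod int ?K)) ?O)"
      by (metis filter_union_mset size_union)
    moreover have "size (filter_mset (\<lambda>r. \<not> [r = ?C] (mod int ?K)) ?O) \<le> ?out k c"
      by (rule size_filter_mset_lesseq)
    ultimately have ge: "?K \<le> size (filter_mset (\<lambda>r. \<not> [r = c'] (mod int k')) R') + ?out k c + 1"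
      using bad eq by linarith
    show ?thesis
    proof (cases "k = 1")
      case True
      then show ?thesis using ge out1 by simp
    next
      case False
      then have o: "?out k c + 2 \<le> k" using kc by blast
      obtain k1 where k1: "k = k1 + 1" using k0 by (metis Suc_eq_plus1 gr0_implies_Suc)
      obtain k2 where k2: "k' = k2 + 1" using k'(2) by (metis Suc_eq_plus1 gr0_implies_Suc less_trans zero_less_one)
      have "k' + k \<le> ?K + 2" unfolding k1 k2 by (simp add: algebra_simps)
      then show ?thesis using ge o by linarith
    qed
  qed
  obtain P' where P': "pair_mset P' \<subseteq># R'" "size P' < N" "\<And>z. z mod int N \<in> ressums N (pair_diffs P')"
    using full_pairs[OF N0 szR' out'] by metis
  define h where "h = (\<lambda>r. c + int k * r)"
  define P where "P = image_mset (\<lambda>p. (h (fst p), h (snd p))) P'"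
  have pm: "pair_mset P = image_mset h (pair_mset P')"
    by (simp add: P_def pair_mset_def multiset.map_comp comp_def)
  have "image_mset h R' = image_mset (\<lambda>r. r) R1"
    unfolding R'_def multiset.map_comp using inR1 by (intro image_mset_cong) (simp add: h_def)
  then have sub: "pair_mset P \<subseteq># R1" unfolding pm using image_mset_subseteq_mono[OF P'(1), of h] by simp
  have df: "pair_diffs P = image_mset (\<lambda>d. int k * d) (pair_diffs P')"
    by (simp add: P_def pair_diffs_def multiset.map_comp comp_def case_prod_unfold h_def algebra_simps)
  have flex: "\<exists>E. E \<subseteq># pair_diffs P \<and> [sum_mset E = t] (mod int n)" if "int k dvd t" for t
  proof -
    obtain t' where t': "t = int k * t'" using \<open>int k dvd t\<close> by (rule dvdE)
    obtain E where E: "E \<subseteq># pair_diffs P'" "[sum_mset E = t'] (mod int N)"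
      using P'(3)[of t'] by (rule ressumsE)
    let ?E = "image_mset (\<lambda>d. int k * d) E"
    have "sum_mset ?E = int k * sum_mset E" by (induction E) (auto simp: algebra_simps)
    moreover have "[int k * sum_mset E = int k * t'] (mod int k * int N)"
      using E(2) by (simp add: cong_iff_dvd_diff flip: right_diff_distrib)
    ultimately have "[sum_mset ?E = t] (mod int n)" using t' N by simp
    moreover have "?E \<subseteq># pair_diffs P" unfolding df using E(1) by (rule image_mset_subseteq_mono)
    ultimately show ?thesis by blast
  qed
  have "size P < n div k" using P'(2) Nd by (simp add: P_def)
  then show ?thesis using that[of k c P] k0 kn kc sub flex unfolding R1_def by blast
qed

section \<open>Choosing a prescribed number of terms with a prescribed sum\<close>

lemma choose_from_pairs:
  assumes E: "E \<subseteq># pair_diffs P"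
  obtains C where "C \<subseteq># pair_mset P" "size C = size P" "sum_mset C = sum_mset (image_mset fst P) + sum_mset E"
proof -
  obtain P1 where P1: "P1 \<subseteq># P" "E = pair_diffs P1"
    using E unfolding pair_diffs_def by (rule subset_image_msetE)
  define P2 where "P2 = P - P1"
  have P: "P = P1 + P2" using P1 by (simp add: P2_def)
  define C where "C = image_mset snd P1 + image_mset fst P2"
  have "pair_mset P = C + (image_mset fst P1 + image_mset snd P2)"
    by (simp add: P pair_mset_def C_def)
  then have "C \<subseteq># pair_mset P" by simp
  moreover have "size C = size P" by (simp add: C_def P)
  moreover have "sum_mset (image_mset snd P1) = sum_mset (image_mset fst P1) + sum_mset (pair_diffs P1)"
    by (induction P1) auto
  then have "sum_mset C = sum_mset (image_mset fst P) + sum_mset E"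
    by (simp add: C_def P P1(2))
  ultimately show ?thesis by (rule that)
qed

lemma sum_mset_cong_const:
  assumes "\<And>r. r \<in># M \<Longrightarrow> [r = c] (mod m)"
  shows "[sum_mset M = int (size M) * c] (mod m)"
  using assms
proof (induction M)
  case (add x M)
  have "[x + sum_mset M = c + int (size M) * c] (mod m)"
    by (intro cong_add add.IH add.prems) (use add.prems in auto)
  then show ?case by (simp add: algebra_simps)
qed simp

lemma flexible_choose:
  fixes M :: "int multiset"
  assumes c: "\<And>r. r \<in># M \<Longrightarrow> [r = c] (mod int k)"
    and sub: "F + pair_mset P \<subseteq># M"
    and flex: "\<And>t. int k dvd t \<Longrightarrow> \<exists>E. E \<subseteq># pair_diffs P \<and> [sum_mset E = t] (mod int n)"
    and m: "size F + size P \<le> m" "m + size P \<le> size M"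
    and t: "[t = int m * c] (mod int k)"
  obtains T where "T \<subseteq># M" "F \<subseteq># T" "size T = m" "[sum_mset T = t] (mod int n)"
proof -
  define M' where "M' = M - (F + pair_mset P)"
  have M: "M = F + pair_mset P + M'" using sub by (simp add: M'_def)
  have "size M = size F + 2 * size P + size M'" by (simp add: M)
  then have "m - size P - size F \<le> size M'" using m by linarith
  then obtain G where G: "G \<subseteq># M'" "size G = m - size P - size F" by (rule subset_mset_sizeE)
  define f where "f = sum_mset F + sum_mset G + sum_mset (image_mset fst P)"
  have "[f = int m * c] (mod int k)"
  proof -
    let ?H = "F + G + image_mset fst P"
    have "r \<in># M" if "r \<in># ?H" for r
      using that G(1) by (auto simp: M pair_mset_def dest: mset_subset_eqD)
    then have "[sum_mset ?H = int (size ?H) * c] (mod int k)" by (intro sum_mset_cong_const c)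
    moreover have "size ?H = m" using G(2) m(1) by simp
    ultimately have "[sum_mset ?H = int m * c] (mod int k)" by (simp only:)
    then show ?thesis by (simp add: f_def)
  qed
  then have "[t = f] (mod int k)" using t by (metis cong_trans cong_sym)
  then have "int k dvd t - f" by (simp add: cong_iff_dvd_diff)
  then obtain E where E: "E \<subseteq># pair_diffs P" "[sum_mset E = t - f] (mod int n)" using flex by blast
  obtain C where C: "C \<subseteq># pair_mset P" "size C = size P" "sum_mset C = sum_mset (image_mset fst P) + sum_mset E"
    using E(1) by (rule choose_from_pairs)
  let ?T = "F + G + C"
  have "?T \<subseteq># F + M' + pair_mset P" using G(1) C(1) by (intro subset_mset.add_mono) auto
  then have "?T \<subseteq># M" by (simp add: M ac_simps)
  moreover have "size ?T = m" using G(2) C(2) m(1) by simp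
  moreover have "[sum_mset ?T = t] (mod int n)"
  proof -
    have "[f + sum_mset E = f + (t - f)] (mod int n)" using E(2) by (intro cong_add) auto
    then show ?thesis by (simp add: f_def C(3) algebra_simps)
  qed
  ultimately show ?thesis using that[of ?T] by (simp add: add.assoc)
qed

lemma add_le_mult_plus_1: "0 < k \<Longrightarrow> 0 < j \<Longrightarrow> k + j \<le> k * j + (1::nat)"
  by (cases k; cases j) auto

text \<open>The terms are chosen in the class given by \<open>flexible_class\<close>; as
  \<open>n\<close> divides \<open>L\<close>, the target 0 agrees with \<open>L * c\<close> modulo
  \<open>k\<close>. At most \<open>k - 1\<close> terms lie outside the class and there are at most
  \<open>n div k - 1\<close> pairs, so \<open>k + n div k <= n + 1\<close> makes
  \<open>L + n - 1\<close> terms enough.\<close>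

lemma erdos_ginzburg_ziv:
  fixes M :: "int multiset"
  assumes n: "n > 0" and L: "n dvd L" "L > 0" and sz: "size M + 1 \<ge> L + n"
  obtains T where "T \<subseteq># M" "size T = L" "int n dvd sum_mset T"
proof -
  have nL: "n \<le> L" using L by (auto intro: dvd_imp_le)
  have "size M + 1 \<ge> 2 * n" using sz nL by linarith
  then obtain k c P where k: "k > 0" "k dvd n"
    "k = 1 \<or> size (off_class k c M) + 2 \<le> k"
    "pair_mset P \<subseteq># residue_class k c M" "size P < n div k"
    "\<And>t. int k dvd t \<Longrightarrow> \<exists>E. E \<subseteq># pair_diffs P \<and> [sum_mset E = t] (mod int n)"
    using flexible_class[OF n] by metis
  let ?M = "residue_class k c M"
  obtain j where j: "n = k * j" using k(2) by auto
  have j0: "j > 0" using j n by (cases j) auto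
  have P: "size P + 1 \<le> j" using k(5) j k(1) by simp
  have szM: "size M = size ?M + size (off_class k c M)"
    by (metis multiset_partition size_union)
  have "k + j \<le> n + 1" using add_le_mult_plus_1[OF k(1) j0] j by simp
  moreover have "size (off_class k c M) + 1 \<le> k"
    using k(3)
  proof
    assume "k = 1"
    then show ?thesis by simp
  qed simp
  ultimately have "L + size P \<le> size ?M" using szM sz P by linarith
  moreover have "size P \<le> L" using P nL \<open>k + j \<le> n + 1\<close> k(1) by linarith
  moreover have "[0 = int L * c] (mod int k)"
    using k(2) L(1) by (simp add: cong_iff_dvd_diff dvd_mult2 dvd_trans)
  ultimately obtain T where T: "T \<subseteq># ?M" "size T = L" "[sum_mset T = 0] (mod int n)"
    using flexible_choose[of ?M c k "{#}" P n L 0] k(4,6) by auto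
  have "T \<subseteq># M" using T(1) multiset_filter_subset subset_mset.order_trans by metis
  then show ?thesis using that T by (simp add: cong_0_iff)
qed

subsection \<open>Products in exponent notation\<close>

text \<open>A sequence over the group is represented by the multiset \<open>C\<close> of the exponents \<open>a\<close> of its terms
  \<open>y ^ a\<close> (the even terms) and the multiset \<open>A\<close> of those of its terms \<open>x y ^ a\<close> (the odd terms);
  \<open>e\<close> is the exponent with \<open>x ^ 2 = y ^ e\<close>, and \<open>reach s e C A c\<close> says that \<open>y ^ c\<close> is the
  product of the terms in some order.\<close>

inductive reach :: "int \<Rightarrow> int \<Rightarrow> int multiset \<Rightarrow> int multiset \<Rightarrow> int \<Rightarrow> bool" for s e where
  empty: "reach s e {#} {#} 0"
| even: "reach s e C A c \<Longrightarrow> reach s e (add_mset a C) A (a + c)"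
| odd: "reach s e C A c \<Longrightarrow> reach s e C' A' c' \<Longrightarrow>
    reach s e (C + C') (add_mset a (add_mset b (A + A'))) (e + s * (a + c) + b + c')"

lemma reach_union:
  "reach s e C A c \<Longrightarrow> reach s e C' A' c' \<Longrightarrow> reach s e (C + C') (A + A') (c + c')"
proof (induction arbitrary: C' A' c' rule: reach.induct)
  case empty
  then show ?case by simp
next
  case (even C A c a)
  from reach.even[OF even.IH[OF even.prems], of a] show ?case by (simp add: add.assoc)
next
  case (odd C A c C1 A1 c1 a b)
  from reach.odd[OF odd.hyps(1) odd.IH(2)[OF odd.prems], of a b]
  show ?case by (simp add: algebra_simps)
qed

lemma reach_evens: "reach s e C {#} (sum_mset C)"
  by (induction C) (auto intro: reach.intros)

text \<open>The exponent of the product of \<open>x y ^ a\<close> and \<open>x y ^ b\<close>, in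
  this order.\<close>

definition pair_val :: "int \<Rightarrow> int \<Rightarrow> int \<times> int \<Rightarrow> int" where
  "pair_val s e p = e + s * fst p + snd p"

abbreviation pair_sum :: "int \<Rightarrow> int \<Rightarrow> (int \<times> int) multiset \<Rightarrow> int" where
  "pair_sum s e P \<equiv> sum_mset (image_mset (pair_val s e) P)"

lemma reach_pair_sandwich:
  "reach s e C {#a, b#} (pair_val s e (a, b) + s * sum_mset C)"
  using reach.odd[OF reach_evens[of s e C] reach.empty, of a b]
  by (simp add: pair_val_def algebra_simps)

lemma reach_pairs: "reach s e {#} (pair_mset P) (pair_sum s e P)"
proof (induction P)
  case (add p P)
  from reach.odd[OF reach.empty add.IH, of "fst p" "snd p"] show ?case
    by (simp add: pair_val_def algebra_simps)
qed (simp add: reach.empty)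

lemma subset_plus_msetE:
  assumes "E \<subseteq># A + B"
  obtains E1 E2 where "E = E1 + E2" "E1 \<subseteq># A" "E2 \<subseteq># B"
proof -
  have "E = (E \<inter># A) + (E - A)" by (simp add: multiset_eq_iff min_def)
  moreover have "E - A \<subseteq># B" using assms by (simp add: subset_eq_diff_conv add.commute)
  ultimately show ?thesis using that[of "E \<inter># A" "E - A"] by simp
qed

text \<open>Placing an even term between the two odd terms of a pair multiplies its exponent by \<open>s\<close>.\<close>

definition flips :: "int \<Rightarrow> int multiset \<Rightarrow> (int \<times> int) multiset \<Rightarrow> int multiset" where
  "flips s C P = image_mset (\<lambda>p. (s - 1) * (snd p - fst p)) P + image_mset (\<lambda>c. (s - 1) * c) C"

text \<open>Swapping the terms of an odd pair \<open>(a, b)\<close> changes its value by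
  \<open>(s - 1) * (b - a)\<close>. The even terms whose exponents are to be multiplied by
  \<open>s\<close> are all placed inside one and the same pair, so a single odd pair suffices and
  the changes are independent.\<close>

lemma reach_flips:
  assumes "P \<noteq> {#}" and E: "E \<subseteq># flips s C P"
  shows "reach s e C (pair_mset P) (pair_sum s e P + sum_mset C + sum_mset E)"
proof -
  let ?d = "\<lambda>p. (s - 1) * (snd p - fst p)"
  obtain E1 E2 where E12: "E = E1 + E2" "E1 \<subseteq># image_mset ?d P" "E2 \<subseteq># image_mset (\<lambda>c. (s - 1) * c) C"
    using E unfolding flips_def by (rule subset_plus_msetE)
  obtain P1 where P1: "P1 \<subseteq># P" "E1 = image_mset ?d P1" using E12(2) by (rule subset_image_msetE)
  obtain C1 where C1: "C1 \<subseteq># C" "E2 = image_mset (\<lambda>c. (s - 1) * c) C1"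
    using E12(3) by (rule subset_image_msetE)
  define P2 where "P2 = P - P1"
  define C2 where "C2 = C - C1"
  have P: "P = P1 + P2" and C: "C = C1 + C2" using P1 C1 by (simp_all add: P2_def C2_def)
  define Q where "Q = image_mset prod.swap P1 + P2"
  have Q: "pair_mset Q = pair_mset P"
    by (simp add: Q_def P pair_mset_def multiset.map_comp comp_def add.commute)
  have "pair_sum s e (image_mset prod.swap P1) =
      pair_sum s e P1 + sum_mset E1"
    unfolding P1(2) by (induction P1) (auto simp: pair_val_def algebra_simps)
  then have sQ: "pair_sum s e Q = pair_sum s e P + sum_mset E1"
    by (simp add: Q_def P)
  have "Q \<noteq> {#}" using assms(1) P by (auto simp: Q_def)
  then obtain p Q0 where Q0: "Q = add_mset p Q0" by (metis multiset_cases)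
  have "reach s e (C1 + {#} + C2) ({#fst p, snd p#} + pair_mset Q0 + {#})
     (pair_val s e (fst p, snd p) + s * sum_mset C1 + pair_sum s e Q0 + sum_mset C2)"
    by (intro reach_union reach_pair_sandwich reach_pairs reach_evens)
  moreover have "s * sum_mset C1 = sum_mset C1 + sum_mset E2"
    unfolding C1(2) by (induction C1) (auto simp: algebra_simps)
  ultimately have "reach s e (C1 + C2) (pair_mset Q)
     (pair_sum s e Q + (sum_mset C1 + sum_mset C2) + sum_mset E2)"
    by (simp add: Q0 algebra_simps)
  then show ?thesis unfolding Q sQ using C E12(1) by (simp add: algebra_simps)
qed

text \<open>The hypothesis says that \<open>y ^ c0\<close> is central, so multiplying every term by
  it contributes one factor \<open>y ^ c0\<close> per term to the product.\<close>

lemma reach_shift: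
  assumes c0: "int n dvd (s - 1) * c0" and "reach s e C A c"
  obtains c' where "reach s e (image_mset (\<lambda>a. a + c0) C) (image_mset (\<lambda>a. a + c0) A) c'"
    "[c' = c + int (size C + size A) * c0] (mod int n)"
proof -
  have "\<exists>c'. reach s e (image_mset (\<lambda>a. a + c0) C) (image_mset (\<lambda>a. a + c0) A) c' \<and>
    [c' = c + int (size C + size A) * c0] (mod int n)"
    using assms(2)
  proof induction
    case empty
    then show ?case by (intro exI[of _ 0]) (simp add: reach.empty)
  next
    case (even C A c a)
    then obtain c' where c': "reach s e (image_mset (\<lambda>a. a + c0) C) (image_mset (\<lambda>a. a + c0) A) c'"
      "[c' = c + int (size C + size A) * c0] (mod int n)" by blast
    have "[(a + c0) + c' = (a + c0) + (c + int (size C + size A) * c0)] (mod int n)"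
      by (intro cong_add c'(2) cong_refl)
    then have "[(a + c0) + c' = a + c + int (size (add_mset a C) + size A) * c0] (mod int n)"
      by (simp add: algebra_simps)
    with reach.even[OF c'(1), of "a + c0"] show ?case by auto
  next
    case (odd C A c C1 A1 c1 a b)
    let ?k = "int (size C + size A)" and ?k1 = "int (size C1 + size A1)"
    obtain c' where c': "reach s e (image_mset (\<lambda>a. a + c0) C) (image_mset (\<lambda>a. a + c0) A) c'"
      "[c' = c + ?k * c0] (mod int n)" using odd.IH(1) by blast
    obtain c1' where c1': "reach s e (image_mset (\<lambda>a. a + c0) C1) (image_mset (\<lambda>a. a + c0) A1) c1'"
      "[c1' = c1 + ?k1 * c0] (mod int n)" using odd.IH(2) by blast
    have "[e + s * ((a + c0) + c') + (b + c0) + c1' =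
        e + s * ((a + c0) + (c + ?k * c0)) + (b + c0) + (c1 + ?k1 * c0)] (mod int n)"
      by (intro cong_add cong_mult cong_refl c' c1')
    also have "e + s * ((a + c0) + (c + ?k * c0)) + (b + c0) + (c1 + ?k1 * c0) =
        (e + s * (a + c) + b + c1) + (?k + ?k1 + 2) * c0 + (?k + 1) * ((s - 1) * c0)"
      by (simp add: algebra_simps)
    also have "[\<dots> = (e + s * (a + c) + b + c1) + (?k + ?k1 + 2) * c0 + 0] (mod int n)"
      using c0 by (intro cong_add cong_refl) (simp add: cong_0_iff)
    finally have "[e + s * ((a + c0) + c') + (b + c0) + c1' = (e + s * (a + c) + b + c1) +
        int (size (C + C1) + size (add_mset a (add_mset b (A + A1)))) * c0] (mod int n)"
      by (simp add: algebra_simps)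
    with reach.odd[OF c'(1) c1'(1), of "a + c0" "b + c0"] show ?case by auto
  qed
  then show ?thesis using that by blast
qed

section \<open>Subsequences with product trivial modulo \<open>m\<close>, and their combination as
  blocks\<close>

definition hits :: "int \<Rightarrow> int \<Rightarrow> nat \<Rightarrow> nat \<Rightarrow> int multiset \<Rightarrow> int multiset \<Rightarrow> bool" where
  "hits s e L m C A \<longleftrightarrow> (\<exists>C' A' c. C' \<subseteq># C \<and> A' \<subseteq># A \<and> size C' + size A' = L \<and> reach s e C' A' c \<and> int m dvd c)"

lemma hitsI:
  "C' \<subseteq># C \<Longrightarrow> A' \<subseteq># A \<Longrightarrow> reach s e C' A' c \<Longrightarrow> int m dvd c \<Longrightarrow> size C' + size A' = L \<Longrightarrow> hits s e L m C A"
  unfolding hits_def by blast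

lemma hits_mono: "hits s e L m C A \<Longrightarrow> C \<subseteq># D \<Longrightarrow> A \<subseteq># B \<Longrightarrow> hits s e L m D B"
  unfolding hits_def by (elim exE conjE) (blast intro: subset_mset.order_trans)

lemma hits_evens: "C' \<subseteq># C \<Longrightarrow> int m dvd sum_mset C' \<Longrightarrow> size C' = L \<Longrightarrow> hits s e L m C A"
  by (rule hitsI[of C' C "{#}" A _ _ "sum_mset C'"]) (auto intro: reach_evens)

text \<open>Exponents of the even terms, exponents of the odd terms, and the exponent of one of
  their products.\<close>

type_synonym block = "int multiset \<times> int multiset \<times> int"

abbreviation evens_of :: "block multiset \<Rightarrow> int multiset" where
  "evens_of B \<equiv> sum_mset (image_mset fst B)"

abbreviation odds_of :: "block multiset \<Rightarrow> int multiset" where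
  "odds_of B \<equiv> sum_mset (image_mset (fst \<circ> snd) B)"

abbreviation vals_of :: "block multiset \<Rightarrow> int" where
  "vals_of B \<equiv> sum_mset (image_mset (snd \<circ> snd) B)"

definition block_size :: "block \<Rightarrow> nat" where
  "block_size b = size (fst b) + size (fst (snd b))"

abbreviation total_size :: "block multiset \<Rightarrow> nat" where
  "total_size B \<equiv> sum_mset (image_mset block_size B)"

definition is_block :: "int \<Rightarrow> int \<Rightarrow> nat \<Rightarrow> block \<Rightarrow> bool" where
  "is_block s e m b \<longleftrightarrow> reach s e (fst b) (fst (snd b)) (snd (snd b)) \<and> int m dvd snd (snd b)"

lemma sum_image_mset_mono:
  fixes f :: "'a \<Rightarrow> 'b multiset"
  shows "B1 \<subseteq># B \<Longrightarrow> sum_mset (image_mset f B1) \<subseteq># sum_mset (image_mset f B)"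
  by (auto simp: mset_subset_eq_exists_conv)

lemma reach_blocks:
  assumes "\<And>b. b \<in># B \<Longrightarrow> is_block s e m b"
  shows "reach s e (evens_of B) (odds_of B)
    (vals_of B)"
  using assms
proof (induction B)
  case (add b B)
  have "reach s e (fst b) (fst (snd b)) (snd (snd b))" using add.prems[of b] by (simp add: is_block_def)
  from reach_union[OF this add.IH] add.prems show ?case by simp
qed (simp add: reach.empty)

lemma size_blocks:
  "size (evens_of B) + size (odds_of B) =
    total_size B"
  by (induction B) (auto simp: block_size_def)

text \<open>Greedy extraction: the last of \<open>j\<close> blocks still finds \<open>M\<close>
  terms after at most \<open>(j - 1) * b\<close> have been removed. \<open>I\<close> records the
  exact length when it is known.\<close>

lemma extract_blocks:
  assumes step: "\<And>C A. size C + size A \<ge> M \<Longrightarrow> \<exists>L. 0 < L \<and> L \<le> b \<and> I L \<and> hits s e L m C A"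
    and "size C + size A + b \<ge> M + j * b"
  obtains B where "size B = j" "\<And>x. x \<in># B \<Longrightarrow> is_block s e m x \<and> 0 < block_size x \<and> block_size x \<le> b \<and> I (block_size x)"
    "evens_of B \<subseteq># C" "odds_of B \<subseteq># A"
proof -
  have "\<exists>B. size B = j \<and> (\<forall>x\<in>#B. is_block s e m x \<and> 0 < block_size x \<and> block_size x \<le> b \<and> I (block_size x)) \<and>
    evens_of B \<subseteq># C \<and> odds_of B \<subseteq># A"
    using assms(2)
  proof (induction j arbitrary: C A)
    case 0
    then show ?case by (intro exI[of _ "{#}"]) simp
  next
    case (Suc j)
    have "size C + size A \<ge> M" using Suc.prems by simp
    from step[OF this] obtain L where L: "0 < L" "L \<le> b" "I L" "hits s e L m C A" by blast
    then obtain C1 A1 c where h: "C1 \<subseteq># C" "A1 \<subseteq># A" "size C1 + size A1 = L" "reach s e C1 A1 c" "int m dvd c"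
      unfolding hits_def by blast
    have CA: "C = C1 + (C - C1)" "A = A1 + (A - A1)" using h by simp_all
    have "size C = size C1 + size (C - C1)" "size A = size A1 + size (A - A1)"
      using arg_cong[OF CA(1), of size] arg_cong[OF CA(2), of size] by simp_all
    then have "size (C - C1) + size (A - A1) + b \<ge> M + j * b" using Suc.prems L(2) h(3) by simp
    from Suc.IH[OF this] obtain B where B: "size B = j"
      "\<forall>x\<in>#B. is_block s e m x \<and> 0 < block_size x \<and> block_size x \<le> b \<and> I (block_size x)"
      "evens_of B \<subseteq># C - C1" "odds_of B \<subseteq># A - A1" by blast
    have "C1 + evens_of B \<subseteq># C1 + (C - C1)" using B(3) by simp
    moreover have "A1 + odds_of B \<subseteq># A1 + (A - A1)" using B(4) by simp
    ultimately show ?case using B h L CA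
      by (intro exI[of _ "add_mset (C1, A1, c) B"]) (auto simp: is_block_def block_size_def comp_def)
  qed
  then show ?thesis using that by blast
qed

text \<open>The values are divided by \<open>m\<close>, so a zero sum of the quotients modulo
  \<open>q\<close> becomes a product trivial modulo \<open>m * q\<close>.\<close>

lemma hits_blocks:
  assumes m: "m > 0" and B: "\<And>b. b \<in># B \<Longrightarrow> is_block s e m b"
    and sub: "evens_of B \<subseteq># C" "odds_of B \<subseteq># A"
    and T: "T \<subseteq># image_mset (\<lambda>b. snd (snd b) div int m) B" "int q dvd sum_mset T"
  obtains B1 where "B1 \<subseteq># B" "size B1 = size T" "hits s e (total_size B1) (m * q) C A"
proof -
  obtain B1 where B1: "B1 \<subseteq># B" "T = image_mset (\<lambda>b. snd (snd b) div int m) B1"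
    using T(1) by (rule subset_image_msetE)
  have bl: "is_block s e m b" if "b \<in># B1" for b using B mset_subset_eqD[OF B1(1) that] by blast
  have "vals_of B1 = int m * sum_mset T"
    unfolding B1(2) using bl
    by (induction B1) (auto simp: is_block_def algebra_simps)
  then have dvd: "int (m * q) dvd vals_of B1" using T(2) by (simp add: mult_dvd_mono)
  have "hits s e (total_size B1) (m * q) C A"
    by (rule hitsI[OF _ _ reach_blocks[OF bl] dvd size_blocks])
      (use subset_mset.order_trans[OF sum_image_mset_mono[OF B1(1)] sub(1)]
           subset_mset.order_trans[OF sum_image_mset_mono[OF B1(1)] sub(2)] in auto)
  moreover have "size B1 = size T" using B1(2) by simp
  ultimately show ?thesis using that B1(1) by blast
qed

lemma sum_block_size_const:
  assumes "\<And>b. b \<in># B \<Longrightarrow> block_size b = m"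
  shows "total_size B = m * size B"
  using assms by (induction B) auto

text \<open>After \<open>2 * q - 2\<close> blocks of length \<open>m\<close> there are still
  \<open>2 * m\<close> terms for one more, and Erdos-Ginzburg-Ziv picks \<open>q\<close> of the
  \<open>2 * q - 1\<close> blocks.\<close>

lemma hits_exact_mult:
  assumes m: "m > 0" and q: "q > 0"
    and base: "\<And>C A. size C + size A \<ge> 2 * m \<Longrightarrow> hits s e m m C A"
    and sz: "size C + size A \<ge> 2 * (m * q)"
  shows "hits s e (m * q) (m * q) C A"
proof -
  have step: "\<exists>L. 0 < L \<and> L \<le> m \<and> L = m \<and> hits s e L m C A" if "size C + size A \<ge> 2 * m" for C A
    using base[OF that] m by blast
  obtain r where r: "q = r + 1" using q by (metis Suc_eq_plus1 gr0_implies_Suc)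
  have szb: "size C + size A + m \<ge> 2 * m + (2 * q - 1) * m"
    using sz by (simp add: r algebra_simps)
  obtain B where B: "size B = 2 * q - 1"
    "\<And>x. x \<in># B \<Longrightarrow> is_block s e m x \<and> 0 < block_size x \<and> block_size x \<le> m \<and> block_size x = m"
    "evens_of B \<subseteq># C" "odds_of B \<subseteq># A"
    using extract_blocks[where I = "\<lambda>L. L = m", OF step szb] by blast
  obtain T where T: "T \<subseteq># image_mset (\<lambda>b. snd (snd b) div int m) B" "size T = q" "int q dvd sum_mset T"
    using erdos_ginzburg_ziv[of q q "image_mset (\<lambda>b. snd (snd b) div int m) B"] q B(1) by auto
  obtain B1 where B1: "B1 \<subseteq># B" "size B1 = size T" "hits s e (total_size B1) (m * q) C A"
    using hits_blocks[OF m _ B(3,4) T(1,3)] B(2) by blast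
  have "total_size B1 = m * q"
    using sum_block_size_const[of B1 m] B(2) mset_subset_eqD[OF B1(1)] B1(2) T(2) by auto
  then show ?thesis using B1(3) by simp
qed

text \<open>\<open>m * q + 1\<close> terms contain \<open>q\<close> blocks of length at most
  \<open>m\<close>; the Davenport constant modulo \<open>q\<close> selects a nonempty part of
  them.\<close>

lemma hits_short_mult:
  assumes m: "m > 0" and q: "q > 0"
    and base: "\<And>C A. size C + size A \<ge> m + 1 \<Longrightarrow> \<exists>L. 0 < L \<and> L \<le> m \<and> hits s e L m C A"
    and sz: "size C + size A \<ge> m * q + 1"
  shows "\<exists>L. 0 < L \<and> L \<le> m * q \<and> hits s e L (m * q) C A"
proof -
  have step: "\<exists>L. 0 < L \<and> L \<le> m \<and> True \<and> hits s e L m C A" if "size C + size A \<ge> m + 1" for C A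
    using base[OF that] by blast
  have szb: "size C + size A + m \<ge> (m + 1) + q * m" using sz by (simp add: algebra_simps)
  obtain B where B: "size B = q"
    "\<And>x. x \<in># B \<Longrightarrow> is_block s e m x \<and> 0 < block_size x \<and> block_size x \<le> m \<and> True"
    "evens_of B \<subseteq># C" "odds_of B \<subseteq># A"
    using extract_blocks[where I = "\<lambda>L. True", OF step szb] by blast
  obtain T where T: "T \<subseteq># image_mset (\<lambda>b. snd (snd b) div int m) B" "T \<noteq> {#}" "int q dvd sum_mset T"
    using davenport_cyclic[OF q, of "image_mset (\<lambda>b. snd (snd b) div int m) B"] B(1) by auto
  obtain B1 where B1: "B1 \<subseteq># B" "size B1 = size T" "hits s e (total_size B1) (m * q) C A"
    using hits_blocks[OF m _ B(3,4) T(1,3)] B(2) by blast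
  have bs: "0 < block_size x \<and> block_size x \<le> m" if "x \<in># B1" for x
    using B(2) mset_subset_eqD[OF B1(1) that] by blast
  have "total_size B1 \<le> m * size B1"
    using bs by (induction B1) (auto intro: add_mono)
  also have "\<dots> \<le> m * q" using size_mset_mono[OF B1(1)] B(1) by simp
  finally have "total_size B1 \<le> m * q" .
  moreover have "0 < total_size B1"
  proof -
    have "B1 \<noteq> {#}" using T(2) B1(2) by auto
    then obtain x B2 where "B1 = add_mset x B2" by (metis multiset_cases)
    then show ?thesis using bs by auto
  qed
  ultimately show ?thesis using B1(3) by blast
qed

subsection \<open>Dihedral quotients\<close>

lemma restrict_size:
  assumes "N \<le> size C + size A"
  obtains C' A' where "C' \<subseteq># C" "A' \<subseteq># A" "size C' + size A' = N"
proof (cases "N \<le> size C")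
  case True
  then obtain T where "T \<subseteq># C" "size T = N" by (rule subset_mset_sizeE)
  then show ?thesis using that[of T "{#}"] by simp
next
  case False
  then have "N - size C \<le> size A" using assms by simp
  then obtain T where "T \<subseteq># A" "size T = N - size C" by (rule subset_mset_sizeE)
  then show ?thesis using that[of C T] False by simp
qed

lemma dvd_sum_mset: "(\<And>x. x \<in># M \<Longrightarrow> d dvd x) \<Longrightarrow> d dvd sum_mset (M :: int multiset)"
  by (induction M) auto

lemma sum_pair_mset: "sum_mset (pair_mset P) = sum_mset (image_mset (\<lambda>p. fst p + snd p :: int) P)"
  by (induction P) auto

lemma size_pair_mset_filter_ge:
  "size (filter_mset Q (pair_mset P)) \<ge> size (filter_mset (\<lambda>p. Q (fst p) \<or> Q (snd p)) P)"
  by (induction P) auto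

lemma card_parity_le: "card ((\<lambda>a :: int. a mod 2) ` Rs) \<le> 2"
proof -
  have "(\<lambda>a :: int. a mod 2) ` Rs \<subseteq> {0, 1}" by auto
  from card_mono[OF _ this] show ?thesis by simp
qed

lemma parity_pairing:
  fixes M :: "int multiset"
  obtains P L where "M = pair_mset P + L" "\<And>p. p \<in># P \<Longrightarrow> even (fst p) = even (snd p)"
    "\<And>a b. {#a, b#} \<subseteq># L \<Longrightarrow> even a \<noteq> even b" "size L \<le> 2"
proof -
  obtain P L where PL: "M = pair_mset P + L" "\<And>p. p \<in># P \<Longrightarrow> fst p mod 2 = snd p mod 2"
    "\<And>a b. {#a, b#} \<subseteq># L \<Longrightarrow> a mod 2 \<noteq> b mod 2" "size L \<le> card ((\<lambda>a. a mod 2) ` set_mset L)"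
    using pairing[of M "\<lambda>a. a mod 2"] by metis
  have "even (fst p) = even (snd p)" if "p \<in># P" for p
    using PL(2)[OF that] by presburger
  moreover have "even a \<noteq> even b" if "{#a, b#} \<subseteq># L" for a b
    using PL(3)[OF that] by presburger
  moreover have "size L \<le> 2" using PL(4) card_parity_le[of "set_mset L"] by linarith
  ultimately show ?thesis using that PL(1) by blast
qed

lemma size_2_mset:
  assumes "size M = 2" obtains a b where "M = {#a, b#}"
proof -
  obtain a N where "M = add_mset a N" "size N = 1"
    using assms by (metis Suc_1 size_eq_Suc_imp_eq_union size_add_mset Suc_inject One_nat_def)
  then show ?thesis using that by (metis size_1_singleton_mset)
qed

context
  fixes p :: nat and s e :: int
  assumes p: "Factorial_Ring.prime p" "odd p" and s: "[s = -1] (mod int p)" and e: "int p dvd e"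
begin

text \<open>Modulo \<open>p\<close> the factor \<open>s - 1\<close> is -2, a unit because
  \<open>p\<close> is odd.\<close>

lemma prime_dvd_flip: "int p dvd (s - 1) * x \<longleftrightarrow> int p dvd x"
proof -
  have "\<not> int p dvd s - 1"
  proof
    assume "int p dvd s - 1"
    moreover have "int p dvd s - -1" using s by (simp only: cong_iff_dvd_diff)
    ultimately have "int p dvd (s - -1) - (s - 1)" by (rule dvd_diff[rotated])
    then have "int p dvd int 2" by simp
    then have "p dvd 2" by (simp only: int_dvd_int_iff)
    then show False using p by (metis primes_dvd_imp_eq two_is_prime_nat even_numeral)
  qed
  then show ?thesis using p by (simp add: prime_dvd_mult_iff)
qed

lemma pair_val_cong: "[pair_val s e q = snd q - fst q] (mod int p)"
proof -
  have "[e + s * fst q + snd q = 0 + (-1) * fst q + snd q] (mod int p)"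
    by (intro cong_add cong_mult s cong_refl) (use e in \<open>simp add: cong_0_iff\<close>)
  then show ?thesis by (simp add: pair_val_def)
qed

lemma size_filter_flips:
  "size (filter_mset (\<lambda>d. \<not> int p dvd d) (flips s C P)) =
    size (filter_mset (\<lambda>q. \<not> int p dvd snd q - fst q) P) + size (filter_mset (\<lambda>c. \<not> int p dvd c) C)"
  by (simp add: flips_def filter_mset_image_mset prime_dvd_flip)

text \<open>Any \<open>p - 1\<close> flips that are nonzero modulo \<open>p\<close> reach every
  residue. For odd \<open>s\<close> all flips are even, so the parity of the value is fixed by the
  choice of terms and can be arranged beforehand.\<close>

lemma reach_by_flips:
  assumes "P \<noteq> {#}"
    and "size (filter_mset (\<lambda>q. \<not> int p dvd snd q - fst q) P) + size (filter_mset (\<lambda>c. \<not> int p dvd c) C) \<ge> p - 1"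
  obtains c where "reach s e C (pair_mset P) c" "int p dvd c"
    "odd s \<longrightarrow> even (c - (pair_sum s e P + sum_mset C))"
proof -
  let ?b = "pair_sum s e P + sum_mset C"
  have "(- ?b) mod int p \<in> ressums p (flips s C P)"
    by (rule ressums_full_prime[OF p(1)]) (use assms(2) in \<open>simp add: size_filter_flips\<close>)
  then obtain E where E: "E \<subseteq># flips s C P" "[sum_mset E = - ?b] (mod int p)" by (rule ressumsE)
  have "int p dvd sum_mset E - - ?b" using E(2) by (simp only: cong_iff_dvd_diff)
  then have "int p dvd ?b + sum_mset E" by (simp add: algebra_simps)
  moreover have "even (sum_mset E)" if "odd s"
  proof (rule dvd_sum_mset)
    fix x assume "x \<in># E"
    then have "x \<in># flips s C P" using E(1) by (rule mset_subset_eqD[rotated])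
    then show "even x" using \<open>odd s\<close> by (auto simp: flips_def)
  qed
  ultimately show ?thesis using that[OF reach_flips[OF assms(1) E(1)]] by simp
qed

text \<open>Pairs of equal parity settle the modulus 2 and flips settle \<open>p\<close>. Of
  \<open>4 * p\<close> terms at most four stay unpaired, so there are at least
  \<open>2 * p - 2\<close> pairs: either \<open>p\<close> of them are trivial modulo
  \<open>p\<close>, or \<open>p - 1\<close> of them supply nonzero flips. The remaining cases are
  those without an odd pair of equal parity.\<close>

lemma dihedral_exact:
  assumes odd: "odd s" "even e" and sz: "size C + size A \<ge> 2 * (2 * p)"
  shows "hits s e (2 * p) (2 * p) C A"
proof -
  have p3: "p \<ge> 3" using p by (metis One_nat_def Suc_1 Suc_leI le_neq_implies_less numeral_3_eq_3 even_numeral prime_ge_2_nat)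
  have two_p: "int (2 * p) dvd x" if "even x" "int p dvd x" for x
  proof -
    have "coprime 2 (int p)" using p by simp
    then have "2 * int p dvd x" using that by (intro divides_mult)
    then show ?thesis by simp
  qed
  obtain C' A' where CA: "C' \<subseteq># C" "A' \<subseteq># A" "size C' + size A' = 2 * (2 * p)"
    using sz by (rule restrict_size)
  obtain Pe Le where Pe: "C' = pair_mset Pe + Le" "\<And>q. q \<in># Pe \<Longrightarrow> even (fst q) = even (snd q)"
    "\<And>a b. {#a, b#} \<subseteq># Le \<Longrightarrow> even a \<noteq> even b" "size Le \<le> 2" using parity_pairing[of C'] by metis
  obtain Po Lo where Po: "A' = pair_mset Po + Lo" "\<And>q. q \<in># Po \<Longrightarrow> even (fst q) = even (snd q)"
    "\<And>a b. {#a, b#} \<subseteq># Lo \<Longrightarrow> even a \<noteq> even b" "size Lo \<le> 2" using parity_pairing[of A'] by metis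
  have evPe: "even (fst q + snd q)" if "q \<in># Pe" for q using Pe(2)[OF that] by simp
  have evPo: "even (pair_val s e q)" if "q \<in># Po" for q
    using Po(2)[OF that] odd by (auto simp: pair_val_def)
  have szs: "2 * (2 * p) = 2 * size Pe + size Le + 2 * size Po + size Lo"
    using CA(3) Pe(1) Po(1) by simp
  define ue where "ue = (\<lambda>q. \<not> int p dvd fst q \<or> \<not> int p dvd snd q)"
  define uo where "uo = (\<lambda>q. \<not> int p dvd snd q - fst q)"
  have finish: "hits s e (2 * p) (2 * p) C A"
    if "C1 \<subseteq># C'" "A1 \<subseteq># A'" "reach s e C1 A1 c" "even c" "int p dvd c" "size C1 + size A1 = 2 * p" for C1 A1 c
    by (rule hits_mono[OF hitsI[OF that(1,2,3) two_p[OF that(4,5)] that(6)] CA(1,2)])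
  have sumPe: "even (sum_mset (pair_mset Q))" if "Q \<subseteq># Pe" for Q
    unfolding sum_pair_mset using evPe mset_subset_eqD[OF that] by (intro dvd_sum_mset) auto
  have sumPo: "even (pair_sum s e Q)" if "Q \<subseteq># Po" for Q
    using evPo mset_subset_eqD[OF that] by (intro dvd_sum_mset) auto
  show ?thesis
  proof (cases "size (filter_mset (\<lambda>q. \<not> ue q) Pe) + size (filter_mset (\<lambda>q. \<not> uo q) Po) \<ge> p")
    case True
    then obtain Z1 Z2 where Z: "Z1 \<subseteq># filter_mset (\<lambda>q. \<not> ue q) Pe" "Z2 \<subseteq># filter_mset (\<lambda>q. \<not> uo q) Po"
      "size Z1 + size Z2 = p" by (rule restrict_size)
    have Z1: "Z1 \<subseteq># Pe" and Z2: "Z2 \<subseteq># Po"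
      using Z(1,2) multiset_filter_subset subset_mset.order_trans by metis+
    have d1: "int p dvd sum_mset (pair_mset Z1)"
      unfolding sum_pair_mset using mset_subset_eqD[OF Z(1)] by (intro dvd_sum_mset) (auto simp: ue_def)
    have d2: "int p dvd pair_sum s e Z2"
    proof (rule dvd_sum_mset)
      fix x assume "x \<in># image_mset (pair_val s e) Z2"
      then obtain q where q: "q \<in># Z2" "x = pair_val s e q" by auto
      then have "int p dvd snd q - fst q" using mset_subset_eqD[OF Z(2)] by (auto simp: uo_def)
      then show "int p dvd x" using pair_val_cong[of q] q(2) by (simp add: cong_dvd_iff)
    qed
    have "reach s e (pair_mset Z1 + {#}) ({#} + pair_mset Z2)
      (sum_mset (pair_mset Z1) + pair_sum s e Z2)"
      by (intro reach_union reach_evens reach_pairs)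
    then have r: "reach s e (pair_mset Z1) (pair_mset Z2)
      (sum_mset (pair_mset Z1) + pair_sum s e Z2)" by simp
    have s1: "pair_mset Z1 \<subseteq># C'" "pair_mset Z2 \<subseteq># A'"
      using pair_mset_mono[OF Z1] pair_mset_mono[OF Z2] Pe(1) Po(1) by (simp_all add: subset_mset.add_increasing2)
    show ?thesis
      by (rule finish[OF s1 r]) (use sumPe[OF Z1] sumPo[OF Z2] d1 d2 Z(3) in simp_all)
  next
    case few: False
    have units: "size (filter_mset ue Pe) + size (filter_mset uo Po) \<ge> p - 1"
    proof -
      have "size Pe = size (filter_mset ue Pe) + size (filter_mset (\<lambda>q. \<not> ue q) Pe)"
        "size Po = size (filter_mset uo Po) + size (filter_mset (\<lambda>q. \<not> uo q) Po)"
        by (metis multiset_partition size_union)+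
      then show ?thesis using szs Pe(4) Po(4) few by linarith
    qed
    show ?thesis
    proof (cases "Po = {#}")
      case False
      obtain We Wo where W: "We \<subseteq># filter_mset ue Pe" "Wo \<subseteq># filter_mset uo Po" "size We + size Wo = p - 1"
        using units by (rule restrict_size)
      have We: "We \<subseteq># Pe" and Wo: "Wo \<subseteq># Po"
        using W(1,2) multiset_filter_subset subset_mset.order_trans by metis+
      \<comment> \<open>One further pair brings the length to \<open>2 * p\<close>. If none of the
        \<open>p - 1\<close> chosen pairs is odd, it has to be, since flips need an odd
        pair.\<close>
      have "\<exists>Xe Xo. Xe \<subseteq># Pe - We \<and> Xo \<subseteq># Po - Wo \<and> size Xe + size Xo = 1 \<and> Wo + Xo \<noteq> {#}"
      proof (cases "Wo = {#}")
        case True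
        obtain o1 where "o1 \<in># Po" using False by auto
        then show ?thesis using True by (intro exI[of _ "{#}"] exI[of _ "{#o1#}"]) auto
      next
        case Wo0: False
        have "size (Pe - We) + size (Po - Wo) \<ge> 1"
          using size_Diff_submset[OF We] size_Diff_submset[OF Wo] size_mset_mono[OF We] size_mset_mono[OF Wo]
            szs Pe(4) Po(4) W(3) p3 by linarith
        then obtain Xe Xo where "Xe \<subseteq># Pe - We" "Xo \<subseteq># Po - Wo" "size Xe + size Xo = 1" by (rule restrict_size)
        then show ?thesis using Wo0 by auto
      qed
      then obtain Xe Xo where Rs: "Xe \<subseteq># Pe - We" "Xo \<subseteq># Po - Wo" "size Xe + size Xo = 1" "Wo + Xo \<noteq> {#}" by blast
      have "We + Xe \<subseteq># We + (Pe - We)" "Wo + Xo \<subseteq># Wo + (Po - Wo)" using Rs(1,2) by simp_all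
      then have sub: "We + Xe \<subseteq># Pe" "Wo + Xo \<subseteq># Po" using We Wo by simp_all
      have fe: "filter_mset ue We = We" "filter_mset uo Wo = Wo"
        using W(1,2) by (auto simp: filter_mset_eq_conv dest: mset_subset_eqD)
      have "size (filter_mset ue (We + Xe)) \<le> size (filter_mset (\<lambda>c. \<not> int p dvd c) (pair_mset (We + Xe)))"
        unfolding ue_def by (rule size_pair_mset_filter_ge)
      then have cnt: "p - 1 \<le> size (filter_mset (\<lambda>q. \<not> int p dvd snd q - fst q) (Wo + Xo)) +
          size (filter_mset (\<lambda>c. \<not> int p dvd c) (pair_mset (We + Xe)))"
        using fe W(3) unfolding uo_def[symmetric] by (simp only: filter_union_mset size_union)
      obtain c where c: "reach s e (pair_mset (We + Xe)) (pair_mset (Wo + Xo)) c" "int p dvd c"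
        "odd s \<longrightarrow> even (c - (pair_sum s e (Wo + Xo) + sum_mset (pair_mset (We + Xe))))"
        by (rule reach_by_flips[OF Rs(4) cnt])
      have "even c" using c(3) odd(1) sumPe[OF sub(1)] sumPo[OF sub(2)] by presburger
      have s1: "pair_mset (We + Xe) \<subseteq># C'" "pair_mset (Wo + Xo) \<subseteq># A'"
        using pair_mset_mono[OF sub(1)] pair_mset_mono[OF sub(2)] unfolding Pe(1) Po(1)
        by (meson mset_subset_eq_add_left subset_mset.order_trans)+
      show ?thesis
        by (rule finish[OF s1 c(1) \<open>even c\<close> c(2)]) (use W(3) Rs(3) p3 in simp)
    next
      case True
      then have A': "A' = Lo" using Po(1) by simp
      show ?thesis
      proof (cases "size A' \<le> 1")
        case True
        then have "size C' + 1 \<ge> 2 * p + 2 * p" using CA(3) by simp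
        then obtain T where T: "T \<subseteq># C'" "size T = 2 * p" "int (2 * p) dvd sum_mset T"
          using erdos_ginzburg_ziv[of "2 * p" "2 * p" C'] p3 by auto
        show ?thesis by (rule hits_mono[OF hits_evens[OF T(1,3,2)] CA(1,2)])
      next
        case False
        then have szA: "size A' = 2" using A' Po(4) by simp
        then obtain a b where ab: "A' = {#a, b#}" by (rule size_2_mset)
        have parab: "even a \<noteq> even b" using Po(3)[of a b] A' ab by simp
        have szC: "2 * (2 * p) = 2 * size Pe + size Le + 2" using szs True szA unfolding A' by simp
        then have "size Le = 0 \<or> size Le = 2" using Pe(4) by presburger
        then show ?thesis
        proof
          assume "size Le = 0"
          then have szPe: "size Pe + 1 = p + p" using szC by simp
          obtain T where T: "T \<subseteq># image_mset (\<lambda>q. fst q + snd q) Pe" "size T = p" "int p dvd sum_mset T"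
            using erdos_ginzburg_ziv[of p p "image_mset (\<lambda>q. fst q + snd q) Pe"] szPe p3 by auto
          obtain Q where Q: "Q \<subseteq># Pe" "T = image_mset (\<lambda>q. fst q + snd q) Q"
            using T(1) by (rule subset_image_msetE)
          have "pair_mset Q \<subseteq># C'" unfolding Pe(1) by (rule pair_mset_le[OF Q(1)])
          moreover have "even (sum_mset (pair_mset Q))" "int p dvd sum_mset (pair_mset Q)"
            using sumPe[OF Q(1)] T(3) Q(2) by (simp_all add: sum_pair_mset)
          moreover have "size (pair_mset Q) + size {#} = 2 * p" using T(2) Q(2) by simp
          ultimately show ?thesis by (intro finish[OF _ _ reach_evens]) auto
        next
          assume "size Le = 2"
          then obtain c0 c1 where c01: "Le = {#c0, c1#}" by (rule size_2_mset)
          have parc: "even c0 \<noteq> even c1" using Pe(3)[of c0 c1] c01 by simp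
          have szU: "size (filter_mset ue Pe) \<ge> p - 1" using units True by simp
          have "filter_mset ue Pe \<noteq> {#}"
          proof
            assume "filter_mset ue Pe = {#}"
            then have "size (filter_mset ue Pe) = 0" by (simp only: size_empty)
            then show False using szU p3 by linarith
          qed
          then obtain u U where U: "filter_mset ue Pe = add_mset u U" by (metis multiset_cases)
          have "p - 2 \<le> size U" using szU U by simp
          then obtain W where W: "W \<subseteq># U" "size W = p - 2" by (rule subset_mset_sizeE)
          have uW: "add_mset u W \<subseteq># filter_mset ue Pe" using U W(1) by simp
          then have uWPe: "add_mset u W \<subseteq># Pe" using multiset_filter_subset subset_mset.order_trans by metis
          have "ue u" using mset_subset_eqD[OF uW, of u] by simp
          then obtain c where c: "c = fst u \<or> c = snd u" "\<not> int p dvd c" unfolding ue_def by blast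
          \<comment> \<open>The pair \<open>(a, b)\<close> has odd value. Parity is restored by
            splitting \<open>u\<close>: its term \<open>c\<close>, nonzero modulo \<open>p\<close>,
            is joined with an unpaired \<open>c'\<close> of the other parity. The
            \<open>p - 2\<close> pairs in \<open>W\<close> and \<open>c\<close> give the
            \<open>p - 1\<close> nonzero flips.\<close>
          obtain c' where c': "c' \<in># Le" "even c' \<noteq> even c" using c01 parc by auto
          let ?C1 = "pair_mset W + {#c, c'#}"
          have "{#c#} \<subseteq># {#fst u, snd u#}" using c(1) by auto
          then have "pair_mset W + {#c#} + {#c'#} \<subseteq># pair_mset W + {#fst u, snd u#} + Le"
            using c'(1) by (intro subset_mset.add_mono) auto
          also have "\<dots> \<subseteq># C'"
            using pair_mset_mono[OF uWPe] unfolding Pe(1) by (intro subset_mset.add_mono) (auto simp: ac_simps)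
          finally have sC: "?C1 \<subseteq># C'" by (simp add: add_mset_commute)
          have fW: "filter_mset ue W = W"
            using uW by (auto simp: filter_mset_eq_conv dest: mset_subset_eqD)
          have cW: "size (filter_mset ue W) \<le> size (filter_mset (\<lambda>c. \<not> int p dvd c) (pair_mset W))"
            unfolding ue_def by (rule size_pair_mset_filter_ge)
          have cnt: "p - 1 \<le> size (filter_mset (\<lambda>q. \<not> int p dvd snd q - fst q) {#(a, b)#}) +
              size (filter_mset (\<lambda>c. \<not> int p dvd c) ?C1)"
          proof -
            have pp: "p - 1 = Suc (p - 2)" using p3 by simp
            show ?thesis unfolding pp using cW c(2) W(2) fW by simp
          qed
          have ne: "{#(a, b)#} \<noteq> {#}" by simp
          obtain d where d: "reach s e ?C1 (pair_mset {#(a, b)#}) d" "int p dvd d"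
            "odd s \<longrightarrow> even (d - (pair_sum s e {#(a, b)#} + sum_mset ?C1))"
            by (rule reach_by_flips[OF ne cnt])
          have "W \<subseteq># Pe" using uWPe by (metis subset_mset.order_trans mset_subset_eq_add_right add_mset_add_single union_commute)
          from sumPe[OF this] have "even (sum_mset (pair_mset W))" .
          moreover have "odd (pair_val s e (a, b))" using parab odd by (auto simp: pair_val_def)
          ultimately have "even d" using d(3) odd(1) c'(2) by simp
          have "pair_mset {#(a, b)#} \<subseteq># A'" using ab by simp
          from finish[OF sC this d(1) \<open>even d\<close> d(2)] show ?thesis using W(2) p3 by simp
        qed
      qed
    qed
  qed
qed

text \<open>Unless one even term or one odd pair is already trivial, all even exponents are nonzero
  and all odd ones distinct modulo \<open>p\<close>. The even ones then give many flips, and the odd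
  ones many different pairs.\<close>

lemma dihedral_short:
  assumes sz: "size C + size A \<ge> p + 1"
  shows "\<exists>L. 0 < L \<and> L \<le> p \<and> hits s e L p C A"
proof -
  have p3: "p \<ge> 3" using p by (metis One_nat_def Suc_1 Suc_leI le_neq_implies_less numeral_3_eq_3 even_numeral prime_ge_2_nat)
  then have p0: "p > 0" by simp
  obtain C' A' where CA: "C' \<subseteq># C" "A' \<subseteq># A" "size C' + size A' = p + 1"
    using sz by (rule restrict_size)
  consider c where "c \<in># C'" "int p dvd c"
    | a b where "{#a, b#} \<subseteq># A'" "int p dvd b - a"
    | "size A' \<le> 1"
    | "size A' \<ge> 2" "\<And>c. c \<in># C' \<Longrightarrow> \<not> int p dvd c" "\<And>a b. {#a, b#} \<subseteq># A' \<Longrightarrow> \<not> int p dvd b - a"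
    by fastforce
  then have "\<exists>L. 0 < L \<and> L \<le> p \<and> hits s e L p C' A'"
  proof cases
    case (1 c)
    then have "hits s e 1 p C' A'" by (intro hits_evens[of "{#c#}"]) auto
    then show ?thesis using p3 by (intro exI[of _ 1]) auto
  next
    case (2 a b)
    have "hits s e 2 p C' A'"
    proof (rule hitsI)
      show "reach s e {#} (pair_mset {#(a, b)#}) (pair_sum s e {#(a, b)#})"
        by (rule reach_pairs)
      show "int p dvd pair_sum s e {#(a, b)#}"
        using pair_val_cong[of "(a, b)"] 2(2) by (simp add: cong_dvd_iff)
    qed (use 2 in auto)
    then show ?thesis using p3 by (intro exI[of _ 2]) auto
  next
    case 3
    then have "p \<le> size C'" using CA(3) by simp
    then obtain D where D: "D \<subseteq># C'" "size D = p" by (rule subset_mset_sizeE)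
    then obtain T where T: "T \<subseteq># D" "T \<noteq> {#}" "int p dvd sum_mset T"
      using davenport_cyclic[OF p0, of D] by auto
    have "hits s e (size T) p C' A'"
      using T(3) subset_mset.order_trans[OF T(1) D(1)] by (intro hits_evens[of T]) auto
    moreover have "size T \<le> p" using size_mset_mono[OF T(1)] D(2) by simp
    ultimately show ?thesis using T(2) by (intro exI[of _ "size T"]) (auto simp: nonempty_has_size)
  next
    case 4
    then have "A' \<noteq> {#}" by auto
    then obtain a A1 where A1: "A' = add_mset a A1" by (metis multiset_cases)
    have nz: "filter_mset (\<lambda>c. \<not> int p dvd c) D = D" if "D \<subseteq># C'" for D
      using 4(2) mset_subset_eqD[OF that] by (auto simp: filter_mset_eq_conv)
    have anz: "\<not> int p dvd b - a" if "b \<in># A1" for b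
      using 4(3)[of a b] that A1 by simp
    show ?thesis
    proof (cases "size A1 = 1")
      case True
      then obtain b where b: "A1 = {#b#}" by (metis size_1_singleton_mset)
      have "p - 2 \<le> size C'" using CA(3) A1 True by simp
      then obtain D where D: "D \<subseteq># C'" "size D = p - 2" by (rule subset_mset_sizeE)
      have ne: "{#(a, b)#} \<noteq> {#}" by simp
      have cnt: "p - 1 \<le> size (filter_mset (\<lambda>q. \<not> int p dvd snd q - fst q) {#(a, b)#}) +
              size (filter_mset (\<lambda>c. \<not> int p dvd c) D)"
        using anz[of b] b nz[OF D(1)] D(2) by simp
      obtain c where c: "reach s e D (pair_mset {#(a, b)#}) c" "int p dvd c"
        by (rule reach_by_flips[OF ne cnt])
      have "hits s e p p C' A'"
        by (rule hitsI[OF D(1) _ c]) (use A1 b D(2) p3 in auto)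
      then show ?thesis using p0 by blast
    next
      case False
      have dist: "count A1 b \<le> 1" for b
      proof (rule ccontr)
        assume "\<not> count A1 b \<le> 1"
        then have "{#b, b#} \<subseteq># A1" by (auto simp: subseteq_mset_def)
        then have "{#b, b#} \<subseteq># A'" unfolding A1 by (rule subset_add_msetI)
        from 4(3)[OF this] show False by simp
      qed
      \<comment> \<open>\<open>g b\<close> is the total flip that makes the product of
        \<open>C'\<close> and the pair \<open>(a, b)\<close> trivial. These targets are distinct,
        the flips of \<open>C'\<close> reach at least \<open>min p (1 + size C')\<close> residues,
        and \<open>1 + size C' + size A1 = p + 1\<close> forces a common one.\<close>
      define g where "g = (\<lambda>b. (- (pair_val s e (a, b) + sum_mset C')) mod int p)"
      have "inj_on g (set_mset A1)"
      proof (rule inj_onI, rule ccontr)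
        fix b b' assume b: "b \<in># A1" "b' \<in># A1" "g b = g b'" "b \<noteq> b'"
        then have "[- (pair_val s e (a, b) + sum_mset C') = - (pair_val s e (a, b') + sum_mset C')] (mod int p)"
          by (simp add: g_def cong_def)
        then have "int p dvd b' - b" by (simp add: cong_iff_dvd_diff pair_val_def)
        moreover have "{#b, b'#} \<subseteq># A1" using b by (simp add: insert_subset_eq_iff in_diff_count)
        then have "{#b, b'#} \<subseteq># A'" unfolding A1 by (rule subset_add_msetI)
        ultimately show False using 4(3) by blast
      qed
      then have "card (g ` set_mset A1) = card (set_mset A1)" by (rule card_image)
      also have "\<dots> = size A1"
      proof -
        have "size A1 = (\<Sum>b\<in>set_mset A1. count A1 b)" by (simp add: size_multiset_overloaded_eq)
        also have "\<dots> = (\<Sum>b\<in>set_mset A1. 1)"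
          using dist by (intro sum.cong) (auto simp: le_Suc_eq count_eq_zero_iff)
        finally show ?thesis by simp
      qed
      finally have cg: "card (g ` set_mset A1) = size A1" .
      define Rs where "Rs = ressums p (image_mset (\<lambda>c. (s - 1) * c) C')"
      have cX: "card Rs \<ge> min p (1 + size C')"
        unfolding Rs_def using card_ressums_prime[OF p(1), of "image_mset (\<lambda>c. (s - 1) * c) C'"] 4(2)
        by (force simp: prime_dvd_flip)
      have "Rs \<inter> g ` set_mset A1 \<noteq> {}"
      proof
        assume disj: "Rs \<inter> g ` set_mset A1 = {}"
        have "Rs \<union> g ` set_mset A1 \<subseteq> {0..<int p}"
          unfolding Rs_def using ressums_bounds[OF p0] p0 by (auto simp: g_def)
        from card_mono[OF _ this] have "card (Rs \<union> g ` set_mset A1) \<le> p" by simp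
        moreover have "card (Rs \<union> g ` set_mset A1) = card Rs + size A1"
          using disj by (subst card_Un_disjoint) (auto simp: Rs_def cg)
        ultimately show False using cX CA(3) A1 4(1) by (simp add: min_def split: if_splits)
      qed
      then obtain b where b: "b \<in># A1" "g b \<in> Rs" by auto
      then obtain E where E: "E \<subseteq># image_mset (\<lambda>c. (s - 1) * c) C'"
        "[sum_mset E = - (pair_val s e (a, b) + sum_mset C')] (mod int p)"
        unfolding Rs_def g_def by (metis ressumsE)
      have "E \<subseteq># flips s C' {#(a, b)#}"
        unfolding flips_def by (rule subset_mset.order_trans[OF E(1)]) simp
      with reach_flips[of "{#(a, b)#}" E s C' e]
      have r: "reach s e C' (pair_mset {#(a, b)#}) (pair_val s e (a, b) + sum_mset C' + sum_mset E)" by simp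
      have "int p dvd sum_mset E - - (pair_val s e (a, b) + sum_mset C')"
        using E(2) by (simp only: cong_iff_dvd_diff)
      then have d: "int p dvd pair_val s e (a, b) + sum_mset C' + sum_mset E" by (simp add: algebra_simps)
      have "hits s e (size C' + 2) p C' A'"
        by (rule hitsI[OF _ _ r d]) (use A1 b in auto)
      moreover have "size C' + 2 \<le> p" using CA(3) A1 4(1) False by simp
      ultimately show ?thesis by (intro exI[of _ "size C' + 2"]) auto
    qed
  qed
  then show ?thesis using hits_mono CA(1,2) by blast
qed

end

subsection \<open>Quotients that are 2-groups\<close>

definition half_sum :: "int \<times> int \<Rightarrow> int" where
  "half_sum p = (fst p + snd p) div 2"

lemma sum_pair_mset_half:
  assumes "\<And>p. p \<in># P \<Longrightarrow> even (fst p) = even (snd p)"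
  shows "sum_mset (pair_mset P) = 2 * sum_mset (image_mset half_sum P)"
  using assms
proof (induction P)
  case (add p P)
  have "even (fst p + snd p)" using add.prems[of p] by simp
  then have "2 * half_sum p = fst p + snd p" by (simp add: half_sum_def)
  moreover have "sum_mset (pair_mset P) = 2 * sum_mset (image_mset half_sum P)"
    by (rule add.IH) (use add.prems in simp)
  ultimately show ?case by simp
qed simp

text \<open>A block of value \<open>q\<close> that is known only modulo \<open>t\<close> can replace two of the terms:
  if the parities of the terms leave two of them unpaired, these two make \<open>q\<close> even or
  are absorbed into it, and the statement for \<open>t\<close> reduces to that for \<open>t / 2\<close>.\<close>

lemma two_power_sums:
  fixes M :: "int multiset"
  assumes "size M + 2 = 4 * 2 ^ j"
  shows "(\<exists>T. T \<subseteq># M \<and> size T = 2 * 2 ^ j \<and> 2 * 2 ^ j dvd sum_mset T) \<or>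
    (\<exists>T. T \<subseteq># M \<and> size T + 2 = 2 * 2 ^ j \<and> 2 ^ j dvd sum_mset T + q)"
  using assms
proof (induction j arbitrary: M q)
  case 0
  show ?case by (rule disjI2, rule exI[of _ "{#}"]) simp
next
  case (Suc j)
  define t :: nat where "t = 2 * 2 ^ j"
  have t0: "t > 0" by (simp add: t_def)
  have it: "int t = 2 * 2 ^ j" by (simp add: t_def)
  obtain P L where PL: "M = pair_mset P + L" "\<And>p. p \<in># P \<Longrightarrow> even (fst p) = even (snd p)"
    "\<And>a b. {#a, b#} \<subseteq># L \<Longrightarrow> even a \<noteq> even b" "size L \<le> 2" using parity_pairing[of M] by metis
  have "size M + 2 = 4 * t" using Suc.prems by (simp add: t_def)
  then have sz: "2 * size P + size L + 2 = 4 * t" using PL(1) by simp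
  have lift: "\<exists>Q. Q \<subseteq># P \<and> size Q = size T \<and> sum_mset (pair_mset Q) = 2 * sum_mset T"
    if "T \<subseteq># image_mset half_sum P" for T
  proof -
    obtain Q where Q: "Q \<subseteq># P" "T = image_mset half_sum Q" using \<open>T \<subseteq># _\<close> by (rule subset_image_msetE)
    have "sum_mset (pair_mset Q) = 2 * sum_mset T"
      unfolding Q(2) by (rule sum_pair_mset_half) (use PL(2) mset_subset_eqD[OF Q(1)] in blast)
    then show ?thesis using Q by auto
  qed
  have first: "\<exists>T. T \<subseteq># M \<and> size T = 2 * t \<and> 2 * int t dvd sum_mset T"
    if T: "T \<subseteq># image_mset half_sum P" "size T = t" "int t dvd sum_mset T" for T
  proof -
    obtain Q where Q: "Q \<subseteq># P" "size Q = size T" "sum_mset (pair_mset Q) = 2 * sum_mset T"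
      using lift[OF T(1)] by blast
    have "pair_mset Q \<subseteq># M" unfolding PL(1) by (rule pair_mset_le[OF Q(1)])
    then show ?thesis using Q T by (intro exI[of _ "pair_mset Q"]) (auto intro: mult_dvd_mono)
  qed
  have main: "(\<exists>T. T \<subseteq># M \<and> size T = 2 * t \<and> 2 * int t dvd sum_mset T) \<or>
    (\<exists>T. T \<subseteq># M \<and> size T + 2 = 2 * t \<and> int t dvd sum_mset T + q)"
  proof (cases "size L = 2")
    case False
    then have "size L = 0" using sz PL(4) by presburger
    then have "size P + 1 = t + t" using sz by simp
    then obtain T where "T \<subseteq># image_mset half_sum P" "size T = t" "int t dvd sum_mset T"
      using erdos_ginzburg_ziv[of t t "image_mset half_sum P"] t0 by auto
    then show ?thesis using first by blast
  next
    case True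
    then obtain a b where ab: "L = {#a, b#}" by (rule size_2_mset)
    have par: "even a \<noteq> even b" using PL(3)[of a b] ab by simp
    have szP: "size P + 2 = 2 * t" using sz True by simp
    show ?thesis
    proof (cases "even q")
      case True
      \<comment> \<open>The half of \<open>q\<close> is the one term that the
        \<open>2 * t - 2\<close> halves lack for Erdos-Ginzburg-Ziv modulo \<open>t\<close>. If it
        is selected, it stands for two terms of the original sequence, which is the second
        alternative.\<close>
      have "size (add_mset (q div 2) (image_mset half_sum P)) + 1 \<ge> t + t" using szP by simp
      then obtain T where T: "T \<subseteq># add_mset (q div 2) (image_mset half_sum P)" "size T = t" "int t dvd sum_mset T"
        using erdos_ginzburg_ziv[of t t "add_mset (q div 2) (image_mset half_sum P)"] t0 by auto
      show ?thesis
      proof (cases "q div 2 \<in># T")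
        case False
        then have "T \<subseteq># image_mset half_sum P"
          using T(1) by (metis add_mset_add_single diff_single_trivial subset_eq_diff_conv)
        then show ?thesis using first T by blast
      next
        case q: True
        then obtain T' where T': "T = add_mset (q div 2) T'" by (meson multi_member_split)
        then have "T' \<subseteq># image_mset half_sum P" using T(1) by simp
        then obtain Q where Q: "Q \<subseteq># P" "size Q = size T'" "sum_mset (pair_mset Q) = 2 * sum_mset T'"
          using lift by blast
        have "pair_mset Q \<subseteq># M" unfolding PL(1) by (rule pair_mset_le[OF Q(1)])
        moreover have "size (pair_mset Q) + 2 = 2 * t" using Q(2) T' T(2) by simp
        moreover have "sum_mset (pair_mset Q) + q = 2 * sum_mset T" using T' True Q(3) by simp
        then have "int t dvd sum_mset (pair_mset Q) + q" using T(3) by simp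
        ultimately show ?thesis by blast
      qed
    next
      case False
      then have q: "even (q + a + b)" using par by simp
      have "size (image_mset half_sum P) + 2 = 4 * 2 ^ j" using szP by (simp add: t_def)
      from Suc.IH[OF this, of "(q + a + b) div 2"] show ?thesis
      proof
        assume "\<exists>T. T \<subseteq># image_mset half_sum P \<and> size T = 2 * 2 ^ j \<and> 2 * 2 ^ j dvd sum_mset T"
        then show ?thesis using first it t_def by auto
      next
        assume "\<exists>T. T \<subseteq># image_mset half_sum P \<and> size T + 2 = 2 * 2 ^ j \<and> 2 ^ j dvd sum_mset T + (q + a + b) div 2"
        then obtain T where T: "T \<subseteq># image_mset half_sum P" "size T + 2 = t"
          "2 ^ j dvd sum_mset T + (q + a + b) div 2" unfolding t_def by blast
        obtain Q where Q: "Q \<subseteq># P" "size Q = size T" "sum_mset (pair_mset Q) = 2 * sum_mset T"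
          using lift[OF T(1)] by blast
        have "pair_mset Q + L \<subseteq># M" unfolding PL(1) using pair_mset_mono[OF Q(1)] by simp
        moreover have "size (pair_mset Q + L) + 2 = 2 * t" using Q(2) T(2) True \<open>size L = 2\<close> by simp
        moreover have "sum_mset (pair_mset Q + L) + q = 2 * (sum_mset T + (q + a + b) div 2)"
          using q Q(3) ab by simp
        then have "int t dvd sum_mset (pair_mset Q + L) + q" unfolding it using T(3)
          by (simp only: mult_dvd_mono dvd_refl)
        ultimately show ?thesis by blast
      qed
    qed
  qed
  have e1: "2 * t = 2 * 2 ^ Suc j" "int t = 2 ^ Suc j" by (simp_all add: t_def)
  show ?case using main unfolding e1 by simp
qed

context
  fixes t j :: nat and s e :: int
  assumes t: "t = 2 ^ j" and s: "[s = 1 + 2 * int t] (mod int (4 * t))" and e: "2 * int t dvd e"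
begin

lemma modular_pos: "t > 0" by (simp add: t)

lemma modular_mult_odd: "odd s"
proof -
  have "int (4 * t) dvd s - (1 + 2 * int t)" using s by (simp only: cong_iff_dvd_diff)
  then have "2 dvd s - (1 + 2 * int t)" by (rule dvd_trans[rotated]) simp
  then show ?thesis by simp
qed

lemma modular_offset_even: "even e" using e by (rule dvd_trans[rotated]) simp

text \<open>The only nonzero flip modulo \<open>4 * t\<close> is \<open>2 * t\<close>, so values
  have to be arranged modulo \<open>2 * t\<close> before any flip helps.\<close>

lemma flip_odd:
  assumes "odd c" shows "[(s - 1) * c = 2 * int t] (mod int (4 * t))"
proof -
  have "[(s - 1) * c = (1 + 2 * int t - 1) * c] (mod int (4 * t))"
    by (intro cong_mult cong_diff s cong_refl)
  also have "(1 + 2 * int t - 1) * c = 2 * int t + int (4 * t) * (c div 2)"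
    using assms by (auto elim!: oddE simp: algebra_simps)
  also have "[\<dots> = 2 * int t] (mod int (4 * t))" by (simp add: cong_def)
  finally show ?thesis .
qed

definition parity_blocks ::
  "(int \<times> int) multiset \<Rightarrow> (int \<times> int) multiset \<Rightarrow> block multiset" where
  "parity_blocks Pe Po = image_mset (\<lambda>p. ({#fst p, snd p#}, {#}, fst p + snd p)) Pe +
    image_mset (\<lambda>p. ({#}, {#fst p, snd p#}, pair_val s e p)) Po"

lemma parity_blocks_props:
  assumes "\<forall>p\<in>#Pe. even (fst p) = even (snd p)" "\<forall>p\<in>#Po. even (fst p) = even (snd p)"
  shows "b \<in># parity_blocks Pe Po \<Longrightarrow> is_block s e 2 b"
    and "b \<in># parity_blocks Pe Po \<Longrightarrow> block_size b = 2"
    and "sum_mset (image_mset fst (parity_blocks Pe Po)) = pair_mset Pe"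
    and "sum_mset (image_mset (fst \<circ> snd) (parity_blocks Pe Po)) = pair_mset Po"
    and "size (parity_blocks Pe Po) = size Pe + size Po"
proof -
  have r1: "reach s e {#a, b#} {#} (a + b)" for a b using reach_evens[of s e "{#a, b#}"] by simp
  have r2: "reach s e {#} {#a, b#} (pair_val s e (a, b))" for a b
    using reach_pairs[of s e "{#(a, b)#}"] by simp
  show "is_block s e 2 b" if "b \<in># parity_blocks Pe Po"
  proof -
    from that consider p where "p \<in># Pe" "b = ({#fst p, snd p#}, {#}, fst p + snd p)"
      | p where "p \<in># Po" "b = ({#}, {#fst p, snd p#}, pair_val s e p)"
      by (auto simp: parity_blocks_def)
    then show ?thesis
    proof cases
      case (1 p)
      then show ?thesis using bspec[OF assms(1) 1(1)] r1[of "fst p" "snd p"] by (simp add: is_block_def)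
    next
      case (2 p)
      have "even (pair_val s e p)" using bspec[OF assms(2) 2(1)] modular_mult_odd modular_offset_even by (auto simp: pair_val_def)
      then show ?thesis using 2(2) r2[of "fst p" "snd p"] by (simp add: is_block_def)
    qed
  qed
  show "block_size b = 2" if "b \<in># parity_blocks Pe Po"
    using that by (auto simp: parity_blocks_def block_size_def)
  have a: "sum_mset (image_mset (\<lambda>p. {#fst p, snd p#}) P) = pair_mset P" for P :: "(int \<times> int) multiset"
    by (induction P) auto
  show "sum_mset (image_mset fst (parity_blocks Pe Po)) = pair_mset Pe"
    "sum_mset (image_mset (fst \<circ> snd) (parity_blocks Pe Po)) = pair_mset Po"
    by (simp_all add: parity_blocks_def multiset.map_comp comp_def a)
  show "size (parity_blocks Pe Po) = size Pe + size Po" by (simp add: parity_blocks_def)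
qed

text \<open>The value is 0 or \<open>2 * t\<close> modulo \<open>4 * t\<close>; in the second case
  \<open>c\<close> is moved between the odd terms \<open>a\<close> and \<open>b\<close>.\<close>

lemma modular_flip:
  assumes B: "\<And>b. b \<in># B \<Longrightarrow> is_block s e 2 b" and c: "c \<in># C0" "odd c"
    and V: "2 * int t dvd vals_of B + (sum_mset C0 + pair_val s e (a, b))"
    and sub: "evens_of B + C0 \<subseteq># C" "odds_of B + {#a, b#} \<subseteq># A"
  shows "hits s e (total_size B + size C0 + 2) (4 * t) C A"
proof -
  let ?V = "vals_of B + (sum_mset C0 + pair_val s e (a, b))"
  have "\<exists>E. E \<subseteq># {#(s - 1) * c#} \<and> int (4 * t) dvd ?V + sum_mset E"
  proof (cases "int (4 * t) dvd ?V")
    case True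
    then show ?thesis by (intro exI[of _ "{#}"]) simp
  next
    case False
    obtain v where v: "?V = 2 * int t * v" using V by (rule dvdE)
    have "odd v" using False unfolding v by (auto elim!: evenE)
    then have "int (4 * t) dvd ?V + 2 * int t" unfolding v by (auto elim!: oddE simp: algebra_simps)
    moreover have "[?V + (s - 1) * c = ?V + 2 * int t] (mod int (4 * t))"
      by (intro cong_add cong_refl flip_odd c)
    ultimately have "int (4 * t) dvd ?V + (s - 1) * c" by (simp add: cong_dvd_iff)
    then show ?thesis by (intro exI[of _ "{#(s - 1) * c#}"]) simp
  qed
  then obtain E where E: "E \<subseteq># {#(s - 1) * c#}" "int (4 * t) dvd ?V + sum_mset E" by blast
  have "{#(s - 1) * c#} \<subseteq># image_mset (\<lambda>c. (s - 1) * c) C0" using c(1) by auto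
  then have "E \<subseteq># flips s C0 {#(a, b)#}"
    unfolding flips_def by (intro subset_mset.order_trans[OF E(1)]) (auto intro: subset_mset.order_trans)
  from reach_flips[OF _ this] have "reach s e C0 {#a, b#} (pair_val s e (a, b) + sum_mset C0 + sum_mset E)" by simp
  from reach_union[OF reach_blocks[OF B] this]
  have r: "reach s e (evens_of B + C0) (odds_of B + {#a, b#}) (?V + sum_mset E)"
    by (simp add: algebra_simps)
  show ?thesis
    by (rule hitsI[OF sub r E(2)]) (use size_blocks[of B] in simp)
qed

lemma block_subset_sums:
  assumes B: "\<And>b. b \<in># B \<Longrightarrow> is_block s e 2 b" and T: "T \<subseteq># image_mset (\<lambda>b. snd (snd b) div 2) B"
  obtains B1 where "B1 \<subseteq># B" "size B1 = size T" "vals_of B1 = 2 * sum_mset T"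
proof -
  obtain B1 where B1: "B1 \<subseteq># B" "T = image_mset (\<lambda>b. snd (snd b) div 2) B1"
    using T by (rule subset_image_msetE)
  have bl: "is_block s e 2 b" if "b \<in># B1" for b using B mset_subset_eqD[OF B1(1) that] by blast
  have "vals_of B1 = 2 * sum_mset T"
    unfolding B1(2) using bl
  proof (induction B1)
    case (add x B1)
    have "even (snd (snd x))" using add.prems[of x] by (simp add: is_block_def)
    then show ?case using add by simp
  qed simp
  then show ?thesis using that B1 by simp
qed

lemma modular_exact:
  assumes sz: "size C + size A \<ge> 2 * (4 * t)"
  shows "hits s e (4 * t) (4 * t) C A"
proof -
  obtain C' A' where CA: "C' \<subseteq># C" "A' \<subseteq># A" "size C' + size A' = 2 * (4 * t)"
    using sz by (rule restrict_size)
  obtain Pe Le where Pe: "C' = pair_mset Pe + Le" "\<And>q. q \<in># Pe \<Longrightarrow> even (fst q) = even (snd q)"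
    "\<And>a b. {#a, b#} \<subseteq># Le \<Longrightarrow> even a \<noteq> even b" "size Le \<le> 2" using parity_pairing[of C'] by metis
  obtain Po Lo where Po: "A' = pair_mset Po + Lo" "\<And>q. q \<in># Po \<Longrightarrow> even (fst q) = even (snd q)"
    "\<And>a b. {#a, b#} \<subseteq># Lo \<Longrightarrow> even a \<noteq> even b" "size Lo \<le> 2" using parity_pairing[of A'] by metis
  define B where "B = parity_blocks Pe Po"
  have ev: "\<forall>p\<in>#Pe. even (fst p) = even (snd p)" "\<forall>p\<in>#Po. even (fst p) = even (snd p)"
    using Pe(2) Po(2) by blast+
  note bl = parity_blocks_props[OF ev, folded B_def]
  have szs: "2 * (4 * t) = 2 * size B + size Le + size Lo" using CA(3) Pe(1) Po(1) bl(5) by simp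
  have subB: "evens_of B \<subseteq># C'" "odds_of B \<subseteq># A'"
    using bl(3,4) Pe(1) Po(1) by simp_all
  let ?W = "image_mset (\<lambda>b. snd (snd b) div int 2) B"
  have pure: "hits s e (4 * t) (4 * t) C' A'" if T: "T \<subseteq># ?W" "size T = 2 * t" "int (2 * t) dvd sum_mset T" for T
  proof -
    obtain B1 where B1: "B1 \<subseteq># B" "size B1 = size T" "hits s e (total_size B1) (2 * (2 * t)) C' A'"
      using hits_blocks[of 2 B s e C' A' T "2 * t"] bl(1) subB T by auto
    have "total_size B1 = 2 * size B1"
      by (rule sum_block_size_const) (use bl(2) mset_subset_eqD[OF B1(1)] in blast)
    then show ?thesis using B1(2,3) T(2) by simp
  qed
  have "hits s e (4 * t) (4 * t) C' A'"
  proof (cases "size Le = 2 \<and> size Lo = 2")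
    case False
    then have "size Le + size Lo \<le> 2" using szs Pe(4) Po(4) by presburger
    then have "size ?W + 1 \<ge> 2 * t + 2 * t" using szs by simp
    then obtain T where "T \<subseteq># ?W" "size T = 2 * t" "int (2 * t) dvd sum_mset T"
      using erdos_ginzburg_ziv[of "2 * t" "2 * t" ?W] modular_pos by auto
    then show ?thesis by (rule pure)
  next
    case True
    obtain c0 c1 where c: "Le = {#c0, c1#}" using True by (auto elim: size_2_mset)
    obtain a0 a1 where a: "Lo = {#a0, a1#}" using True by (auto elim: size_2_mset)
    have parc: "even c0 \<noteq> even c1" and para: "even a0 \<noteq> even a1"
      using Pe(3)[of c0 c1] c Po(3)[of a0 a1] a by simp_all
    define q where "q = (sum_mset Le + pair_val s e (a0, a1)) div 2"
    have "even (sum_mset Le + pair_val s e (a0, a1))"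
      using parc para modular_mult_odd modular_offset_even by (auto simp: pair_val_def c)
    then have q: "sum_mset Le + pair_val s e (a0, a1) = 2 * q" by (simp add: q_def)
    \<comment> \<open>The \<open>4 * t - 2\<close> block values are one short of Erdos-Ginzburg-Ziv
      for length \<open>2 * t\<close> modulo \<open>2 * t\<close>. The four unpaired terms, of total
      value \<open>2 * q\<close>, compensate: with them a sum modulo \<open>t\<close> suffices, and
      a flip does the rest.\<close>
    have "size ?W + 2 = 4 * 2 ^ j" using szs True by (simp add: t)
    from two_power_sums[OF this, of q] show ?thesis
    proof
      assume "\<exists>T. T \<subseteq># ?W \<and> size T = 2 * 2 ^ j \<and> 2 * 2 ^ j dvd sum_mset T"
      then show ?thesis using pure by (auto simp: t)
    next
      assume "\<exists>T. T \<subseteq># ?W \<and> size T + 2 = 2 * 2 ^ j \<and> 2 ^ j dvd sum_mset T + q"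
      then obtain T where T: "T \<subseteq># ?W" "size T + 2 = 2 * t" "int t dvd sum_mset T + q"
        by (auto simp: t)
      have T1: "T \<subseteq># image_mset (\<lambda>b. snd (snd b) div 2) B" using T(1) by simp
      obtain B1 where B1: "B1 \<subseteq># B" "size B1 = size T" "vals_of B1 = 2 * sum_mset T"
        using bl(1) T1 by (rule block_subset_sums)
      obtain c' where c': "c' \<in># Le" "odd c'" using parc by (auto simp: c)
      have V: "2 * int t dvd vals_of B1 + (sum_mset Le + pair_val s e (a0, a1))"
        
        proof -
          have "2 * int t dvd 2 * (sum_mset T + q)" using T(3) by (intro mult_dvd_mono) auto
          then show ?thesis by (simp only: B1(3) q distrib_left)
        qed
      have s1: "evens_of B1 + Le \<subseteq># C'"
        using sum_image_mset_mono[OF B1(1), of fst] unfolding Pe(1) bl(3) by simp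
      have s2: "odds_of B1 + {#a0, a1#} \<subseteq># A'"
        using sum_image_mset_mono[OF B1(1), of "fst \<circ> snd"] unfolding Po(1) bl(4) a
        by (rule subset_mset.add_right_mono)
      have h: "hits s e (total_size B1 + size Le + 2) (4 * t) C' A'"
        by (rule modular_flip[OF _ c' V s1 s2]) (use bl(1) mset_subset_eqD[OF B1(1)] in blast)
      moreover have "total_size B1 = 2 * size B1"
        by (rule sum_block_size_const) (use bl(2) mset_subset_eqD[OF B1(1)] in blast)
      ultimately have "total_size B1 + size Le + 2 = 4 * t"
        using B1(2) T(2) True by linarith
      then show ?thesis using h by simp
    qed
  qed
  then show ?thesis using hits_mono CA(1,2) by blast
qed

lemma modular_short:
  assumes sz: "size C + size A \<ge> 4 * t + 1"
  shows "\<exists>L. 0 < L \<and> L \<le> 4 * t \<and> hits s e L (4 * t) C A"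
proof -
  obtain C' A' where CA: "C' \<subseteq># C" "A' \<subseteq># A" "size C' + size A' = 4 * t + 1"
    using sz by (rule restrict_size)
  obtain Pe Le where Pe: "C' = pair_mset Pe + Le" "\<And>q. q \<in># Pe \<Longrightarrow> even (fst q) = even (snd q)"
    "\<And>a b. {#a, b#} \<subseteq># Le \<Longrightarrow> even a \<noteq> even b" "size Le \<le> 2" using parity_pairing[of C'] by metis
  obtain Po Lo where Po: "A' = pair_mset Po + Lo" "\<And>q. q \<in># Po \<Longrightarrow> even (fst q) = even (snd q)"
    "\<And>a b. {#a, b#} \<subseteq># Lo \<Longrightarrow> even a \<noteq> even b" "size Lo \<le> 2" using parity_pairing[of A'] by metis
  define B where "B = parity_blocks Pe Po"
  have ev: "\<forall>p\<in>#Pe. even (fst p) = even (snd p)" "\<forall>p\<in>#Po. even (fst p) = even (snd p)"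
    using Pe(2) Po(2) by blast+
  note bl = parity_blocks_props[OF ev, folded B_def]
  have szs: "4 * t + 1 = 2 * size B + size Le + size Lo" using CA(3) Pe(1) Po(1) bl(5) by simp
  have subB: "evens_of B \<subseteq># C'" "odds_of B \<subseteq># A'"
    using bl(3,4) Pe(1) Po(1) by simp_all
  have pure: "\<exists>L. 0 < L \<and> L \<le> 4 * t \<and> hits s e L (4 * t) C' A'"
    if D: "\<And>b. b \<in># D \<Longrightarrow> is_block s e 2 b" "\<And>b. b \<in># D \<Longrightarrow> 0 < block_size b"
      "evens_of D \<subseteq># C'" "odds_of D \<subseteq># A'"
      "total_size D \<le> 4 * t"
      and T: "T \<subseteq># image_mset (\<lambda>b. snd (snd b) div int 2) D" "T \<noteq> {#}" "int (2 * t) dvd sum_mset T" for D T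
  proof -
    obtain D1 where D1: "D1 \<subseteq># D" "size D1 = size T" "hits s e (total_size D1) (2 * (2 * t)) C' A'"
      using hits_blocks[of 2 D s e C' A' T "2 * t"] D T by auto
    have "total_size D1 \<le> total_size D"
      using D1(1) by (auto simp: mset_subset_eq_exists_conv)
    moreover have "0 < total_size D1"
    proof -
      have "D1 \<noteq> {#}" using T(2) D1(2) by auto
      then obtain x D2 where x: "D1 = add_mset x D2" by (metis multiset_cases)
      then have "x \<in># D" using mset_subset_eqD[OF D1(1)] by simp
      then show ?thesis using D(2)[of x] x by simp
    qed
    ultimately show ?thesis using D1(3) D(5) by (intro exI[of _ "total_size D1"]) simp
  qed
  let ?W = "image_mset (\<lambda>b. snd (snd b) div int 2) B"
  have szB: "total_size B = 2 * size B"
    by (rule sum_block_size_const) (use bl(2) in blast)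
  have "\<exists>L. 0 < L \<and> L \<le> 4 * t \<and> hits s e L (4 * t) C' A'"
  \<comment> \<open>The number of terms is odd, so one or three stay unpaired. With one there are
    \<open>2 * t\<close> blocks, the Davenport constant modulo \<open>2 * t\<close>.\<close>
  proof (cases "size Le + size Lo = 1")
    case True
    then have "2 * t \<le> size ?W" using szs by simp
    then obtain T where T: "T \<subseteq># ?W" "T \<noteq> {#}" "int (2 * t) dvd sum_mset T"
      using davenport_cyclic[of "2 * t" ?W] modular_pos by auto
    have b0: "0 < block_size b" if "b \<in># B" for b using bl(2)[OF that] by simp
    have "total_size B \<le> 4 * t" using szB szs by simp
    from pure[OF bl(1) b0 subB this T] show ?thesis by blast
  next
    case False
    then have L3: "size Le + size Lo = 3" using szs Pe(4) Po(4) by presburger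
    show ?thesis
    proof (cases "\<exists>c\<in>#Le. even c")
      case True
      then obtain c0 where c0: "c0 \<in># Le" "even c0" by blast
      define D where "D = add_mset ({#c0#}, {#}, c0) B"
      have b1: "is_block s e 2 b" if "b \<in># D" for b
      proof (cases "b \<in># B")
        case False
        then show ?thesis using that c0(2) reach_evens[of s e "{#c0#}"] by (simp add: D_def is_block_def)
      qed (rule bl(1))
      have b2: "0 < block_size b" if "b \<in># D" for b
      proof (cases "b \<in># B")
        case False
        then show ?thesis using that by (simp add: D_def block_size_def)
      next
        case True
        then show ?thesis using bl(2)[OF True] by simp
      qed
      have d1: "evens_of D \<subseteq># C'"
        unfolding Pe(1) using bl(3) c0(1) by (simp add: D_def)
      have d2: "odds_of D \<subseteq># A'"
        using subB(2) by (simp add: D_def)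
      have d3: "total_size D \<le> 4 * t"
        using szB szs L3 by (simp add: D_def block_size_def)
      have "2 * t \<le> size (image_mset (\<lambda>b. snd (snd b) div int 2) D)" using szs L3 by (simp add: D_def)
      then obtain T where T: "T \<subseteq># image_mset (\<lambda>b. snd (snd b) div int 2) D" "T \<noteq> {#}" "int (2 * t) dvd sum_mset T"
        using davenport_cyclic[of "2 * t" "image_mset (\<lambda>b. snd (snd b) div int 2) D"] modular_pos by auto
      from pure[OF b1 b2 d1 d2 d3 T] show ?thesis by blast
    next
      case noeven: False
      have "size Le \<noteq> 2"
      proof
        assume "size Le = 2"
        then obtain c0 c1 where "Le = {#c0, c1#}" by (rule size_2_mset)
        then show False using Pe(3)[of c0 c1] noeven by auto
      qed
      then have "size Le = 1" "size Lo = 2" using L3 Pe(4) Po(4) by linarith+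
      then obtain c1 a0 a1 where c: "Le = {#c1#}" and a: "Lo = {#a0, a1#}"
        by (metis size_1_singleton_mset size_2_mset)
      have oddc: "odd c1" using noeven c by simp
      have para: "even a0 \<noteq> even a1" using Po(3)[of a0 a1] a by simp
      define q where "q = (sum_mset Le + pair_val s e (a0, a1)) div 2"
      have "even (sum_mset Le + pair_val s e (a0, a1))"
        using oddc para modular_mult_odd modular_offset_even by (auto simp: pair_val_def c)
      then have q: "sum_mset Le + pair_val s e (a0, a1) = 2 * q" by (simp add: q_def)
      have szW: "size ?W = 2 * t - 1" using szs L3 by simp
      show ?thesis
      proof (cases "zero_sum_free (2 * t) ?W")
        case False
        then obtain T where T: "T \<subseteq># ?W" "T \<noteq> {#}" "int (2 * t) dvd sum_mset T"
          unfolding zero_sum_free_def by blast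
        have b0: "0 < block_size b" if "b \<in># B" for b using bl(2)[OF that] by simp
        have "total_size B \<le> 4 * t" using szB szs by simp
        from pure[OF bl(1) b0 subB this T] show ?thesis by blast
      next
        case True
        \<comment> \<open>All blocks together with the three unpaired terms would be too long by one
          term, so one value is dropped. The others have at least \<open>2 * t - 1\<close> subset
          sums modulo \<open>2 * t\<close> and miss at most one residue, whereas \<open>- q\<close>
          modulo \<open>t\<close> comes from two.\<close>
        have "2 * t - 2 \<le> size ?W" using szW by simp
        then obtain W' where W': "W' \<subseteq># ?W" "size W' = 2 * t - 2" by (rule subset_mset_sizeE)
        have "zero_sum_free (2 * t) W'"
          using True W'(1) unfolding zero_sum_free_def by (meson subset_mset.order_trans)
        then have cW: "card (ressums (2 * t) W') \<ge> 2 * t - 1"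
          using zero_sum_free_card[of "2 * t" W'] W'(2) modular_pos by linarith
        have "\<exists>T. T \<subseteq># W' \<and> int t dvd sum_mset T + q"
        proof (rule ccontr)
          assume no: "\<not> ?thesis"
          have not_in: "z mod int (2 * t) \<notin> ressums (2 * t) W'" if "[z = - q] (mod int t)" for z
          proof
            assume "z mod int (2 * t) \<in> ressums (2 * t) W'"
            then obtain E where E: "E \<subseteq># W'" "[sum_mset E = z] (mod int (2 * t))" by (rule ressumsE)
            have "[sum_mset E = z] (mod int t)" using E(2) by (rule cong_dvd_modulus) simp
            then have "[sum_mset E = - q] (mod int t)" using that by (rule cong_trans)
            then have "int t dvd sum_mset E - - q" by (simp only: cong_iff_dvd_diff)
            then show False using no E(1) by simp
          qed
          let ?z1 = "(- q) mod int (2 * t)" and ?z2 = "(- q + int t) mod int (2 * t)"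
          have ne: "?z1 \<noteq> ?z2"
          proof
            assume "?z1 = ?z2"
            then have "int (2 * t) dvd - q + int t - (- q)" by (simp add: mod_eq_dvd_iff dvd_diff_commute)
            then have "2 * t dvd t" by (simp flip: int_dvd_int_iff)
            then show False using modular_pos by (auto dest: dvd_imp_le)
          qed
          have "ressums (2 * t) W' \<subseteq> {0..<int (2 * t)} - {?z1, ?z2}"
            using ressums_bounds[of "2 * t" W'] not_in[of "- q"] not_in[of "- q + int t"] modular_pos
            by (auto simp: cong_def)
          then have "card (ressums (2 * t) W') \<le> card ({0..<int (2 * t)} - {?z1, ?z2})"
            by (intro card_mono) auto
          also have "\<dots> = 2 * t - 2"
            using ne modular_pos by (subst card_Diff_subset) auto
          finally show False using cW modular_pos by linarith
        qed
        then obtain T where T: "T \<subseteq># W'" "int t dvd sum_mset T + q" by blast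
        have T1: "T \<subseteq># image_mset (\<lambda>b. snd (snd b) div 2) B"
          using subset_mset.order_trans[OF T(1) W'(1)] by simp
        obtain B1 where B1: "B1 \<subseteq># B" "size B1 = size T" "vals_of B1 = 2 * sum_mset T"
          using bl(1) T1 by (rule block_subset_sums)
        have V: "2 * int t dvd vals_of B1 + (sum_mset Le + pair_val s e (a0, a1))"
          
        proof -
          have "2 * int t dvd 2 * (sum_mset T + q)" using T(2) by (intro mult_dvd_mono) auto
          then show ?thesis by (simp only: B1(3) q distrib_left)
        qed
        have s1: "evens_of B1 + Le \<subseteq># C'"
          using sum_image_mset_mono[OF B1(1), of fst] unfolding Pe(1) bl(3) by simp
        have s2: "odds_of B1 + {#a0, a1#} \<subseteq># A'"
          using sum_image_mset_mono[OF B1(1), of "fst \<circ> snd"] unfolding Po(1) bl(4) a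
          by (rule subset_mset.add_right_mono)
        have c1: "c1 \<in># Le" using c by simp
        have h: "hits s e (total_size B1 + size Le + 2) (4 * t) C' A'"
          by (rule modular_flip[OF _ c1 oddc V s1 s2]) (use bl(1) mset_subset_eqD[OF B1(1)] in blast)
        have "total_size B1 = 2 * size B1"
          by (rule sum_block_size_const) (use bl(2) mset_subset_eqD[OF B1(1)] in blast)
        moreover have "size B1 \<le> 2 * t - 2" using B1(2) size_mset_mono[OF T(1)] W'(2) by simp
        ultimately have "total_size B1 + size Le + 2 \<le> 4 * t"
          using c modular_pos by simp
        then show ?thesis using h by (intro exI[of _ "total_size B1 + size Le + 2"]) simp
      qed
    qed
  qed
  then show ?thesis using hits_mono CA(1,2) by blast
qed

end

subsection \<open>Lifting to \<open>n\<close>\<close>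

text \<open>If no odd prime divisor of \<open>n\<close> divides \<open>s + 1\<close>, then the odd
  part \<open>r\<close> is coprime to \<open>s + 1\<close> and divides \<open>s - 1\<close>, so the
  power of 2 in \<open>n\<close> does not.\<close>

lemma square_one_cases:
  fixes s :: int
  assumes n: "n > 0" "even n" and s2: "int n dvd s\<^sup>2 - 1" and s1: "\<not> int n dvd s - 1"
  obtains p where "Factorial_Ring.prime p" "odd p" "p dvd n" "[s = -1] (mod int p)"
  | j where "4 * 2 ^ j dvd n" "[s = 1 + 2 * int (2 ^ j)] (mod int (4 * 2 ^ j))"
proof (cases "\<exists>p. Factorial_Ring.prime p \<and> odd p \<and> p dvd n \<and> int p dvd s + 1")
  case True
  then obtain p where p: "Factorial_Ring.prime p" "odd p" "p dvd n" "int p dvd s + 1" by blast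
  then have "[s = -1] (mod int p)" by (simp add: cong_iff_dvd_diff)
  then show ?thesis using that(1) p by blast
next
  case False
  have "n \<noteq> 0" using n by simp
  then obtain r where r: "n = 2 ^ multiplicity 2 n * r" "\<not> 2 dvd r"
    using multiplicity_decompose'[of n 2] by auto
  define a where "a = multiplicity 2 n"
  have nr: "n = 2 ^ a * r" unfolding a_def by (rule r(1))
  have "coprime (s + 1) (int r)"
  proof (rule ccontr)
    assume "\<not> coprime (s + 1) (int r)"
    then obtain c where c: "c dvd s + 1" "c dvd int r" "\<not> is_unit c" by (rule not_coprimeE)
    have "nat \<bar>c\<bar> \<noteq> 1" using c(3) by auto
    then obtain p where p: "Factorial_Ring.prime p" "p dvd nat \<bar>c\<bar>" using prime_factor_nat by blast
    have pc: "int p dvd c" using p(2) by (simp only: dvd_nat_abs_iff)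
    have "int p dvd int r" using pc c(2) by (rule dvd_trans)
    then have pr: "p dvd r" by (simp only: int_dvd_int_iff)
    have "int p dvd s + 1" using pc c(1) by (rule dvd_trans)
    moreover have "odd p" using pr r(2) by (blast intro: dvd_trans)
    moreover have "p dvd n" unfolding nr using pr by (rule dvd_mult)
    ultimately show False using False p(1) by blast
  qed
  moreover have "int r dvd (s - 1) * (s + 1)"
  proof -
    have "int r dvd int n" using nr by simp
    moreover have "s\<^sup>2 - 1 = (s - 1) * (s + 1)" by (simp add: power2_eq_square algebra_simps)
    ultimately show ?thesis using s2 dvd_trans by metis
  qed
  ultimately have rs: "int r dvd s - 1" by (simp add: coprime_dvd_mult_left_iff coprime_commute)
  have na: "\<not> 2 ^ a dvd s - 1"
  proof
    assume "2 ^ a dvd s - 1"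
    moreover have "coprime (2 ^ a) (int r)" using r(2) by simp
    ultimately have "2 ^ a * int r dvd s - 1" using rs by (simp add: divides_mult)
    then show False using s1 nr by simp
  qed
  \<comment> \<open>As \<open>s\<close> is odd, \<open>k\<close> is at least 2, and
    \<open>s - 1\<close> is an odd multiple of \<open>2 ^ (k - 1)\<close>; with
    \<open>k = j + 2\<close> this is the second alternative.\<close>
  define k where "k = (LEAST k. \<not> 2 ^ k dvd s - 1)"
  have k: "\<not> 2 ^ k dvd s - 1" unfolding k_def by (rule LeastI[of _ a]) (rule na)
  have ka: "k \<le> a" unfolding k_def by (rule Least_le) (rule na)
  have small: "2 ^ i dvd s - 1" if "i < k" for i
    using not_less_Least[of i "\<lambda>k. \<not> 2 ^ k dvd s - 1"] that by (simp add: k_def)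
  have "odd s"
  proof -
    have "2 dvd s\<^sup>2 - 1" using s2 n(2) by (metis dvd_trans even_of_nat)
    then show ?thesis by simp
  qed
  have "k \<noteq> 0" using k by (intro notI) simp
  moreover have "k \<noteq> 1" using k \<open>odd s\<close> by (intro notI) simp
  ultimately have "k = (k - 2) + 2" by simp
  then obtain j where j: "k = j + 2" by blast
  have "2 ^ (j + 1) dvd s - 1" using small[of "j + 1"] j by simp
  then obtain v where v: "s - 1 = 2 ^ (j + 1) * v" by (rule dvdE)
  have "odd v"
  proof
    assume "even v"
    then have "2 ^ k dvd s - 1" unfolding v j by (auto elim!: evenE)
    then show False using k by simp
  qed
  then obtain u where "v = 2 * u + 1" by (rule oddE)
  then have "s - (1 + 2 * int (2 ^ j)) = int (4 * 2 ^ j) * u" using v by (simp add: algebra_simps)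
  then have "[s = 1 + 2 * int (2 ^ j)] (mod int (4 * 2 ^ j))"
    by (metis cong_iff_dvd_diff dvd_triv_left)
  moreover have "4 * 2 ^ j dvd n"
  proof -
    have "(2::nat) ^ k dvd 2 ^ a" using ka by (rule le_imp_power_dvd)
    then have "2 ^ k dvd n" unfolding nr by simp
    then show ?thesis by (simp add: j)
  qed
  ultimately show ?thesis using that(2) by blast
qed

lemma odd_of_square_one:
  fixes s :: int
  assumes "even n" "int n dvd s\<^sup>2 - 1" shows "odd s"
proof -
  have "2 dvd s\<^sup>2 - 1" using assms by (metis dvd_trans even_of_nat)
  then show ?thesis by simp
qed

text \<open>Divisibility by 4 makes the offset \<open>n div 2\<close> even, as
  \<open>dihedral_exact\<close> requires.\<close>

lemma exact_zero_sum:
  fixes s :: int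
  assumes n: "n > 0" "4 dvd n" and s2: "int n dvd s\<^sup>2 - 1" and s1: "\<not> int n dvd s - 1"
    and sz: "size C + size A \<ge> 2 * n"
  shows "hits s (int (n div 2)) n n C A"
proof -
  have n2: "even n" using n(2) by (metis dvd_trans even_numeral)
  have e2: "even (int (n div 2))" using n(2) by (auto elim!: dvdE)
  have od: "odd s" by (rule odd_of_square_one[OF n2 s2])
  show ?thesis
  proof (rule square_one_cases[OF n(1) n2 s2 s1])
    fix p assume p: "Factorial_Ring.prime p" "odd p" "p dvd n" "[s = -1] (mod int p)"
    have "coprime 2 p" using p(2) by simp
    then have "2 * p dvd n" using n2 p(3) by (rule divides_mult[rotated 2])
    then obtain q where q: "n = 2 * p * q" by (rule dvdE)
    have "p dvd n div 2" using q by simp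
    then have pe: "int p dvd int (n div 2)" by simp
    have "hits s (int (n div 2)) (2 * p * q) (2 * p * q) C A"
    proof (rule hits_exact_mult)
      show "2 * p > 0" "q > 0" using q n(1) by (auto intro!: Nat.gr0I)
      show "hits s (int (n div 2)) (2 * p) (2 * p) C A" if "size C + size A \<ge> 2 * (2 * p)" for C A
        by (rule dihedral_exact[OF p(1,2,4) pe od e2 that])
      show "size C + size A \<ge> 2 * (2 * p * q)" using sz q by simp
    qed
    then show ?thesis using q by simp
  next
    fix j assume j: "4 * 2 ^ j dvd n" "[s = 1 + 2 * int (2 ^ j)] (mod int (4 * 2 ^ j))"
    obtain q where q: "n = 4 * 2 ^ j * q" using j(1) by (rule dvdE)
    have e: "2 * int (2 ^ j) dvd int (n div 2)" using q by simp
    have "hits s (int (n div 2)) (4 * 2 ^ j * q) (4 * 2 ^ j * q) C A"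
    proof (rule hits_exact_mult)
      show "4 * 2 ^ j > (0::nat)" "q > 0" using q n(1) by (auto intro!: Nat.gr0I)
      show "hits s (int (n div 2)) (4 * 2 ^ j) (4 * 2 ^ j) C A" if "size C + size A \<ge> 2 * (4 * 2 ^ j)" for C A
        by (rule modular_exact[OF refl j(2) e that])
      show "size C + size A \<ge> 2 * (4 * 2 ^ j * q)" using sz q by simp
    qed
    then show ?thesis using q by simp
  qed
qed

lemma short_zero_sum:
  fixes s :: int
  assumes n: "n > 0" "even n" and s2: "int n dvd s\<^sup>2 - 1" and s1: "\<not> int n dvd s - 1"
    and sz: "size C + size A \<ge> n + 1"
  shows "\<exists>L. 0 < L \<and> L \<le> n \<and> hits s (int (n div 2)) L n C A"
proof (rule square_one_cases[OF n s2 s1])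
  fix p assume p: "Factorial_Ring.prime p" "odd p" "p dvd n" "[s = -1] (mod int p)"
  obtain q where q: "n = p * q" using p(3) by (rule dvdE)
  have "p dvd n div 2"
  proof -
    have "even q" using n(2) p(2) q by simp
    then show ?thesis using q by (auto elim!: evenE)
  qed
  then have pe: "int p dvd int (n div 2)" by simp
  have "\<exists>L. 0 < L \<and> L \<le> p * q \<and> hits s (int (n div 2)) L (p * q) C A"
  proof (rule hits_short_mult)
    show "p > 0" "q > 0" using q n(1) by (auto intro!: Nat.gr0I)
    show "\<exists>L. 0 < L \<and> L \<le> p \<and> hits s (int (n div 2)) L p C A" if "size C + size A \<ge> p + 1" for C A
      by (rule dihedral_short[OF p(1,2,4) pe that])
    show "size C + size A \<ge> p * q + 1" using sz q by simp
  qed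
  then show ?thesis using q by simp
next
  fix j assume j: "4 * 2 ^ j dvd n" "[s = 1 + 2 * int (2 ^ j)] (mod int (4 * 2 ^ j))"
  obtain q where q: "n = 4 * 2 ^ j * q" using j(1) by (rule dvdE)
  have e: "2 * int (2 ^ j) dvd int (n div 2)" using q by simp
  have "\<exists>L. 0 < L \<and> L \<le> 4 * 2 ^ j * q \<and> hits s (int (n div 2)) L (4 * 2 ^ j * q) C A"
  proof (rule hits_short_mult)
    show "4 * 2 ^ j > (0::nat)" "q > 0" using q n(1) by (auto intro!: Nat.gr0I)
    show "\<exists>L. 0 < L \<and> L \<le> 4 * 2 ^ j \<and> hits s (int (n div 2)) L (4 * 2 ^ j) C A"
      if "size C + size A \<ge> 4 * 2 ^ j + 1" for C A
      by (rule modular_short[OF refl j(2) e that])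
    show "size C + size A \<ge> 4 * 2 ^ j * q + 1" using sz q by simp
  qed
  then show ?thesis using q by simp
qed

lemma hits_double:
  assumes n: "n > 0" and base: "\<And>C A. size C + size A \<ge> 2 * n \<Longrightarrow> hits s e n n C A"
    and sz: "size C + size A \<ge> 3 * n"
  shows "hits s e (2 * n) n C A"
proof -
  have step: "\<exists>L. 0 < L \<and> L \<le> n \<and> L = n \<and> hits s e L n C A" if "size C + size A \<ge> 2 * n" for C A
    using base[OF that] n by blast
  have szb: "size C + size A + n \<ge> 2 * n + 2 * n" using sz by simp
  obtain B where B: "size B = 2"
    "\<And>x. x \<in># B \<Longrightarrow> is_block s e n x \<and> 0 < block_size x \<and> block_size x \<le> n \<and> block_size x = n"
    "evens_of B \<subseteq># C" "odds_of B \<subseteq># A"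
    using extract_blocks[where I = "\<lambda>L. L = n", OF step szb] by blast
  have bl: "is_block s e n b" if "b \<in># B" for b using B(2)[OF that] by blast
  have "int n dvd vals_of B"
    using bl by (intro dvd_sum_mset) (auto simp: is_block_def)
  moreover have "total_size B = n * size B"
    by (rule sum_block_size_const) (use B(2) in blast)
  then have "size (evens_of B) + size (odds_of B) = 2 * n"
    unfolding size_blocks B(1) by simp
  ultimately show ?thesis using hitsI[OF B(3,4) reach_blocks[OF bl]] by blast
qed

text \<open>Pairs of terms of the same type that agree modulo \<open>f\<close> have, with one of two even terms
  multiplied by \<open>s\<close>, a value divisible by \<open>f\<close>; this leaves a problem modulo \<open>d\<close>. Too many odd
  terms force an odd pair into the solution, which makes the multiplication by \<open>s\<close> possible.\<close>

lemma many_odd_terms: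
  assumes df: "n = d * f" "d > 0" "f > 0" "2 * d + 2 * f \<le> n + 2" and n0: "n > 0"
    and f: "int f dvd s + 1" "int f dvd e"
    and C: "size C < 2 * n" and sz: "size C + size A = 3 * n"
  shows "hits s e (2 * n) n C A"
proof -
  let ?m = "\<lambda>a. a mod int f"
  have card_m: "card (?m ` Rs) \<le> f" if "finite Rs" for Rs
  proof -
    have "?m ` Rs \<subseteq> {0..<int f}" using df(3) by auto
    from card_mono[OF _ this] show ?thesis by simp
  qed
  obtain Pe Le where Pe: "C = pair_mset Pe + Le" "\<And>p. p \<in># Pe \<Longrightarrow> ?m (fst p) = ?m (snd p)"
    "size Le \<le> card (?m ` set_mset Le)" using pairing[of C ?m] by metis
  obtain Po Lo where Po: "A = pair_mset Po + Lo" "\<And>p. p \<in># Po \<Longrightarrow> ?m (fst p) = ?m (snd p)"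
    "size Lo \<le> card (?m ` set_mset Lo)" using pairing[of A ?m] by metis
  have "size Le \<le> f" "size Lo \<le> f" using Pe(3) Po(3) card_m[of "set_mset Le"] card_m[of "set_mset Lo"] by auto
  moreover have "3 * n = 2 * size Pe + size Le + (2 * size Po + size Lo)" using sz Pe(1) Po(1) by simp
  \<comment> \<open>At most \<open>2 * f\<close> terms are unpaired, so the hypothesis on
    \<open>d\<close> and \<open>f\<close> is what leaves \<open>n + d - 1\<close> pairs, the
    Erdos-Ginzburg-Ziv number for length \<open>n\<close> modulo \<open>d\<close>.\<close>
  ultimately have szP: "size Pe + size Po + 1 \<ge> n + d" using df(4) by linarith
  define ge where "ge = (\<lambda>p. (fst p + s * snd p) div int f)"
  define go where "go = (\<lambda>p. pair_val s e p div int f)"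
  have c1: "int f dvd fst p + s * snd p" if "p \<in># Pe" for p
  proof -
    have "int f dvd fst p - snd p" using Pe(2)[OF that] by (simp add: mod_eq_dvd_iff)
    moreover have "int f dvd (s + 1) * snd p" using f(1) by simp
    ultimately have "int f dvd (fst p - snd p) + (s + 1) * snd p" by (rule dvd_add)
    then show ?thesis by (simp add: algebra_simps)
  qed
  have c2: "int f dvd pair_val s e p" if "p \<in># Po" for p
  proof -
    have "int f dvd snd p - fst p" using Po(2)[OF that] by (simp add: mod_eq_dvd_iff dvd_diff_commute)
    moreover have "int f dvd (s + 1) * fst p + e" using f by simp
    ultimately have "int f dvd (snd p - fst p) + ((s + 1) * fst p + e)" by (rule dvd_add)
    then show ?thesis by (simp add: pair_val_def algebra_simps)
  qed
  have "size (image_mset ge Pe + image_mset go Po) + 1 \<ge> n + d" using szP by simp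
  then obtain T where T: "T \<subseteq># image_mset ge Pe + image_mset go Po" "size T = n" "int d dvd sum_mset T"
    using erdos_ginzburg_ziv[of d n "image_mset ge Pe + image_mset go Po"] df n0 by auto
  obtain T1 T2 where T12: "T = T1 + T2" "T1 \<subseteq># image_mset ge Pe" "T2 \<subseteq># image_mset go Po"
    using T(1) by (rule subset_plus_msetE)
  obtain Qe where Qe: "Qe \<subseteq># Pe" "T1 = image_mset ge Qe" using T12(2) by (rule subset_image_msetE)
  obtain Qo where Qo: "Qo \<subseteq># Po" "T2 = image_mset go Qo" using T12(3) by (rule subset_image_msetE)
  have szQ: "size Qe + size Qo = n" using T(2) T12(1) Qe(2) Qo(2) by simp
  have "2 * size Pe \<le> size C" by (simp add: Pe(1))
  then have "size Qe < n" using C size_mset_mono[OF Qe(1)] by linarith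
  then have ne: "Qo \<noteq> {#}" using szQ by auto
  define E where "E = image_mset (\<lambda>c. (s - 1) * c) (image_mset snd Qe)"
  have "image_mset snd Qe \<subseteq># pair_mset Qe" by (simp add: pair_mset_def)
  then have "E \<subseteq># image_mset (\<lambda>c. (s - 1) * c) (pair_mset Qe)"
    unfolding E_def by (rule image_mset_subseteq_mono)
  then have "E \<subseteq># flips s (pair_mset Qe) Qo"
    unfolding flips_def by (rule subset_mset.order_trans) simp
  from reach_flips[OF ne this, of e]
  have r: "reach s e (pair_mset Qe) (pair_mset Qo)
    (pair_sum s e Qo + sum_mset (pair_mset Qe) + sum_mset E)" .
  have i1: "sum_mset (pair_mset Qe) + sum_mset E = int f * sum_mset T1"
  proof -
    have "\<forall>p\<in>#Qe. int f dvd fst p + s * snd p" using c1 mset_subset_eqD[OF Qe(1)] by blast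
    then show ?thesis unfolding Qe(2) E_def
      by (induction Qe) (auto simp: ge_def algebra_simps)
  qed
  have i2: "pair_sum s e Qo = int f * sum_mset T2"
  proof -
    have "\<forall>p\<in>#Qo. int f dvd pair_val s e p" using c2 mset_subset_eqD[OF Qo(1)] by blast
    then show ?thesis unfolding Qo(2) by (induction Qo) (auto simp: go_def algebra_simps)
  qed
  have "pair_sum s e Qo + sum_mset (pair_mset Qe) + sum_mset E = int f * sum_mset T"
    using i1 i2 T12(1) by (simp add: algebra_simps)
  then have dv: "int n dvd pair_sum s e Qo + sum_mset (pair_mset Qe) + sum_mset E"
    using T(3) df(1) by (simp add: mult_dvd_mono mult.commute)
  show ?thesis
  proof (rule hitsI[OF _ _ r dv])
    show "pair_mset Qe \<subseteq># C" unfolding Pe(1) by (rule pair_mset_le[OF Qe(1)])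
    show "pair_mset Qo \<subseteq># A" unfolding Po(1) by (rule pair_mset_le[OF Qo(1)])
    show "size (pair_mset Qe) + size (pair_mset Qo) = 2 * n" using szQ by simp
  qed
qed

subsection \<open>Zero sums of length \<open>2 n\<close> for \<open>n\<close> congruent to 2 modulo 4\<close>

text \<open>The odd terms are paired arbitrarily, and all but at most \<open>k - 1\<close> pairs are
  kept. Subtracting \<open>2 * c\<close> arranges that the kept pairs together count, modulo
  \<open>k\<close>, like as many pairs of even terms from the class of \<open>c\<close>.\<close>

lemma pairs_of_odd_terms:
  fixes A :: "int multiset"
  assumes k: "k > 0"
  obtains Q where "pair_mset Q \<subseteq># A" "int k dvd sum_mset (image_mset (\<lambda>p. pair_val s e p - 2 * c) Q)"
    "size Q + k \<ge> size A div 2 + 1"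
proof -
  obtain Q0 L where Q0: "A = pair_mset Q0 + L" "size L \<le> card ((\<lambda>a. ()) ` set_mset L)"
    using pairing[of A "\<lambda>_. ()"] by metis
  have "card ((\<lambda>a. ()) ` set_mset L) \<le> card {()}" by (rule card_mono) auto
  then have "size L \<le> 1" using Q0(2) by simp
  moreover have "size A = 2 * size Q0 + size L" by (simp add: Q0(1))
  ultimately have szQ0: "size Q0 = size A div 2" by presburger
  let ?w = "\<lambda>p. pair_val s e p - 2 * c"
  obtain T where T: "T \<subseteq># image_mset ?w Q0" "int k dvd sum_mset T" "size T + k \<ge> size (image_mset ?w Q0) + 1"
    using large_zero_sum[OF k, of "image_mset ?w Q0"] by metis
  obtain Q where Q: "Q \<subseteq># Q0" "T = image_mset ?w Q" using T(1) by (rule subset_image_msetE)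
  have "pair_mset Q \<subseteq># A" unfolding Q0(1) by (rule pair_mset_le[OF Q(1)])
  moreover have "int k dvd sum_mset (image_mset ?w Q)" using T(2) Q(2) by (simp only:)
  moreover have "size Q + k \<ge> size A div 2 + 1" using T(3) szQ0 Q(2) by simp
  ultimately show ?thesis by (rule that)
qed

lemma mult_bound: "0 < k \<Longrightarrow> 3 \<le> j \<Longrightarrow> j + 3 * k \<le> k * j + (3::nat)"
proof -
  assume "0 < k" "3 \<le> j"
  then obtain k' j' where "k = k' + 1" "j = j' + 3"
    by (metis Suc_eq_plus1 add.commute gr0_implies_Suc le_Suc_ex)
  then show ?thesis by (simp add: algebra_simps)
qed

text \<open>The chosen \<open>2 * n\<close> terms have modulo \<open>k\<close> the same value as
  \<open>2 * n\<close> copies of \<open>c\<close>, which is 0 because \<open>k\<close> divides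
  \<open>n\<close>; the flexible pairs then settle the modulus \<open>q\<close>. Through
  \<open>F\<close> a caller can reserve even terms.\<close>

lemma few_odd_terms_main:
  fixes C A :: "int multiset"
  assumes n: "n > 0" and q: "q dvd n" "q > 0" and k: "k dvd q" "3 * k \<le> n"
    and A: "size A \<le> n" and sz: "size C + size A = 3 * n"
    and out: "size (residue_class k c C) + k \<ge> size C + 1"
    and sub: "F + pair_mset P \<subseteq># residue_class k c C"
    and P: "size P < q div k" "size F + size P \<le> n"
    and flex: "\<And>t. int k dvd t \<Longrightarrow> \<exists>E. E \<subseteq># pair_diffs P \<and> [sum_mset E = t] (mod int q)"
  obtains Q T where "pair_mset Q \<subseteq># A" "T \<subseteq># C" "F \<subseteq># T" "size T + 2 * size Q = 2 * n"
    "int q dvd pair_sum s e Q + sum_mset T" "size Q + k \<ge> size A div 2 + 1"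
proof -
  let ?R = "residue_class k c C"
  have k0: "k > 0" using k(1) q(2) by (auto intro!: Nat.gr0I)
  obtain Q where Q: "pair_mset Q \<subseteq># A" "int k dvd sum_mset (image_mset (\<lambda>p. pair_val s e p - 2 * c) Q)"
    "size Q + k \<ge> size A div 2 + 1" using k0 by (rule pairs_of_odd_terms)
  have szQ: "2 * size Q \<le> size A" using size_mset_mono[OF Q(1)] by simp
  define m where "m = 2 * n - 2 * size Q"
  have m: "m + 2 * size Q = 2 * n" using szQ A by (simp add: m_def)
  have "k dvd n" using k(1) q(1) by (rule dvd_trans)
  then obtain j where j: "n = k * j" by (rule dvdE)
  have "3 \<le> j" using k(2) j k0 by simp
  have "q div k \<le> j" using q(1) n j k0 by (metis div_le_mono dvd_imp_le nonzero_mult_div_cancel_left not_gr_zero)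
  then have Pj: "size P + 1 \<le> j" using P(1) by linarith
  have "j + 3 * k \<le> n + 3" using mult_bound[OF k0 \<open>3 \<le> j\<close>] j by simp
  then have m1: "m + size P \<le> size ?R" using m out sz Q(3) Pj by linarith
  have m2: "size F + size P \<le> m" using P(2) m szQ A by linarith
  have sumw: "sum_mset (image_mset (\<lambda>p. pair_val s e p - 2 * c) Q) =
      pair_sum s e Q - 2 * int (size Q) * c"
    by (induction Q) (auto simp: algebra_simps)
  define t where "t = - pair_sum s e Q"
  have "int k dvd t - int m * c"
  proof -
    have "int k dvd int n" using \<open>k dvd n\<close> by simp
    then have "int k dvd - (pair_sum s e Q - 2 * int (size Q) * c) - int n * (2 * c)"
      using Q(2) unfolding sumw by (intro dvd_diff dvd_mult2) (simp_all only: dvd_minus_iff)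
    also have "- (pair_sum s e Q - 2 * int (size Q) * c) - int n * (2 * c) =
        t - (2 * int n - 2 * int (size Q)) * c" by (simp add: t_def algebra_simps)
    also have "2 * int n - 2 * int (size Q) = int m" using arg_cong[OF m, of int] by simp
    finally show ?thesis .
  qed
  then have t: "[t = int m * c] (mod int k)" by (simp only: cong_iff_dvd_diff)
  obtain T where T: "T \<subseteq># ?R" "F \<subseteq># T" "size T = m" "[sum_mset T = t] (mod int q)"
    by (rule flexible_choose[OF _ sub flex m2 m1 t]) auto
  have "int q dvd sum_mset T - t" using T(4) by (simp only: cong_iff_dvd_diff)
  then have "int q dvd pair_sum s e Q + sum_mset T" by (simp add: t_def algebra_simps)
  moreover have "T \<subseteq># C" using T(1) multiset_filter_subset by (rule subset_mset.order_trans)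
  ultimately show ?thesis using that Q(1,3) T(2,3) m by simp
qed

section \<open>Central majority: short blocks and a filling of any length\<close>

lemma gather_blocks:
  assumes short: "\<And>C A. size C + size A \<ge> n + 1 \<Longrightarrow> \<exists>L. 0 < L \<and> L \<le> n \<and> hits s e L n C A"
    and sz: "l = 0 \<or> l + n \<le> size C + size A"
  shows "\<exists>L. l \<le> L \<and> L \<le> l + n \<and> hits s e L n C A"
  using sz
proof (induction l)
  case 0
  have "hits s e 0 n C A" by (rule hits_evens[of "{#}"]) auto
  then show ?case by auto
next
  case (Suc l)
  then have sz: "Suc l + n \<le> size C + size A" by simp
  then obtain L where L: "l \<le> L" "L \<le> l + n" "hits s e L n C A" using Suc.IH by auto
  show ?case
  \<comment> \<open>Only a union of length exactly \<open>l\<close> must grow; then at least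
    \<open>n + 1\<close> terms are left, and the new block has length at most
    \<open>n\<close>.\<close>
  proof (cases "L = l")
    case False
    then show ?thesis using L by (intro exI[of _ L]) simp
  next
    case True
    then obtain C1 A1 c where h: "C1 \<subseteq># C" "A1 \<subseteq># A" "size C1 + size A1 = l" "reach s e C1 A1 c" "int n dvd c"
      using L(3) unfolding hits_def by blast
    have "size (C - C1) + size (A - A1) \<ge> n + 1"
      using size_Diff_submset[OF h(1)] size_Diff_submset[OF h(2)] sz h(3)
        size_mset_mono[OF h(1)] size_mset_mono[OF h(2)] by linarith
    from short[OF this] obtain L' where L': "0 < L'" "L' \<le> n" "hits s e L' n (C - C1) (A - A1)" by blast
    then obtain C2 A2 d where g: "C2 \<subseteq># C - C1" "A2 \<subseteq># A - A1" "size C2 + size A2 = L'" "reach s e C2 A2 d" "int n dvd d"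
      unfolding hits_def by blast
    have "C1 + C2 \<subseteq># C1 + (C - C1)" "A1 + A2 \<subseteq># A1 + (A - A1)" using g(1,2) by simp_all
    then have sub: "C1 + C2 \<subseteq># C" "A1 + A2 \<subseteq># A" using h(1,2) by simp_all
    have "hits s e (l + L') n C A"
      by (rule hitsI[OF sub reach_union[OF h(4) g(4)]]) (use h g in auto)
    then show ?thesis using L' by (intro exI[of _ "l + L'"]) simp
  qed
qed

text \<open>Terms of \<open>Z\<close> are used in even number. When the parity is wrong, one term of
  \<open>U\<close> is given up for a further term of \<open>Z\<close>; this is why \<open>U\<close>
  is nonempty and \<open>size Z\<close> even.\<close>

lemma even_fill:
  assumes "U \<noteq> {#}" "even (size Z)" "f \<le> size U + size Z"
    and U: "\<And>u. u \<in># U \<Longrightarrow> int n dvd u" and Z: "\<And>z. z \<in># Z \<Longrightarrow> [z = l] (mod int n)" and l: "int n dvd 2 * l"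
  obtains T where "T \<subseteq># U + Z" "size T = f" "int n dvd sum_mset T"
proof -
  have "\<exists>a b. a \<le> size U \<and> b \<le> size Z \<and> even b \<and> a + b = f"
  proof (cases "f \<le> size U")
    case True
    then show ?thesis by (intro exI[of _ f] exI[of _ 0]) simp
  next
    case False
    show ?thesis
    proof (cases "even (f - size U)")
      case True
      then show ?thesis using False assms(3) by (intro exI[of _ "size U"] exI[of _ "f - size U"]) auto
    next
      case odd: False
      then have "f - size U \<noteq> size Z" using assms(2) by metis
      then have "f - size U + 1 \<le> size Z" using assms(3) False by linarith
      moreover have "size U \<noteq> 0" using assms(1) by simp
      moreover have "even (f - size U + 1)" using odd by simp
      moreover have "size U - 1 + (f - size U + 1) = f" using False \<open>size U \<noteq> 0\<close> by linarith
      ultimately show ?thesis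
        by (meson diff_le_self)
    qed
  qed
  then obtain a b where ab: "a \<le> size U" "b \<le> size Z" "even b" "a + b = f" by blast
  obtain T1 where T1: "T1 \<subseteq># U" "size T1 = a" using ab(1) by (rule subset_mset_sizeE)
  obtain T2 where T2: "T2 \<subseteq># Z" "size T2 = b" using ab(2) by (rule subset_mset_sizeE)
  have "int n dvd sum_mset T1" using U mset_subset_eqD[OF T1(1)] by (intro dvd_sum_mset) auto
  moreover have "int n dvd sum_mset T2"
  proof -
    have "[sum_mset T2 = int b * l] (mod int n)"
      using sum_mset_cong_const[of T2 l "int n"] Z mset_subset_eqD[OF T2(1)] T2(2) by auto
    moreover have "int n dvd int b * l"
    proof -
      obtain b' where "b = 2 * b'" using ab(3) by (rule evenE)
      then have "int b * l = int b' * (2 * l)" by simp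
      then show ?thesis using dvd_mult[OF l, of "int b'"] by (simp only:)
    qed
    ultimately show ?thesis by (simp add: cong_dvd_iff)
  qed
  ultimately have "int n dvd sum_mset (T1 + T2)" by simp
  moreover have "T1 + T2 \<subseteq># U + Z" using T1 T2 by (intro subset_mset.add_mono)
  moreover have "size (T1 + T2) = f" using T1 T2 ab by simp
  ultimately show ?thesis using that by blast
qed

text \<open>Translating by the central \<open>y ^ c\<close> changes a product of \<open>L\<close>
  terms by \<open>y ^ (L * c)\<close>, which is trivial as \<open>n\<close> divides
  \<open>L\<close>.\<close>

lemma hits_shift:
  assumes c: "int n dvd (s - 1) * c" and L: "n dvd L"
    and h: "hits s e L n (image_mset (\<lambda>a. a - c) C) (image_mset (\<lambda>a. a - c) A)"
  shows "hits s e L n C A"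
proof -
  obtain C1 A1 v where v: "C1 \<subseteq># image_mset (\<lambda>a. a - c) C" "A1 \<subseteq># image_mset (\<lambda>a. a - c) A"
    "size C1 + size A1 = L" "reach s e C1 A1 v" "int n dvd v" using h unfolding hits_def by blast
  obtain v' where v': "reach s e (image_mset (\<lambda>a. a + c) C1) (image_mset (\<lambda>a. a + c) A1) v'"
    "[v' = v + int (size C1 + size A1) * c] (mod int n)" using reach_shift[OF c v(4)] by blast
  have "int n dvd v + int (size C1 + size A1) * c" using v(5) L unfolding v(3) by simp
  then have d: "int n dvd v'" using v'(2) by (simp add: cong_dvd_iff)
  have s: "image_mset (\<lambda>a. a + c) C1 \<subseteq># C" "image_mset (\<lambda>a. a + c) A1 \<subseteq># A"
    using image_mset_subseteq_mono[OF v(1), of "\<lambda>a. a + c"] image_mset_subseteq_mono[OF v(2), of "\<lambda>a. a + c"]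
    by (simp_all add: multiset.map_comp comp_def)
  show ?thesis by (rule hitsI[OF s v'(1) d]) (use v(3) in simp)
qed

text \<open>Gao's argument: at least \<open>n\<close> terms are central and equal up to the central involution;
  after a translation they are trivial and fill up any collection of short blocks.\<close>

lemma central_majority:
  fixes C A :: "int multiset"
  assumes n: "n > 0" "n = 2 * l"
    and short: "\<And>C A. size C + size A \<ge> n + 1 \<Longrightarrow> \<exists>L. 0 < L \<and> L \<le> n \<and> hits s e L n C A"
    and c: "int n dvd (s - 1) * c" and s: "odd s"
    and maj: "size (residue_class l c C) \<ge> n + 2"
    and sz: "size C + size A = 3 * n"
  shows "hits s e (2 * n) n C A"
proof -
  let ?M = "residue_class l c C"
  have "size ?M \<noteq> 0" using maj by linarith
  then have "?M \<noteq> {#}" by (simp only: size_eq_0_iff_empty not_False_eq_True)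
  then obtain c1 where "c1 \<in># ?M" by (rule multiset_nonemptyE)
  then have c1: "c1 \<in># C" "[c1 = c] (mod int l)" by simp_all
  \<comment> \<open>Translation by an actual term \<open>c1\<close> instead of \<open>c\<close> puts
    0 into \<open>U\<close>, as \<open>even_fill\<close> needs. It is central as well:
    \<open>c1 - c\<close> is a multiple of \<open>l\<close> and \<open>s - 1\<close> is
    even.\<close>
  have central: "int n dvd (s - 1) * c1"
  proof -
    have "int l dvd c1 - c" using c1(2) by (simp only: cong_iff_dvd_diff)
    moreover have "2 dvd s - 1" using s by simp
    ultimately have "2 * int l dvd (s - 1) * (c1 - c)" by (intro mult_dvd_mono)
    then have "int n dvd (s - 1) * (c1 - c) + (s - 1) * c" using c n(2) by simp
    then show ?thesis by (simp add: algebra_simps)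
  qed
  define C' where "C' = image_mset (\<lambda>a. a - c1) C"
  define A' where "A' = image_mset (\<lambda>a. a - c1) A"
  define U where "U = filter_mset (\<lambda>r. int n dvd r) C'"
  define Z where "Z = filter_mset (\<lambda>r. [r = int l] (mod int n)) (C' - U)"
  have iff: "int n dvd r \<or> [r = int l] (mod int n)" if "int l dvd r" for r
  proof -
    obtain v where v: "r = int l * v" using \<open>int l dvd r\<close> by (rule dvdE)
    show ?thesis
    proof (cases "even v")
      case True
      then show ?thesis using v n(2) by (auto elim!: evenE)
    next
      case False
      then obtain w where "v = 2 * w + 1" by (rule oddE)
      then have "r - int l = int n * w" using v n(2) by (simp add: algebra_simps)
      then have "int n dvd r - int l" by simp
      then show ?thesis by (simp add: cong_iff_dvd_diff)
    qed
  qed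
  have UC: "U \<subseteq># C'" by (simp add: U_def)
  have UZ: "U + Z \<subseteq># C'"
  proof -
    have "Z \<subseteq># C' - U" unfolding Z_def by (rule multiset_filter_subset)
    then have "U + Z \<subseteq># U + (C' - U)" by simp
    then show ?thesis using UC by simp
  qed
  have szUZ: "size (U + Z) \<ge> n + 2"
  proof -
    have "size ?M = size (filter_mset (\<lambda>r. int l dvd r) C')"
    proof -
      have "[r = c] (mod int l) \<longleftrightarrow> int l dvd r - c1" for r
        using c1(2) unfolding cong_iff_dvd_diff[symmetric] by (metis cong_trans cong_sym)
      then show ?thesis by (simp add: C'_def filter_mset_image_mset)
    qed
    moreover have "filter_mset (\<lambda>r. int l dvd r) C' \<subseteq># U + Z"
    proof -
      have C'U: "C' - U = filter_mset (\<lambda>r. \<not> int n dvd r) C'"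
        unfolding U_def by (metis add_diff_cancel_left' multiset_partition)
      have "count (filter_mset (\<lambda>r. int l dvd r) C') r \<le> count (U + Z) r" for r
        using iff[of r] by (auto simp: U_def Z_def C'U)
      then show ?thesis by (simp add: subseteq_mset_def)
    qed
    ultimately show ?thesis using maj size_mset_mono by fastforce
  qed
  have U0: "U \<noteq> {#}"
  proof -
    have "c1 - c1 \<in># C'" unfolding C'_def set_image_mset using c1(1) by (rule imageI)
    then have "0 \<in># U" by (simp add: U_def)
    then show ?thesis by auto
  qed
  \<comment> \<open>At most one term is lost to make the size even, so the majority of
    \<open>n + 2\<close> still leaves \<open>n + 1\<close> terms in \<open>F\<close>.\<close>
  have "\<exists>Z'. Z' \<subseteq># Z \<and> even (size Z') \<and> size Z \<le> size Z' + 1"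
  proof (cases "even (size Z)")
    case False
    then obtain z Z1 where "Z = add_mset z Z1" by (metis multiset_cases size_empty even_zero)
    then show ?thesis using False by (intro exI[of _ Z1]) auto
  qed auto
  then obtain Z' where Z': "Z' \<subseteq># Z" "even (size Z')" "size Z \<le> size Z' + 1" by blast
  define F where "F = U + Z'"
  have "U + Z' \<subseteq># U + Z" using Z'(1) by simp
  then have FC: "F \<subseteq># C'" unfolding F_def using UZ by (rule subset_mset.order_trans)
  have szF: "size F \<ge> n + 1" using szUZ Z'(3) by (simp add: F_def)
  have szC: "size C' + size A' = 3 * n" using sz by (simp add: C'_def A'_def)
  have "size (C' - F) + size F = size C'" using size_Diff_submset[OF FC] size_mset_mono[OF FC] by linarith
  \<comment> \<open>Blocks found outside \<open>F\<close> get a total length of at least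
    \<open>2 * n - size F\<close> and, since \<open>size F > n\<close>, at most
    \<open>2 * n\<close>; terms of \<open>F\<close> supply the difference.\<close>
  then have "2 * n - size F = 0 \<or> 2 * n - size F + n \<le> size (C' - F) + size A'" using szC by linarith
  from gather_blocks[of n s e "2 * n - size F" "C' - F" A', OF short this]
  obtain L where L: "2 * n - size F \<le> L" "L \<le> 2 * n - size F + n" "hits s e L n (C' - F) A'" by blast
  then obtain C1 A1 v where v: "C1 \<subseteq># C' - F" "A1 \<subseteq># A'" "size C1 + size A1 = L" "reach s e C1 A1 v" "int n dvd v"
    unfolding hits_def by blast
  have L2: "L \<le> 2 * n"
    using L(2) szF by linarith
  have fF: "2 * n - L \<le> size U + size Z'" using L(1) by (simp add: F_def)
  have Zl: "[z = int l] (mod int n)" if "z \<in># Z'" for z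
    using mset_subset_eqD[OF Z'(1) that] unfolding Z_def set_mset_filter by blast
  have Ud: "int n dvd u" if "u \<in># U" for u using that by (simp add: U_def)
  have l2: "int n dvd 2 * int l" using n(2) by simp
  obtain T where T: "T \<subseteq># U + Z'" "size T = 2 * n - L" "int n dvd sum_mset T"
    using even_fill[OF U0 Z'(2) fF Ud Zl l2] by blast
  have "C1 + T \<subseteq># (C' - F) + F" using v(1) T(1) unfolding F_def by (intro subset_mset.add_mono)
  then have s1: "C1 + T \<subseteq># C'" using FC by simp
  have r: "reach s e (C1 + T) (A1 + {#}) (v + sum_mset T)"
    by (intro reach_union v reach_evens)
  have h: "hits s e (2 * n) n C' A'"
    by (rule hitsI[OF s1 _ r]) (use v(2,3,5) T(2,3) L2 in auto)
  show ?thesis by (rule hits_shift[OF central _ h[unfolded C'_def A'_def]]) simp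
qed

lemma few_odd_terms_reach:
  assumes "pair_mset Q \<subseteq># A" "T \<subseteq># C" "size T + 2 * size Q = 2 * n"
    "int n dvd pair_sum s e Q + sum_mset T"
  shows "hits s e (2 * n) n C A"
proof -
  have r: "reach s e ({#} + T) (pair_mset Q + {#}) (pair_sum s e Q + sum_mset T)"
    by (intro reach_union reach_pairs reach_evens)
  show ?thesis by (rule hitsI[OF _ _ r]) (use assms in auto)
qed

section \<open>Non-central majority: reserved terms whose flips generate the missing multiples of
  \<open>q\<close>\<close>

lemma cong_multiple_solution:
  fixes g v :: int
  assumes n: "n > 0" and v: "gcd g (int n) dvd v"
  obtains i where "i < n div nat (gcd g (int n))" "int n dvd v + int i * g"
proof -
  define q where "q = gcd g (int n)"
  have q0: "q > 0" using n by (simp add: q_def)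
  define w where "w = n div nat q"
  have nq: "nat q dvd n" using q0 by (simp add: q_def nat_dvd_iff)
  then have nw: "n = nat q * w" by (simp add: w_def)
  then have iw: "int n = q * int w" using q0 by simp
  have w0: "w > 0" using nw n by (auto intro!: Nat.gr0I)
  obtain g' where g': "g = q * g'" unfolding q_def by (meson dvdE gcd_dvd1)
  obtain v' where v': "v = q * v'" using v unfolding q_def by (rule dvdE)
  have "coprime g' (int w)"
  proof (rule gcd_coprime)
    show "gcd g (int n) \<noteq> 0" using q0 by (simp only: q_def)
    show "g = g' * gcd g (int n)" using g' by (simp only: q_def mult.commute)
    show "int n = int w * gcd g (int n)" using iw by (simp only: q_def mult.commute)
  qed
  then obtain x where x: "[g' * x = 1] (mod int w)" using cong_solve_coprime_int by blast
  define i where "i = nat ((- v' * x) mod int w)"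
  have i: "int i = (- v' * x) mod int w" "i < w" using w0 by (auto simp: i_def nat_less_iff)
  have "[v' + int i * g' = v' + (- v' * x) * g'] (mod int w)"
    unfolding i(1) by (intro cong_add cong_mult cong_refl) (simp add: cong_def)
  also have "v' + (- v' * x) * g' = v' - v' * (g' * x)" by (simp add: algebra_simps)
  also have "[\<dots> = v' - v' * 1] (mod int w)" by (intro cong_diff cong_mult cong_refl x)
  finally have "int w dvd v' + int i * g'" by (simp add: cong_0_iff)
  then have "q * int w dvd q * (v' + int i * g')" by (intro mult_dvd_mono) auto
  then have "int n dvd v + int i * g" by (simp add: iw v' g' algebra_simps)
  then show ?thesis using that[of i] i(2) unfolding w_def q_def by blast
qed

text \<open>Subtracting \<open>c\<close> and dividing by \<open>k\<close> reduces the modulus to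
  \<open>n div k\<close>, so the surplus needed beyond \<open>L\<close> drops to
  \<open>n div k - 1\<close>.\<close>

lemma egz_residue_class:
  fixes C :: "int multiset"
  assumes n: "n > 0" and k: "k dvd n" and R: "\<And>r. r \<in># R \<Longrightarrow> [r = c] (mod int k)"
    and L: "n dvd L" "L > 0" and sz: "size R + 1 \<ge> L + n div k"
  obtains T where "T \<subseteq># R" "size T = L" "int n dvd sum_mset T"
proof -
  obtain j where j: "n = k * j" using k by (rule dvdE)
  have k0: "k > 0" and j0: "j > 0" using j n by (auto intro!: Nat.gr0I)
  define g where "g = (\<lambda>r. (r - c) div int k)"
  have g: "r = c + int k * g r" if "r \<in># R" for r
  proof -
    have "int k dvd r - c" using R[OF that] by (simp only: cong_iff_dvd_diff)
    then show ?thesis by (simp add: g_def)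
  qed
  have "j dvd L" using L(1) j by (metis dvd_mult_right)
  moreover have "size (image_mset g R) + 1 \<ge> L + j" using sz j k0 by simp
  ultimately obtain T' where T': "T' \<subseteq># image_mset g R" "size T' = L" "int j dvd sum_mset T'"
    using erdos_ginzburg_ziv[OF j0 _ L(2)] by blast
  obtain T where T: "T \<subseteq># R" "T' = image_mset g T" using T'(1) by (rule subset_image_msetE)
  have "\<forall>r\<in>#T. r = c + int k * g r" using g mset_subset_eqD[OF T(1)] by blast
  then have "sum_mset T = int (size T) * c + int k * sum_mset T'"
    unfolding T(2)
  proof (induction T)
    case (add r T)
    have "r = c + int k * g r" using add.prems by simp
    moreover have "sum_mset T = int (size T) * c + int k * sum_mset (image_mset g T)"
      using add.IH add.prems by simp
    ultimately have "r + sum_mset T = c + int k * g r + (int (size T) * c + int k * sum_mset (image_mset g T))"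
      by linarith
    then show ?case by (simp add: algebra_simps)
  qed simp
  moreover have "size T = L" using T'(2) T(2) by simp
  moreover have "int n dvd int L" using L(1) by simp
  moreover have "int n dvd int k * sum_mset T'" using T'(3) j by (simp add: mult_dvd_mono)
  ultimately have "int n dvd sum_mset T" by simp
  then show ?thesis using that T(1) \<open>size T = L\<close> by blast
qed

text \<open>A large class of non-central even terms: modulo \<open>q = gcd ((s - 1) c) n\<close> the sum is
  adjusted by the choice of the terms, and the remaining multiple of \<open>q\<close> is killed by moving
  copies of \<open>c\<close> between two odd terms.\<close>

lemma noncentral_majority:
  fixes C A :: "int multiset" and s :: int
  assumes n: "n > 0" "n = 2 * l" "odd l" and s: "odd s" and c0: "\<not> int n dvd (s - 1) * c0"
    and maj: "size (residue_class l c0 C) \<ge> n + 2"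
    and A: "size A \<le> n" and sz: "size C + size A = 3 * n"
  shows "hits s e (2 * n) n C A"
proof -
  define g where "g = (s - 1) * c0"
  define q where "q = nat (gcd g (int n))"
  have iq: "int q = gcd g (int n)" by (simp add: q_def)
  have q0: "q > 0" using n by (simp add: q_def)
  have qn: "q dvd n"
  proof -
    have "int q dvd int n" unfolding iq by simp
    then show ?thesis by (simp only: int_dvd_int_iff)
  qed
  then obtain w where w: "n = q * w" by (rule dvdE)
  have w0: "w > 0" using w n by (auto intro!: Nat.gr0I)
  \<comment> \<open>Both \<open>s - 1\<close> and \<open>n\<close> are even, hence so is
    \<open>q\<close>, and an even \<open>w\<close> would give 4 as a divisor of \<open>n\<close>.
    Since \<open>w\<close> is not 1 either, it is at least 3, on which the counts below
    rest.\<close>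
  have "odd w"
  proof
    assume "even w"
    moreover have "even (int q)" unfolding iq using s n(2) by (simp add: g_def)
    ultimately have "4 dvd n" unfolding w by (auto elim!: evenE)
    then show False using n(2,3) by presburger
  qed
  moreover have "w \<noteq> 1"
  proof
    assume "w = 1"
    then have "int n = gcd g (int n)" using w iq by simp
    then have "int n dvd g" by (metis gcd_dvd1)
    then show False using c0 by (simp add: g_def)
  qed
  ultimately have w3: "w \<ge> 3" using w0 by (cases w) (auto elim!: oddE)
  have "size C \<ge> 2 * n" using A sz by linarith
  moreover have "q \<le> n" using w w0 by simp
  ultimately have "size C + 1 \<ge> 2 * q" by linarith
  then obtain k c P where k: "k > 0" "k dvd q"
    "k = 1 \<or> size (off_class k c C) + 2 \<le> k"
    "pair_mset P \<subseteq># residue_class k c C" "size P < q div k"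
    "\<And>t. int k dvd t \<Longrightarrow> \<exists>E. E \<subseteq># pair_diffs P \<and> [sum_mset E = t] (mod int q)"
    using flexible_class[OF q0] by metis
  let ?R = "residue_class k c C"
  let ?O = "off_class k c C"
  have CRO: "C = ?R + ?O" by (rule multiset_partition)
  have szCRO: "size C = size ?R + size ?O" by (metis multiset_partition size_union)
  have "size ?O + 1 \<le> k" using k(3) by auto
  then have out: "size ?R + k \<ge> size C + 1" using szCRO by linarith
  obtain j where j: "q = k * j" using k(2) by (rule dvdE)
  have j0: "j > 0" using j q0 by (auto intro!: Nat.gr0I)
  have Pj: "size P + 1 \<le> j" using k(1,5) j by simp
  let ?maj = "\<lambda>r. [r = c0] (mod int l)"
  define R' where "R' = ?R - pair_mset P"
  have RR': "?R = pair_mset P + R'" using k(4) by (simp add: R'_def)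
  have b1: "k + 2 * j \<le> 2 * q + 1"
  proof -
    obtain k' j' where "k = k' + 1" "j = j' + 1" using k(1) j0 by (metis Suc_eq_plus1 gr0_implies_Suc)
    then show ?thesis by (simp add: j algebra_simps)
  qed
  have b2: "2 * q + w \<le> n + 5"
  proof -
    obtain q' w' where "q = q' + 1" "w = w' + 3"
      using q0 w3 by (metis Suc_eq_plus1 add.commute gr0_implies_Suc le_Suc_ex)
    then show ?thesis by (simp add: w algebra_simps)
  qed
  have b3: "q + w \<le> n + 1" using add_le_mult_plus_1[OF q0 w0] w by simp
  \<comment> \<open>Fewer than \<open>w\<close> flips will be needed to remove a multiple of
    \<open>q\<close> modulo \<open>n\<close>, so \<open>w - 1\<close> majority terms outside the
    flexible pairs are reserved as \<open>F\<close>.\<close>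
  have "size (filter_mset ?maj R') \<ge> w - 1"
  proof -
    have "C = pair_mset P + R' + ?O" using CRO RR' by simp
    then have "size (filter_mset ?maj C) = size (filter_mset ?maj (pair_mset P)) +
        size (filter_mset ?maj R') + size (filter_mset ?maj ?O)"
      by (metis filter_union_mset size_union)
    moreover have "size (filter_mset ?maj (pair_mset P)) \<le> 2 * size P"
      by (metis size_filter_mset_lesseq pair_mset_simps(4))
    moreover have "size (filter_mset ?maj ?O) \<le> size ?O" by (rule size_filter_mset_lesseq)
    ultimately show ?thesis using maj \<open>size ?O + 1 \<le> k\<close> Pj b1 b2 by linarith
  qed
  then obtain F where F: "F \<subseteq># filter_mset ?maj R'" "size F = w - 1" by (rule subset_mset_sizeE)
  have "F \<subseteq># R'" using F(1) multiset_filter_subset by (rule subset_mset.order_trans)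
  then have sub: "F + pair_mset P \<subseteq># ?R" unfolding RR' by (simp add: union_commute)
  have k3: "3 * k \<le> n"
  proof -
    have "k \<le> q" using k(2) q0 by (rule dvd_imp_le)
    moreover have "3 * q \<le> n" unfolding w using w3 by (simp add: mult.commute)
    ultimately show ?thesis by linarith
  qed
  have "j \<le> q" using j k(1) by simp
  then have szFP: "size F + size P \<le> n" using F(2) Pj b3 by linarith
  obtain Q T where QT: "pair_mset Q \<subseteq># A" "T \<subseteq># C" "F \<subseteq># T" "size T + 2 * size Q = 2 * n"
    "int q dvd pair_sum s e Q + sum_mset T" "size Q + k \<ge> size A div 2 + 1"
    using few_odd_terms_main[OF n(1) qn q0 k(2) k3 A sz out sub k(5) szFP k(6)] by metis
  show ?thesis
  proof (cases "Q = {#}")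
    case True
    \<comment> \<open>Without an odd pair nothing can be flipped, but then so few terms are odd that
      the class \<open>?R\<close> alone has the \<open>2 * n + n div k - 1\<close> terms for a zero
      sum of even terms.\<close>
    then have "size A + 1 \<le> 2 * k" using QT(6) by simp
    moreover have "n div k + 3 * k \<le> n + 3"
    proof -
      have "n = k * (j * w)" using w j by simp
      moreover have "3 \<le> j * w" using w3 j0 by (metis mult_le_mono less_eq_Suc_le mult_1 One_nat_def)
      ultimately show ?thesis using mult_bound[OF k(1), of "j * w"] k(1) by simp
    qed
    ultimately have "size ?R + 1 \<ge> 2 * n + n div k" using out sz by linarith
    moreover have "k dvd n" using k(2) qn by (rule dvd_trans)
    ultimately obtain T' where T': "T' \<subseteq># ?R" "size T' = 2 * n" "int n dvd sum_mset T'"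
      using egz_residue_class[of n k ?R c "2 * n"] n(1) by auto
    have "T' \<subseteq># C" using T'(1) multiset_filter_subset by (rule subset_mset.order_trans)
    then show ?thesis using T' by (intro hits_evens)
  next
    case False
    let ?V = "pair_sum s e Q + sum_mset T"
    have gV: "gcd g (int n) dvd ?V" using QT(5) by (simp only: iq)
    obtain i where i: "i < n div nat (gcd g (int n))" "int n dvd ?V + int i * g"
      using n(1) gV by (rule cong_multiple_solution)
    have "n div nat (gcd g (int n)) = w" using w q0 unfolding q_def[symmetric] by simp
    then have "i \<le> size F" using i(1) F(2) by simp
    then obtain F' where F': "F' \<subseteq># F" "size F' = i" by (rule subset_mset_sizeE)
    define E where "E = image_mset (\<lambda>c. (s - 1) * c) F'"
    have "F' \<subseteq># T" using F'(1) QT(3) by (rule subset_mset.order_trans)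
    then have "E \<subseteq># image_mset (\<lambda>c. (s - 1) * c) T" unfolding E_def by (rule image_mset_subseteq_mono)
    then have "E \<subseteq># flips s T Q" unfolding flips_def by (rule subset_mset.order_trans) simp
    from reach_flips[OF False this, of e]
    have r: "reach s e T (pair_mset Q) (?V + sum_mset E)" .
    \<comment> \<open>Reserved terms agree with \<open>c0\<close> modulo \<open>l\<close> only, but
      the even factor \<open>s - 1\<close> turns this into agreement of the flips modulo
      \<open>n = 2 * l\<close>.\<close>
    have "[x = g] (mod int n)" if "x \<in># E" for x
    proof -
      obtain r where r: "r \<in># F'" "x = (s - 1) * r" using \<open>x \<in># E\<close> by (auto simp: E_def)
      have "r \<in># filter_mset ?maj R'" using r(1) mset_subset_eqD[OF F'(1)] mset_subset_eqD[OF F(1)] by blast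
      then have "[r = c0] (mod int l)" by simp
      then have "int l dvd r - c0" by (simp only: cong_iff_dvd_diff)
      moreover have "2 dvd s - 1" using s by simp
      ultimately have "2 * int l dvd (s - 1) * (r - c0)" by (intro mult_dvd_mono)
      then have "int n dvd x - g" using n(2) by (simp add: r(2) g_def algebra_simps)
      then show ?thesis by (simp only: cong_iff_dvd_diff)
    qed
    then have "[sum_mset E = int (size E) * g] (mod int n)" by (rule sum_mset_cong_const)
    then have "[?V + sum_mset E = ?V + int i * g] (mod int n)"
      using F'(2) by (intro cong_add cong_refl) (simp add: E_def)
    then have d: "int n dvd ?V + sum_mset E" using i(2) by (simp add: cong_dvd_iff)
    show ?thesis by (rule hitsI[OF QT(2,1) r d]) (use QT(4) in simp)
  qed
qed

text \<open>If \<open>3 * k <= n\<close>, the flexible pairs modulo \<open>n\<close> suffice.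
  Otherwise \<open>k\<close> is \<open>n\<close> or \<open>l\<close>, so of at least
  \<open>2 * n\<close> even terms all but at most \<open>n - 2\<close> agree modulo
  \<open>l\<close>; this is the origin of the majority \<open>n + 2\<close>.\<close>

lemma few_odd_terms:
  fixes C A :: "int multiset" and s :: int
  assumes n: "n \<ge> 4" "n = 2 * l" "odd l" and s: "odd s"
    and short: "\<And>C A. size C + size A \<ge> n + 1 \<Longrightarrow> \<exists>L. 0 < L \<and> L \<le> n \<and> hits s e L n C A"
    and A: "size A \<le> n" and sz: "size C + size A = 3 * n"
  shows "hits s e (2 * n) n C A"
proof -
  have n0: "n > 0" using n(1) by simp
  have "size C + 1 \<ge> 2 * n" using A sz by linarith
  then obtain k c P where k: "k > 0" "k dvd n"
    "k = 1 \<or> size (off_class k c C) + 2 \<le> k"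
    "pair_mset P \<subseteq># residue_class k c C" "size P < n div k"
    "\<And>t. int k dvd t \<Longrightarrow> \<exists>E. E \<subseteq># pair_diffs P \<and> [sum_mset E = t] (mod int n)"
    using flexible_class[OF n0] by metis
  let ?R = "residue_class k c C"
  let ?O = "off_class k c C"
  have szCRO: "size C = size ?R + size ?O" by (metis multiset_partition size_union)
  show ?thesis
  proof (cases "3 * k \<le> n")
    case True
    have "size ?O + 1 \<le> k" using k(3) by auto
    then have out: "size ?R + k \<ge> size C + 1" using szCRO by linarith
    have sub: "{#} + pair_mset P \<subseteq># ?R" using k(4) by simp
    have "n div k \<le> n" by simp
    then have "size P \<le> n" using k(5) by linarith
    then have szFP: "size {#} + size P \<le> n" by simp
    obtain Q T where QT: "pair_mset Q \<subseteq># A" "T \<subseteq># C" "size T + 2 * size Q = 2 * n"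
      "int n dvd pair_sum s e Q + sum_mset T"
      using few_odd_terms_main[OF n0 dvd_refl n0 k(2) True A sz out sub k(5) szFP k(6)] by metis
    then show ?thesis by (rule few_odd_terms_reach)
  next
    case False
    obtain j where j: "n = k * j" using k(2) by (rule dvdE)
    have "j < 3" using False j k(1) by (metis mult.commute mult_le_mono1 not_less)
    moreover have "j \<noteq> 0" using j n0 by auto
    ultimately have "j = 1 \<or> j = 2" by linarith
    then have lk: "l dvd k" using j n(2) by auto
    have "k \<noteq> 1" using False n(1) j \<open>j < 3\<close> by auto
    then have szO: "size ?O + 2 \<le> n" using k(3) k(2) n0 dvd_imp_le[OF k(2) n0] by linarith
    have "?R \<subseteq># residue_class l c C"
    proof -
      have "[r = c] (mod int l)" if "[r = c] (mod int k)" for r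
        using that by (rule cong_dvd_modulus) (use lk in simp)
      then have "?R = residue_class k c (residue_class l c C)"
        unfolding filter_filter_mset by (intro filter_mset_cong) auto
      then show ?thesis by (metis multiset_filter_subset)
    qed
    from size_mset_mono[OF this]
    have maj: "size (residue_class l c C) \<ge> n + 2"
      using szO szCRO A sz by linarith
    show ?thesis
    proof (cases "int n dvd (s - 1) * c")
      case True
      show ?thesis by (rule central_majority[OF n0 n(2) short True s maj sz])
    next
      case False
      show ?thesis by (rule noncentral_majority[OF n0 n(2,3) s False maj A sz])
    qed
  qed
qed

lemma double_zero_sum:
  fixes C A :: "int multiset" and s :: int
  assumes n: "n \<ge> 8" "n mod 4 = 2" and s2: "int n dvd s\<^sup>2 - 1"
    and s1: "\<not> int n dvd s - 1" "\<not> int n dvd s + 1"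
    and sz: "size C + size A \<ge> 3 * n"
  shows "hits s (int (n div 2)) (2 * n) n C A"
proof -
  define l where "l = n div 2"
  have l: "n = 2 * l" "odd l" using n(2) unfolding l_def by presburger+
  have n0: "n > 0" "even n" using n l by auto
  have od: "odd s" by (rule odd_of_square_one[OF n0(2) s2])
  obtain C' A' where CA: "C' \<subseteq># C" "A' \<subseteq># A" "size C' + size A' = 3 * n"
    using sz by (rule restrict_size)
  have "hits s (int l) (2 * n) n C' A'"
  proof (cases "size A' \<le> n")
    case True
    have n4: "n \<ge> 4" using n(1) by simp
    have short: "\<exists>L. 0 < L \<and> L \<le> n \<and> hits s (int l) L n C A" if "size C + size A \<ge> n + 1" for C A
      using short_zero_sum[OF n0 s2 s1(1) that] by (simp only: l_def)
    show ?thesis by (rule few_odd_terms[OF n4 l od short True CA(3)])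
  next
    case False
    define d where "d = nat (gcd (s - 1) (int n))"
    have id: "int d = gcd (s - 1) (int n)" by (simp add: d_def)
    have dn: "d dvd n"
    proof -
      have "int d dvd int n" unfolding id by simp
      then show ?thesis by (simp only: int_dvd_int_iff)
    qed
    then obtain f where f: "n = d * f" by (rule dvdE)
    have d0: "d > 0" and f0: "f > 0" using f n0 by (auto intro!: Nat.gr0I)
    have "even (int d)" unfolding id using od n0(2) by simp
    then have ed: "even d" by simp
    have of: "odd f"
    proof
      assume "even f"
      then have "4 dvd n" using ed f by (auto elim!: evenE)
      then show False using n(2) by presburger
    qed
    obtain t where t: "s - 1 = int d * t" unfolding id by (meson dvdE gcd_dvd1)
    have cop: "coprime t (int f)"
    proof (rule gcd_coprime)
      show "gcd (s - 1) (int n) \<noteq> 0" using d0 unfolding id[symmetric] by simp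
      show "s - 1 = t * gcd (s - 1) (int n)" unfolding id[symmetric] using t by (simp only: mult.commute)
      show "int n = int f * gcd (s - 1) (int n)" unfolding id[symmetric] using f by (simp only: mult.commute of_nat_mult)
    qed
    have fs: "int f dvd s + 1"
    proof -
      have "s\<^sup>2 - 1 = (s - 1) * (s + 1)" by (simp add: power2_eq_square algebra_simps)
      then have "int d * int f dvd int d * (t * (s + 1))" using s2 f t by (simp add: mult.assoc)
      then have "int f dvd t * (s + 1)" using d0 by simp
      then show ?thesis using cop by (simp add: coprime_dvd_mult_right_iff coprime_commute)
    qed
    have fl: "f dvd l"
    proof -
      have "f dvd 2 * l" using f l(1) by simp
      then show ?thesis using of by (simp add: coprime_dvd_mult_right_iff)
    qed
    have "f \<noteq> 1"
    proof
      assume "f = 1"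
      then have "int n dvd s - 1" using f t by simp
      then show False using s1(1) by simp
    qed
    then have f3: "f \<ge> 3" using of f0 by (cases f) (auto elim!: oddE)
    have "d \<noteq> 2"
    proof
      assume "d = 2"
      then have "f = l" using f l(1) by simp
      moreover have "2 dvd s + 1" using od by simp
      moreover have "coprime 2 (int l)" using l(2) by simp
      ultimately have "2 * int l dvd s + 1" using fs by (simp add: divides_mult)
      then show False using s1(2) l(1) by simp
    qed
    moreover have "d \<noteq> 4" using f n(2) by (auto)
    ultimately have "d \<ge> 6" using ed d0 by presburger
    then obtain d' f' where "d = d' + 6" "f = f' + 3" using f3 by (metis add.commute le_Suc_ex)
    \<comment> \<open>This amounts to \<open>(d - 2) * (f - 2) >= 2\<close>, which would fail for
      \<open>d = 2\<close>, the value excluded by \<open>s\<close> not being -1 modulo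
      \<open>n\<close>.\<close>
    then have "2 * d + 2 * f \<le> n + 2" unfolding f by (simp add: algebra_simps)
    moreover have "size C' < 2 * n" using False CA(3) by linarith
    ultimately show ?thesis
      using many_odd_terms[OF f d0 f0 _ n0(1) fs _ _ CA(3), of "int l"] fl by simp
  qed
  then show ?thesis unfolding l_def using hits_mono CA(1,2) by blast
qed

subsection \<open>The group\<close>

context group
begin

lemma list_prod_closed: "set xs \<subseteq> carrier G \<Longrightarrow> list_prod G xs \<in> carrier G"
  by (induction xs) (auto simp: list_prod_def)

lemma list_prod_Nil [simp]: "list_prod G [] = \<one>"
  by (simp add: list_prod_def)

lemma list_prod_Cons [simp]: "list_prod G (a # xs) = a \<otimes> list_prod G xs"
  by (simp add: list_prod_def)

lemma list_prod_append:
  "set xs \<subseteq> carrier G \<Longrightarrow> set ys \<subseteq> carrier G \<Longrightarrow> list_prod G (xs @ ys) = list_prod G xs \<otimes> list_prod G ys"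
  by (induction xs) (auto simp: list_prod_closed m_assoc)

end

locale nonsplit_metacyclic = group G for G (structure) +
  fixes x y :: 'a and n :: nat and s :: int
  assumes n_ge: "n \<ge> 8" and n_even: "even n"
    and s_square: "int n dvd s\<^sup>2 - 1" and s_not_one: "\<not> int n dvd s - 1" and s_not_neg_one: "\<not> int n dvd s + 1"
    and x_carrier [simp]: "x \<in> carrier G" and y_carrier [simp]: "y \<in> carrier G"
    and generated: "generate G {x, y} = carrier G"
    and order_G: "order G = 2 * n"
    and x_square: "x [^] (2::nat) = y [^] (n div 2)"
    and y_pow_n: "y [^] n = \<one>"
    and y_x: "y \<otimes> x = x \<otimes> (y [^] s)"
begin

lemma n_pos: "n > 0" using n_ge by simp

lemma odd_s: "odd s" by (rule odd_of_square_one[OF n_even s_square])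

lemma y_pow_cong:
  assumes "[a = b] (mod int n)" shows "y [^] a = y [^] (b :: int)"
proof -
  have "int n dvd a - b" using assms by (simp only: cong_iff_dvd_diff)
  then obtain q where "a - b = int n * q" by (rule dvdE)
  then have a: "a = b + int n * q" by simp
  have "y [^] (int n * q) = (y [^] int n) [^] q" by (simp add: int_pow_pow)
  also have "\<dots> = \<one>" by (simp add: int_pow_int y_pow_n)
  finally have "y [^] (int n * q) = \<one>" .
  moreover have "y [^] (b + int n * q) = y [^] b \<otimes> y [^] (int n * q)" by (rule int_pow_mult) simp
  ultimately show ?thesis unfolding a by simp
qed

lemma y_pow_x: "y [^] (a :: int) \<otimes> x = x \<otimes> y [^] (s * a)"
proof -
  have nat: "y [^] (int k) \<otimes> x = x \<otimes> y [^] (s * int k)" for k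
  proof (induction k)
    case (Suc k)
    have "y [^] (int k + 1) = y [^] int k \<otimes> y [^] (1::int)" by (rule int_pow_mult) simp
    then have "y [^] int (Suc k) = y [^] int k \<otimes> y" by (simp add: add.commute)
    then have "y [^] int (Suc k) \<otimes> x = y [^] int k \<otimes> (y \<otimes> x)"
      by (simp add: m_assoc)
    also have "\<dots> = (y [^] int k \<otimes> x) \<otimes> y [^] s" by (simp add: y_x m_assoc)
    also have "\<dots> = x \<otimes> (y [^] (s * int k) \<otimes> y [^] s)" by (simp add: Suc.IH m_assoc)
    also have "y [^] (s * int k) \<otimes> y [^] s = y [^] (s * int k + s)"
      by (rule int_pow_mult[symmetric]) simp
    also have "s * int k + s = s * int (Suc k)" by (simp add: algebra_simps)
    finally show ?case .
  qed simp
  have c: "[int (nat (a mod int n)) = a] (mod int n)" using n_pos by (simp add: cong_def)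
  have "y [^] a = y [^] int (nat (a mod int n))" by (rule y_pow_cong[OF cong_sym[OF c]])
  moreover have "y [^] (s * a) = y [^] (s * int (nat (a mod int n)))"
    by (rule y_pow_cong) (intro cong_mult cong_refl cong_sym[OF c])
  ultimately show ?thesis using nat[of "nat (a mod int n)"] by (simp only:)
qed

definition elem :: "bool \<Rightarrow> int \<Rightarrow> 'a" where
  "elem b a = (if b then x \<otimes> y [^] a else y [^] a)"

lemma elem_carrier [simp]: "elem b a \<in> carrier G"
  by (simp add: elem_def)

lemma x_times_x: "x \<otimes> x = y [^] int (n div 2)"
  using x_square by (simp add: numeral_2_eq_2 int_pow_int)

lemma elem_mult:
  "elem False a \<otimes> elem False b = elem False (a + b)"
  "elem True a \<otimes> elem False b = elem True (a + b)"
  "elem False a \<otimes> elem True b = elem True (s * a + b)"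
  "elem True a \<otimes> elem True b = elem False (int (n div 2) + s * a + b)"
proof -
  show "elem False a \<otimes> elem False b = elem False (a + b)" by (simp add: elem_def int_pow_mult)
  show "elem True a \<otimes> elem False b = elem True (a + b)" by (simp add: elem_def int_pow_mult m_assoc)
  have c: "y [^] a \<otimes> (x \<otimes> y [^] b) = x \<otimes> y [^] (s * a + b)" for a b :: int
  proof -
    have "y [^] a \<otimes> (x \<otimes> y [^] b) = (y [^] a \<otimes> x) \<otimes> y [^] b" by (simp add: m_assoc)
    also have "\<dots> = x \<otimes> (y [^] (s * a) \<otimes> y [^] b)" unfolding y_pow_x by (simp add: m_assoc)
    finally show ?thesis by (simp add: int_pow_mult)
  qed
  then show "elem False a \<otimes> elem True b = elem True (s * a + b)" by (simp add: elem_def)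
  have "(x \<otimes> y [^] a) \<otimes> (x \<otimes> y [^] b) = x \<otimes> (y [^] a \<otimes> (x \<otimes> y [^] b))" by (simp add: m_assoc)
  also have "\<dots> = (x \<otimes> x) \<otimes> y [^] (s * a + b)" unfolding c by (simp add: m_assoc)
  also have "\<dots> = y [^] (int (n div 2) + (s * a + b))" unfolding x_times_x by (rule int_pow_mult[symmetric]) simp
  finally show "elem True a \<otimes> elem True b = elem False (int (n div 2) + s * a + b)"
    by (simp add: elem_def add.assoc)
qed

lemma elem_mult_ex: "\<exists>c. elem b a \<otimes> elem b' a' = elem (b \<noteq> b') c"
  by (cases b; cases b') (use elem_mult in auto)

lemma one_elem: "\<one> = elem False 0" and x_elem: "x = elem True 0" and y_elem: "y = elem False 1"
  by (simp_all add: elem_def)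

lemma elem_exists:
  assumes "g \<in> carrier G" obtains b a where "g = elem b a"
proof -
  have "g \<in> generate G {x, y}" using assms generated by simp
  then have "\<exists>b a. g = elem b a"
  proof induction
    case one
    then show ?case using one_elem by blast
  next
    case (incl h)
    then show ?case using x_elem y_elem by blast
  next
    case (inv h)
    then consider "h = x" | "h = y" by blast
    then show ?case
    proof cases
      case 1
      have "x \<otimes> elem True (- int (n div 2)) = \<one>"
        using elem_mult(4)[of 0 "- int (n div 2)"] by (simp add: x_elem[symmetric] one_elem[symmetric])
      then have "inv (elem True (- int (n div 2))) = x" by (intro inv_equality) auto
      then have "inv x = elem True (- int (n div 2))" by (metis elem_carrier inv_inv)
      then show ?thesis using 1 by blast
    next
      case 2
      have "y \<otimes> elem False (-1) = \<one>"
        using elem_mult(1)[of 1 "-1"] by (simp add: y_elem[symmetric] one_elem[symmetric])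
      then have "inv (elem False (-1)) = y" by (intro inv_equality) auto
      then have "inv y = elem False (-1)" by (metis elem_carrier inv_inv)
      then show ?thesis using 2 by blast
    qed
  next
    case (eng h1 h2)
    then show ?case using elem_mult_ex by metis
  qed
  then show ?thesis using that by blast
qed

lemma elem_cong: "[a = a'] (mod int n) \<Longrightarrow> elem b a = elem b a'"
  using y_pow_cong by (simp add: elem_def)

text \<open>Every element has a name \<open>elem b a\<close> with \<open>a\<close> in
  \<open>{0..<n}\<close>. These are \<open>2 * n\<close> names for \<open>2 * n\<close> elements, so
  names are unique: the order of the group makes the normal form faithful.\<close>

lemma elem_eq_one_iff: "elem b a = \<one> \<longleftrightarrow> \<not> b \<and> int n dvd a"
proof
  assume "\<not> b \<and> int n dvd a"
  then show "elem b a = \<one>" unfolding one_elem using elem_cong[of a 0 False] by (simp add: cong_0_iff)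
next
  assume eq: "elem b a = \<one>"
  let ?D = "UNIV \<times> {0..<int n} :: (bool \<times> int) set"
  let ?f = "\<lambda>p. elem (fst p) (snd p)"
  have "?f ` ?D = carrier G"
  proof
    show "carrier G \<subseteq> ?f ` ?D"
    proof
      fix g assume "g \<in> carrier G"
      then obtain b a where g: "g = elem b a" by (rule elem_exists)
      have "g = ?f (b, a mod int n)" unfolding g fst_conv snd_conv
        by (rule elem_cong) (simp add: cong_def)
      moreover have "(b, a mod int n) \<in> ?D" using n_pos by simp
      ultimately show "g \<in> ?f ` ?D" by (rule image_eqI)
    qed
  qed auto
  moreover have "card ?D = 2 * n" by (simp add: card_cartesian_product)
  moreover have "card (carrier G) = 2 * n" using order_G by (simp add: order_def)
  ultimately have "card (?f ` ?D) = card ?D" by simp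
  then have inj: "inj_on ?f ?D" by (intro eq_card_imp_inj_on) auto
  have "?f (b, a mod int n) = ?f (False, 0)"
    using eq elem_cong[of "a mod int n" a b] one_elem by (simp add: cong_def)
  then have "(b, a mod int n) = (False, 0)" by (rule inj_onD[OF inj]) (use n_pos in auto)
  then show "\<not> b \<and> int n dvd a" by (simp add: dvd_eq_mod_eq_0)
qed

text \<open>The rule \<open>odd\<close> describes the product of \<open>x y ^ a\<close>,
  \<open>y ^ c\<close>, \<open>x y ^ b\<close> and \<open>y ^ c'\<close>: moving the second
  \<open>x\<close> to the left multiplies \<open>a + c\<close> by \<open>s\<close>, and
  \<open>x ^ 2\<close> contributes the offset. This soundness carries the upper bounds over to the
  group.\<close>

lemma reach_product:
  assumes "reach s (int (n div 2)) C A c"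
  obtains xs where "mset xs = image_mset (elem False) C + image_mset (elem True) A" "list_prod G xs = elem False c"
proof -
  have "\<exists>xs. mset xs = image_mset (elem False) C + image_mset (elem True) A \<and> list_prod G xs = elem False c"
    using assms
  proof induction
    case empty
    then show ?case by (intro exI[of _ "[]"]) (simp add: one_elem)
  next
    case (even C A c a)
    then obtain xs where "mset xs = image_mset (elem False) C + image_mset (elem True) A"
      "list_prod G xs = elem False c" by blast
    then show ?case by (intro exI[of _ "elem False a # xs"]) (simp add: elem_mult)
  next
    case (odd C A c C' A' c' a b)
    then obtain xs ys where xs: "mset xs = image_mset (elem False) C + image_mset (elem True) A"
      "list_prod G xs = elem False c" and
      ys: "mset ys = image_mset (elem False) C' + image_mset (elem True) A'" "list_prod G ys = elem False c'"
      by blast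
    have "set_mset (mset xs) \<subseteq> carrier G" "set_mset (mset ys) \<subseteq> carrier G"
      unfolding xs ys by auto
    then have car: "set xs \<subseteq> carrier G" "set (elem True b # ys) \<subseteq> carrier G" by simp_all
    let ?zs = "elem True a # xs @ elem True b # ys"
    have "list_prod G ?zs = elem True a \<otimes> (elem False c \<otimes> (elem True b \<otimes> elem False c'))"
      using list_prod_append[OF car] xs(2) ys(2) by simp
    also have "\<dots> = (elem True a \<otimes> elem False c) \<otimes> (elem True b \<otimes> elem False c')" by (simp add: m_assoc)
    also have "\<dots> = elem False (int (n div 2) + s * (a + c) + b + c')"
      by (simp add: elem_mult add.assoc)
    finally have "list_prod G ?zs = elem False (int (n div 2) + s * (a + c) + b + c')" .
    then show ?case using xs(1) ys(1) by (intro exI[of _ ?zs]) (simp add: ac_simps)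
  qed
  then show ?thesis using that by blast
qed

lemma decompose_sequence:
  assumes "seq_over G S"
  obtains C A where "S = image_mset (elem False) C + image_mset (elem True) A" "size C + size A = size S"
proof -
  have "\<exists>C A. S = image_mset (elem False) C + image_mset (elem True) A"
    using assms
  proof (induction S)
    case empty
    then show ?case by (intro exI[of _ "{#}"]) simp
  next
    case (add g S)
    then obtain C A where CA: "S = image_mset (elem False) C + image_mset (elem True) A"
      by (auto simp: seq_over_def)
    have "g \<in> carrier G" using add.prems by (simp add: seq_over_def)
    then obtain b a where g: "g = elem b a" by (rule elem_exists)
    show ?case
    proof (cases b)
      case True
      then show ?thesis using CA g by (intro exI[of _ C] exI[of _ "add_mset a A"]) simp
    next
      case False
      have "add_mset g S = image_mset (elem False) (add_mset a C) + image_mset (elem True) A"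
        using CA g False by simp
      then show ?thesis by blast
    qed
  qed
  then show ?thesis using that by (metis size_image_mset size_union)
qed

lemma product_one_of_hits:
  assumes "S = image_mset (elem False) C + image_mset (elem True) A" "hits s (int (n div 2)) L n C A"
  shows "\<exists>T. T \<subseteq># S \<and> size T = L \<and> product_one G T"
proof -
  obtain C' A' c where h: "C' \<subseteq># C" "A' \<subseteq># A" "size C' + size A' = L"
    "reach s (int (n div 2)) C' A' c" "int n dvd c" using assms(2) unfolding hits_def by blast
  obtain xs where xs: "mset xs = image_mset (elem False) C' + image_mset (elem True) A'"
    "list_prod G xs = elem False c" using h(4) by (rule reach_product)
  have "list_prod G xs = \<one>" using xs(2) h(5) elem_eq_one_iff[of False c] by simp
  then have "\<exists>ys. \<one> = list_prod G ys \<and> mset ys = mset xs" by (intro exI[of _ xs]) simp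
  then have "product_one G (mset xs)" by (simp add: product_one_def prods_def)
  moreover have "mset xs \<subseteq># S" unfolding xs(1) assms(1)
    by (intro subset_mset.add_mono image_mset_subseteq_mono h)
  moreover have "size (mset xs) = L" unfolding xs(1) using h(3) by simp
  ultimately show ?thesis by blast
qed

lemma short_product_one:
  assumes "seq_over G S" "size S \<ge> n + 1"
  obtains T where "T \<subseteq># S" "1 \<le> size T" "size T \<le> n" "product_one G T"
proof -
  obtain C A where CA: "S = image_mset (elem False) C + image_mset (elem True) A" "size C + size A = size S"
    using assms(1) by (rule decompose_sequence)
  have sz: "size C + size A \<ge> n + 1" using CA(2) assms(2) by simp
  obtain L where L: "0 < L" "L \<le> n" "hits s (int (n div 2)) L n C A"
    using short_zero_sum[OF n_pos n_even s_square s_not_one sz] by blast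
  from product_one_of_hits[OF CA(1) L(3)] show ?thesis using that L by auto
qed

lemma exact_product_one:
  assumes "n mod 4 = 0" "seq_over G S" "size S \<ge> 2 * n"
  shows "\<exists>T. T \<subseteq># S \<and> size T = n \<and> product_one G T"
proof -
  obtain C A where CA: "S = image_mset (elem False) C + image_mset (elem True) A" "size C + size A = size S"
    using assms(2) by (rule decompose_sequence)
  have sz: "size C + size A \<ge> 2 * n" using CA(2) assms(3) by simp
  have "4 dvd n" using assms(1) by presburger
  from exact_zero_sum[OF n_pos this s_square s_not_one sz] show ?thesis
    by (rule product_one_of_hits[OF CA(1)])
qed

lemma double_product_one:
  assumes "seq_over G S" "size S \<ge> 3 * n"
  shows "\<exists>T. T \<subseteq># S \<and> size T = 2 * n \<and> product_one G T"
proof -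
  obtain C A where CA: "S = image_mset (elem False) C + image_mset (elem True) A" "size C + size A = size S"
    using assms(1) by (rule decompose_sequence)
  have sz: "size C + size A \<ge> 3 * n" using CA(2) assms(2) by simp
  have "n mod 4 = 0 \<or> n mod 4 = 2" using n_even by presburger
  then have "hits s (int (n div 2)) (2 * n) n C A"
  proof
    assume "n mod 4 = 0"
    then have "4 dvd n" by presburger
    then show ?thesis
      by (intro hits_double[OF n_pos _ sz] exact_zero_sum[OF n_pos _ s_square s_not_one])
  next
    assume "n mod 4 = 2"
    then show ?thesis by (rule double_zero_sum[OF n_ge _ s_square s_not_one s_not_neg_one sz])
  qed
  then show ?thesis by (rule product_one_of_hits[OF CA(1)])
qed

section \<open>Lower bounds, the exponent of the group, and the four invariants\<close>

definition extremal :: "nat \<Rightarrow> 'a multiset" where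
  "extremal i = replicate_mset i \<one> + replicate_mset (n - 1) y + {#x#}"

lemma extremal_seq_over: "seq_over G (extremal i)"
  by (auto simp: seq_over_def extremal_def)

lemma size_extremal: "size (extremal i) = i + n"
  using n_pos by (simp add: extremal_def)

lemma list_prod_y:
  assumes "set xs \<subseteq> {\<one>, y}" shows "list_prod G xs = elem False (int (length (filter (\<lambda>g. g \<noteq> \<one>) xs)))"
  using assms
proof (induction xs)
  case Nil
  then show ?case by (simp add: one_elem)
next
  case (Cons g xs)
  then have IH: "list_prod G xs = elem False (int (length (filter (\<lambda>g. g \<noteq> \<one>) xs)))" by simp
  show ?case
  proof (cases "g = \<one>")
    case True
    then show ?thesis using IH by simp
  next
    case False
    then have "g = y" using Cons.prems by simp
    then show ?thesis using IH False elem_mult(1)[of 1] by (simp add: y_elem[symmetric])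
  qed
qed

lemma list_prod_elem_ex:
  "set xs \<subseteq> {\<one>, y} \<Longrightarrow> \<exists>a. list_prod G xs = elem False a"
  using list_prod_y by blast

text \<open>A product containing the single \<open>x\<close> has the form \<open>elem True c\<close>
  and is not 1. Without \<open>x\<close>, the number of factors \<open>y\<close> is a multiple of
  \<open>n\<close> below \<open>n\<close>, hence 0, and only the \<open>i\<close> copies of 1
  remain.\<close>

lemma extremal_product_one:
  assumes T: "T \<subseteq># extremal i" and p: "product_one G T"
  shows "size T \<le> i"
proof -
  obtain xs where xs: "mset xs = T" "list_prod G xs = \<one>"
    using p by (auto simp: product_one_def prods_def)
  have ny: "y \<noteq> \<one>"
  proof
    assume "y = \<one>"
    then have "int n dvd 1" using elem_eq_one_iff[of False 1] y_elem by simp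
    then show False using n_ge by simp
  qed
  have xy: "x \<noteq> y" "x \<noteq> \<one>"
  proof -
    show "x \<noteq> \<one>" using elem_eq_one_iff[of True 0] x_elem by simp
    show "x \<noteq> y"
    proof
      assume "x = y"
      then have "elem True 0 = elem False 1" unfolding x_elem[symmetric] y_elem[symmetric] .
      then have "elem True 0 \<otimes> elem False (-1) = elem False 1 \<otimes> elem False (-1)" by (simp only:)
      then have "elem True (0 + -1) = elem False (1 + -1)" by (simp only: elem_mult)
      then show False using elem_eq_one_iff[of True "-1"] one_elem by simp
    qed
  qed
  have cx: "count (extremal i) x = 1" using xy by (simp add: extremal_def)
  have sub: "set_mset T \<subseteq> {\<one>, y, x}"
    using set_mset_mono[OF T] by (auto simp: extremal_def split: if_splits)
  have "x \<notin># T"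
  proof
    assume "x \<in># T"
    then have "x \<in> set xs" using xs(1) by auto
    then obtain us vs where uv: "xs = us @ x # vs" by (meson split_list)
    have "count T x \<le> 1" using T cx by (metis subseteq_mset_def)
    then have "count (mset us) x = 0" "count (mset vs) x = 0" using xs(1) uv by auto
    then have "x \<notin> set us" "x \<notin> set vs" by (simp_all add: count_eq_zero_iff)
    moreover have "set us \<subseteq> {\<one>, y, x}" "set vs \<subseteq> {\<one>, y, x}" using sub xs(1) uv by auto
    ultimately have us: "set us \<subseteq> {\<one>, y}" and vs: "set vs \<subseteq> {\<one>, y}" by auto
    obtain a where a: "list_prod G us = elem False a" using list_prod_elem_ex[OF us] by blast
    obtain b where b: "list_prod G vs = elem False b" using list_prod_elem_ex[OF vs] by blast
    have "set us \<subseteq> carrier G" "set (x # vs) \<subseteq> carrier G" using us vs by auto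
    then have "list_prod G xs = elem False a \<otimes> (elem True 0 \<otimes> elem False b)"
      unfolding uv using list_prod_append a b by (simp add: x_elem[symmetric])
    then have "list_prod G xs = elem True (s * a + b)" by (simp add: elem_mult)
    then show False using xs(2) elem_eq_one_iff[of True "s * a + b"] by simp
  qed
  then have set: "set xs \<subseteq> {\<one>, y}" using sub xs(1) by auto
  define k where "k = length (filter (\<lambda>g. g \<noteq> \<one>) xs)"
  have "int n dvd int k"
    using list_prod_y[OF set] xs(2) elem_eq_one_iff[of False "int k"] by (simp add: k_def)
  then have nk: "n dvd k" by (simp only: int_dvd_int_iff)
  have ksz: "k = size (filter_mset (\<lambda>g. g \<noteq> \<one>) T)"
    unfolding k_def xs(1)[symmetric] by (metis mset_filter size_mset)
  have "count (filter_mset (\<lambda>g. g \<noteq> \<one>) T) g \<le> count (replicate_mset (n - 1) y) g" for g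
  proof -
    have "count T g \<le> count (extremal i) g" using T by (simp add: subseteq_mset_def)
    then show ?thesis using \<open>x \<notin># T\<close> ny by (auto simp: extremal_def not_in_iff split: if_splits)
  qed
  then have "filter_mset (\<lambda>g. g \<noteq> \<one>) T \<subseteq># replicate_mset (n - 1) y"
    by (simp add: subseteq_mset_def)
  from size_mset_mono[OF this] have "k < n" using ksz n_pos by simp
  then have "k = 0" using nk by (auto dest: dvd_imp_le)
  then have "filter_mset (\<lambda>g. g \<noteq> \<one>) T = {#}" using ksz by (simp only: size_eq_0_iff_empty)
  then have "set_mset (filter_mset (\<lambda>g. g \<noteq> \<one>) T) = {}" by (simp only: set_mset_empty)
  then have "set_mset T \<subseteq> {\<one>}" by auto
  then have "T = replicate_mset (size T) \<one>" by (metis set_mset_subset_singletonD)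
  then have "size T = count T \<one>" by (metis count_replicate_mset)
  also have "\<dots> \<le> count (extremal i) \<one>" using T by (simp add: subseteq_mset_def)
  also have "\<dots> = i" using ny xy by (simp add: extremal_def)
  finally show ?thesis .
qed

text \<open>The square of \<open>x y ^ a\<close> is \<open>y ^ (n div 2 + (s + 1) * a)\<close> with
  \<open>s + 1\<close> even. If \<open>n div 2\<close> is even, its power \<open>n div 2\<close> is
  trivial; if \<open>n div 2\<close> is odd, \<open>x ^ n\<close> is not 1.\<close>

lemma group_exp_eq: "group_exp G = (if n mod 4 = 0 then n else 2 * n)"
proof -
  have y_exp: "n dvd k" if "\<forall>g\<in>carrier G. g [^] k = \<one>" for k :: nat
  proof -
    have "y [^] k = \<one>" using that by simp
    then have "elem False (int k) = \<one>" by (simp add: elem_def int_pow_int)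
    then show ?thesis using elem_eq_one_iff by simp
  qed
  have even_pow: "elem False a [^] (k::nat) = elem False (a * int k)" for a k
    by (simp add: elem_def int_pow_pow flip: int_pow_int)
  have odd_pow: "elem True a [^] (2 * k :: nat) = elem False ((int (n div 2) + s * a + a) * int k)" for a k
  proof -
    have "elem True a [^] (2 * k) = (elem True a [^] (2::nat)) [^] k" by (simp add: nat_pow_pow)
    also have "elem True a [^] (2::nat) = elem False (int (n div 2) + s * a + a)"
      by (simp add: numeral_2_eq_2 elem_mult)
    finally show ?thesis by (simp add: even_pow)
  qed
  show ?thesis
  proof (cases "n mod 4 = 0")
    case True
    have "elem b a [^] n = \<one>" for b a
    proof (cases b)
      case False
      then show ?thesis using even_pow[of a n] elem_eq_one_iff[of False "a * int n"] by simp
    next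
      case b: True
      have "even (n div 2)" using True by presburger
      then have "even (int (n div 2) + s * a + a)" using odd_s by simp
      then obtain v where v: "int (n div 2) + s * a + a = 2 * v" by (rule evenE)
      have "2 * (n div 2) = n" using n_even by simp
      then have "(int (n div 2) + s * a + a) * int (n div 2) = int n * v" unfolding v by (metis mult.assoc mult.commute of_nat_mult of_nat_numeral)
      then show ?thesis
        using odd_pow[of a "n div 2"] elem_eq_one_iff[of False "int n * v"] b \<open>2 * (n div 2) = n\<close> by simp
    qed
    then have "\<forall>g\<in>carrier G. g [^] n = \<one>" by (metis elem_exists)
    then have "group_exp G = n"
      unfolding group_exp_def using n_pos y_exp by (intro Least_equality) (auto intro: dvd_imp_le)
    then show ?thesis using True by simp
  next
    case False
    then have od: "odd (n div 2)" using n_even by presburger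
    have nn: "2 * (n div 2) = n" using n_even by simp
    have "elem b a [^] (2 * n) = \<one>" for b a
    proof (cases b)
      case False
      then show ?thesis using even_pow[of a "2 * n"] elem_eq_one_iff[of False "a * int (2 * n)"] by simp
    next
      case True
      then show ?thesis
        using odd_pow[of a n] elem_eq_one_iff[of False "(int (n div 2) + s * a + a) * int n"] by simp
    qed
    then have all: "\<forall>g\<in>carrier G. g [^] (2 * n) = \<one>" by (metis elem_exists)
    have "2 * n \<le> k" if k: "0 < k" "\<forall>g\<in>carrier G. g [^] k = \<one>" for k
    proof (rule ccontr)
      assume "\<not> 2 * n \<le> k"
      moreover obtain q where q: "k = n * q" using y_exp[OF k(2)] by (rule dvdE)
      ultimately have "q < 2" by (metis mult.commute mult_le_mono1 not_less)
      moreover have "q \<noteq> 0" using q k(1) by auto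
      ultimately have "k = n" using q by (simp add: less_2_cases_iff)
      then have "elem True 0 [^] (2 * (n div 2)) = \<one>" using k(2) nn by simp
      then have "int n dvd int (n div 2) * int (n div 2)"
        using odd_pow[of 0 "n div 2"] elem_eq_one_iff[of False "int (n div 2) * int (n div 2)"] by simp
      then have "n dvd n div 2 * (n div 2)" by (simp flip: of_nat_mult)
      then have "even (n div 2 * (n div 2))" using n_even by (metis dvd_trans)
      then show False using od by simp
    qed
    then have "group_exp G = 2 * n"
      unfolding group_exp_def using n_pos all by (intro Least_equality) auto
    then show ?thesis using False by simp
  qed
qed

lemma davenport_eq: "davenport G = n"
  unfolding davenport_def
proof (rule Greatest_equality)
  have "product_one_free G (extremal 0)"
    unfolding product_one_free_def using extremal_product_one by fastforce
  then show "\<exists>S. seq_over G S \<and> product_one_free G S \<and> size S = n"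
    using extremal_seq_over size_extremal by (metis add_0)
  show "l \<le> n" if l: "\<exists>S. seq_over G S \<and> product_one_free G S \<and> size S = l" for l
  proof (rule ccontr)
    assume "\<not> l \<le> n"
    moreover obtain S where S: "seq_over G S" "product_one_free G S" "size S = l"
      using l by blast
    ultimately have "size S \<ge> n + 1" by simp
    with S(1) obtain T where "T \<subseteq># S" "1 \<le> size T" "product_one G T" by (rule short_product_one)
    then show False using S(2) unfolding product_one_free_def by fastforce
  qed
qed

text \<open>Common to three invariants, with \<open>i\<close> equal to 0, \<open>2 * n - 1\<close>
  and \<open>group_exp G - 1\<close>. If all admissible lengths exceed \<open>i\<close>, then
  \<open>extremal i\<close>, of length \<open>i + n\<close>, has no admissible product-one
  subsequence.\<close>

lemma least_length_eq:
  assumes "\<And>S. seq_over G S \<Longrightarrow> size S \<ge> i + n + 1 \<Longrightarrow> \<exists>T. T \<subseteq># S \<and> R T \<and> product_one G T"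
    and "\<And>T. R T \<Longrightarrow> i < size T"
  shows "(LEAST l. \<forall>S. seq_over G S \<and> size S \<ge> l \<longrightarrow> (\<exists>T. T \<subseteq># S \<and> R T \<and> product_one G T)) = i + n + 1"
proof (rule Least_equality)
  show "\<forall>S. seq_over G S \<and> size S \<ge> i + n + 1 \<longrightarrow> (\<exists>T. T \<subseteq># S \<and> R T \<and> product_one G T)"
    using assms(1) by blast
  show "i + n + 1 \<le> l" if l: "\<forall>S. seq_over G S \<and> size S \<ge> l \<longrightarrow> (\<exists>T. T \<subseteq># S \<and> R T \<and> product_one G T)" for l
  proof (rule ccontr)
    assume "\<not> i + n + 1 \<le> l"
    then have "size (extremal i) \<ge> l" by (simp add: size_extremal)
    then obtain T where "T \<subseteq># extremal i" "R T" "product_one G T" using l extremal_seq_over by blast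
    then show False using assms(2)[of T] extremal_product_one[of T i] by simp
  qed
qed

lemma eta_eq: "eta_inv G = n + 1"
proof -
  have le: "n \<le> group_exp G" by (simp add: group_exp_eq)
  have "(LEAST l. \<forall>S. seq_over G S \<and> size S \<ge> l \<longrightarrow>
      (\<exists>T. T \<subseteq># S \<and> (1 \<le> size T \<and> size T \<le> group_exp G) \<and> product_one G T)) = 0 + n + 1"
  proof (rule least_length_eq)
    fix S assume S: "seq_over G S" "size S \<ge> 0 + n + 1"
    have "size S \<ge> n + 1" using S(2) by simp
    with S(1) obtain T where "T \<subseteq># S" "1 \<le> size T" "size T \<le> n" "product_one G T" by (rule short_product_one)
    then show "\<exists>T. T \<subseteq># S \<and> (1 \<le> size T \<and> size T \<le> group_exp G) \<and> product_one G T" using le by fastforce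
  qed simp
  then show ?thesis by (simp add: eta_inv_def conj_assoc)
qed

lemma E_eq: "E_inv G = 3 * n"
proof -
  have "(LEAST l. \<forall>S. seq_over G S \<and> size S \<ge> l \<longrightarrow>
      (\<exists>T. T \<subseteq># S \<and> size T = order G \<and> product_one G T)) = (2 * n - 1) + n + 1"
    by (rule least_length_eq) (use double_product_one order_G n_pos in auto)
  then show ?thesis using n_pos by (simp add: E_inv_def)
qed

lemma s_eq: "s_inv G = (if n mod 4 = 0 then 2 * n else 3 * n)"
proof -
  have "(LEAST l. \<forall>S. seq_over G S \<and> size S \<ge> l \<longrightarrow>
      (\<exists>T. T \<subseteq># S \<and> size T = group_exp G \<and> product_one G T)) = (group_exp G - 1) + n + 1"
    by (rule least_length_eq)
      (use double_product_one exact_product_one n_pos in \<open>auto simp: group_exp_eq split: if_splits\<close>)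
  then show ?thesis using n_pos by (simp add: s_inv_def group_exp_eq)
qed

end

theorem theorem1p1:
  fixes G (structure) and x y :: 'a and n :: nat and s :: int
  assumes "group G"
    and "n \<ge> 8" and "even n"
    and "s^2 mod int n = 1 mod int n" and "s mod int n \<noteq> 1 mod int n" and "s mod int n \<noteq> (-1) mod int n"
    and "x \<in> carrier G" and "y \<in> carrier G"
    and "generate G {x, y} = carrier G"
    and "order G = 2 * n"
    and "x [^] (2::nat) = y [^] (n div 2)"
    and "y [^] n = \<one>"
    and "y \<otimes> x = x \<otimes> (y [^] s)"
  shows "davenport G = n \<and> eta_inv G = n + 1
       \<and> s_inv G = (if n mod 4 = 0 then 2 * n else 3 * n)
       \<and> E_inv G = 3 * n"
proof -
  interpret group G by (rule assms(1))
  interpret nonsplit_metacyclic G x y n s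
  proof
    show "int n dvd s\<^sup>2 - 1" using assms(4) by (simp only: mod_eq_dvd_iff)
    show "\<not> int n dvd s - 1" using assms(5) by (simp only: mod_eq_dvd_iff not_False_eq_True)
    show "\<not> int n dvd s + 1" using assms(6) by (simp add: mod_eq_dvd_iff)
  qed (rule assms)+
  show ?thesis using davenport_eq eta_eq s_eq E_eq by blast
qed

end
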